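(* Let a directed graph $\mathcal{G}$ consist of two strong components connected by a cutset with adjacency matrix $\bm{C}$ and write the associated Laplacian as $$\bm{L_W}=\begin{pmatrix}\bm{L}_1&\bm{0}\\-\bm{C}&\bm{L}_2+\bm{D_C}\end{pmatrix}.$$ Assume that $\mathcal{G}$ has a spanning diverging tree. Let $\lambda_2$ be the spectral gap of $\bm{L_W}$. Then, for a generic choice of the nonzero weights of $\bm{L_W}$, the following hold. (i) (Invariance of synchronizability) If $\lambda_2$ is an eigenvalue of $\bm{L}_1$, then the network's synchronizability is invariant under arbitrary structural perturbations $\bm{\Delta}$ in direction of the cutset. (ii) (Improving synchronizability by reinforcing the cutset) If $\lambda_2$ is an eigenvalue of $\bm{L}_2+\bm{D_C}$, then the network's synchronizability increases for arbitrary structural perturbations $\bm{\Delta}$ in direction of the cutset. (iii) (Non-optimality of master-slave configurations) Assume $\lambda_2$ is an eigenvalue of $\bm{L}_2+\bm{D_C}$. Then: (a) There exists a structural perturbation $\bm{\Delta}$ in opposite direction of the cutset such that $s(\bm{\Delta})>0$. (b) There exists a constant $\delta(\bm{L}_1)>0$ and at least one node $1\le k_0\le n$ (in the driving component) such that if $0<\lambda_2<\delta(\bm{L}_1)$, then $s(\bm{\Delta})>0$ for any structural perturbation $\bm{\Delta}$ consisting of only one link in opposite direction of the cutset and ending at node $k_0$. (c) If moreover $\bm{L}_1$ has zero column-sums, then there exists a constant $\delta(\bm{L}_1)>0$ such that if $0<\lambda_2<\delta(\bm{L}_1)$ we have $s(\bm{\Delta})>0$ for any structural perturbation $\bm{\Delta}$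 in opposite direction of the cutset. (iv) (Hindering synchronizability by breaking the master-slave configuration) There exists a cutset $\bm{C}$ for which $\lambda_2$ is an eigenvalue of $\bm{L}_2+\bm{D_C}$ and a perturbation $\bm{\Delta}$ in opposite direction of $\bm{C}$ such that: if $\bm{L}_1$ admits a positive eigenvalue sufficiently small, then we have $s(\bm{\Delta})\le 0$.
   Context: A weighted directed graph on $N$ nodes is given by an adjacency matrix $\bm{W}\in\mathbb{R}^{N\times N}$ with $W_{ij}\ge0$, where $W_{ij}>0$ means there is a link from node $j$ to node $i$ of weight $W_{ij}$. Its Laplacian is $\bm{L_W}=\bm{D_W}-\bm{W}$ with $\bm{D_W}$ diagonal with entries $\sum_jW_{ij}$. Eigenvalues are ordered by real part, $0=\lambda_1\le\Re(\lambda_2)\le\dots\le\Re(\lambda_N)$; $\lambda_2$ is the spectral gap. A strong component is a maximal strongly connected subgraph; the cutset is the maximal set of links connecting the two strong components. A spanning diverging tree is a weakly connected subgraph (containing all nodes) in which one node, the root, has no incoming edges and all other nodes have one incoming edge. In the block form, $N=n+m$, $\bm{L}_1\in\mathbb{R}^{n\times n}$ and $\bm{L}_2\in\mathbb{R}^{m\times m}$ are the Laplacians of the two strong components (the first is the driving, or master, component; the second is the slave component), and $\bm{C}\in\mathbb{R}^{m\times n}$ is the nonnegative adjacency matrix of the cutset pointing from the first to the second component. For a nonnegative matrix $\bm{A}$, $\bm{D_A}$ denotes the diagonal matrix of row sums of $\bm{A}$. A structural perturbation in direction of the cutset is given by a nonzero nonnegative matrix $\bm{\Delta}\in\mathbb{R}^{m\times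 n}$, with perturbed Laplacian $$\bm{L}_p(\bm{\Delta})=\begin{pmatrix}\bm{L}_1&\bm{0}\\-\bm{C}-\bm{\Delta}&\bm{L}_2+\bm{D}_{\bm{C}+\bm{\Delta}}\end{pmatrix}.$$ A structural perturbation in opposite direction of the cutset is given by a nonzero nonnegative matrix $\bm{\Delta}\in\mathbb{R}^{n\times m}$, with $$\bm{L}_p(\bm{\Delta})=\begin{pmatrix}\bm{L}_1+\bm{D}_{\bm{\Delta}}&-\bm{\Delta}\\-\bm{C}&\bm{L}_2+\bm{D_C}\end{pmatrix};$$ it consists of only one link ending at node $k_0$ if its only nonzero entry lies in row $k_0$. When $\lambda_2(\bm{L_W})$ is simple, $s(\bm{\Delta}):=\lim_{\varepsilon\to0}\frac1\varepsilon\big(\lambda_2(\bm{L}_p(\varepsilon\bm{\Delta}))-\lambda_2(\bm{L_W})\big)$. Synchronizability: for the network $\dot{\bm{x}}_i=\bm{f}(\bm{x}_i)+\alpha\sum_jW_{ij}\bm{H}(\bm{x}_j-\bm{x}_i)$ with fixed $\bm{f},\bm{H}$, it is measured by the critical coupling $\alpha_c=\rho/\gamma$, $\gamma=\Re(\lambda_2)\min_j\beta_j>0$, where $\rho$ depends only on $\bm{f}$ and $d\bm{H}(\bm{0})$, and $\beta_j$ are the eigenvalues (assumed real) of $d\bm{H}(\bm{0})$. A network is more synchronizable than another if its $\alpha_c$ is smaller. Hence, with $\bm{f},\bm{H}$ fixed, synchronizability is invariant when $\Re(\lambda_2)$ is unchanged and increases when $\Re(\lambda_2)$ increases. "For a generic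 choice of the nonzero weights" means: fix the set of links and consider all Laplacians of networks with this set of links but potentially different weights; in this set, the subset of Laplacians for which the assertion holds is dense and its complement has Lebesgue measure zero. In particular, simplicity of the eigenvalues of $\bm{L_W}$ is a generic property in this sense. *)

theory Defs
  imports
    "HOL-Analysis.Analysis"
    "Jordan_Normal_Form.Char_Poly"
    "Graph_Theory.Graph_Theory"
begin

subsection \<open>Graphs\<close>

text \<open>
  The nodes are \<open>0, \<dots>, N - 1\<close>. Following Graph_Theory, a link is a pair (tail, head), so the
  weight of the link \<open>(j, i)\<close> from \<open>j\<close> to \<open>i\<close> is the matrix entry \<open>W $$ (i, j)\<close>.
\<close>

definition link_graph :: "nat \<Rightarrow> nat rel \<Rightarrow> nat pair_pre_digraph" where
  "link_graph N E = \<lparr>pverts = {..<N}, parcs = E\<rparr>"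

definition adjacency_on :: "nat \<Rightarrow> nat rel \<Rightarrow> real mat \<Rightarrow> bool" where
  "adjacency_on N E W \<longleftrightarrow> W \<in> carrier_mat N N \<and>
     (\<forall>i<N. \<forall>j<N. 0 \<le> W $$ (i, j) \<and> (0 < W $$ (i, j) \<longleftrightarrow> (j, i) \<in> E))"

text \<open>
  The constant \<open>connected\<close> of Graph_Theory (qualified, because HOL-Analysis has a topological
  notion of that name) is connectedness of the underlying undirected graph, i.e. weak
  connectedness.
\<close>

definition spanning_diverging_tree :: "('a, 'b) pre_digraph \<Rightarrow> ('a, 'b) pre_digraph \<Rightarrow> bool" where
  "spanning_diverging_tree T G \<longleftrightarrow> spanning T G \<and> Digraph_Component.connected T \<and>
     (\<exists>r\<in>verts T. in_degree T r = 0 \<and> (\<forall>v\<in>verts T - {r}. in_degree T v = 1))"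

text \<open>
  Two strong components, on the first \<open>n\<close> and on the last \<open>m\<close> nodes, such that all links between
  them (the cutset) point from the first to the second.
\<close>

definition two_component_graph :: "nat \<Rightarrow> nat \<Rightarrow> nat rel \<Rightarrow> bool" where
  "two_component_graph n m E \<longleftrightarrow> E \<subseteq> {..<n + m} \<times> {..<n + m} \<and>
     pre_digraph.sccs (with_proj (link_graph (n + m) E)) =
       {induce_subgraph (link_graph (n + m) E) {..<n},
        induce_subgraph (link_graph (n + m) E) {n..<n + m}} \<and>
     E \<inter> {n..<n + m} \<times> {..<n} = {}"

subsection \<open>Laplacians\<close>

definition row_sum_mat :: "real mat \<Rightarrow> real mat" where
  "row_sum_mat A = mat_diag (dim_row A) (\<lambda>i. \<Sum>j<dim_col A. A $$ (i, j))"

definition laplacian :: "real mat \<Rightarrow> real mat" where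
  "laplacian W = row_sum_mat W - W"

definition nonneg_mat :: "real mat \<Rightarrow> bool" where
  "nonneg_mat A \<longleftrightarrow> (\<forall>i<dim_row A. \<forall>j<dim_col A. 0 \<le> A $$ (i, j))"

definition master_slave_laplacian :: "real mat \<Rightarrow> real mat \<Rightarrow> real mat \<Rightarrow> real mat" where
  "master_slave_laplacian L1 L2 C =
     four_block_mat L1 (0\<^sub>m (dim_row L1) (dim_col L2)) (- C) (L2 + row_sum_mat C)"

lemma laplacian_master_slave:
  assumes "W1 \<in> carrier_mat n n" "W2 \<in> carrier_mat m m" "C \<in> carrier_mat m n"
  shows "laplacian (four_block_mat W1 (0\<^sub>m n m) C W2)
    = master_slave_laplacian (laplacian W1) (laplacian W2) C"
proof (rule eq_matI)
  have split: "(\<Sum>j<n + m. f j) = (\<Sum>j<n. f j) + (\<Sum>j<m. f (n + j))" for f :: "nat \<Rightarrow> real"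
    by (induction m) (auto simp: algebra_simps)
  fix i j
  assume "i < dim_row (master_slave_laplacian (laplacian W1) (laplacian W2) C)"
    and "j < dim_col (master_slave_laplacian (laplacian W1) (laplacian W2) C)"
  then show "laplacian (four_block_mat W1 (0\<^sub>m n m) C W2) $$ (i, j)
      = master_slave_laplacian (laplacian W1) (laplacian W2) C $$ (i, j)"
    using assms
    by (auto simp: laplacian_def row_sum_mat_def mat_diag_def master_slave_laplacian_def split)
qed (use assms in \<open>auto simp: laplacian_def row_sum_mat_def mat_diag_def
       master_slave_laplacian_def\<close>)

definition structural_perturbation :: "nat \<Rightarrow> nat \<Rightarrow> real mat \<Rightarrow> bool" where
  "structural_perturbation r c \<Delta> \<longleftrightarrow> \<Delta> \<in> carrier_mat r c \<and> nonneg_mat \<Delta> \<and> \<Delta> \<noteq> 0\<^sub>m r c"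

definition perturbed_along :: "real mat \<Rightarrow> real mat \<Rightarrow> real mat \<Rightarrow> real mat \<Rightarrow> real mat" where
  "perturbed_along L1 L2 C \<Delta> =
     four_block_mat L1 (0\<^sub>m (dim_row L1) (dim_col L2)) (- C - \<Delta>) (L2 + row_sum_mat (C + \<Delta>))"

definition perturbed_against :: "real mat \<Rightarrow> real mat \<Rightarrow> real mat \<Rightarrow> real mat \<Rightarrow> real mat" where
  "perturbed_against L1 L2 C \<Delta> =
     four_block_mat (L1 + row_sum_mat \<Delta>) (- \<Delta>) (- C) (L2 + row_sum_mat C)"

definition single_link_to :: "nat \<Rightarrow> real mat \<Rightarrow> bool" where
  "single_link_to k \<Delta> \<longleftrightarrow> (\<exists>l<dim_col \<Delta>. \<forall>i<dim_row \<Delta>. \<forall>j<dim_col \<Delta>.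
     \<Delta> $$ (i, j) \<noteq> 0 \<longleftrightarrow> i = k \<and> j = l)"

definition zero_column_sums :: "real mat \<Rightarrow> bool" where
  "zero_column_sums A \<longleftrightarrow> (\<forall>j<dim_col A. (\<Sum>i<dim_row A. A $$ (i, j)) = 0)"

subsection \<open>Spectral gap and its sensitivity\<close>

abbreviation ev :: "real mat \<Rightarrow> complex \<Rightarrow> bool" where
  "ev A z \<equiv> eigenvalue (map_mat complex_of_real A) z"

text \<open>
  The second entry (list index 1) in an ordering of the eigenvalues, counted with algebraic
  multiplicity, by real part. Eigenvalues with equal real part come in an unspecified order.
\<close>

definition spectral_gap :: "real mat \<Rightarrow> complex" where
  "spectral_gap A = (SOME z. \<exists>es. char_poly (map_mat complex_of_real A) = (\<Prod>e\<leftarrow>es. [:- e, 1:]) \<and>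
     sorted (map Re es) \<and> z = es ! 1)"

definition simple_ev :: "real mat \<Rightarrow> complex \<Rightarrow> bool" where
  "simple_ev A z \<longleftrightarrow> order z (char_poly (map_mat complex_of_real A)) = 1"

text \<open>
  A positive eigenvalue \<open>\<mu>\<close> is sufficiently small if it lies below the real parts of all other nonzero
  eigenvalues. A bound that ignores these is not enough: for a directed cycle of six nodes with
  weights near \<open>\<epsilon>\<close>, the Laplacian has an eigenvalue near \<open>2 \<epsilon>\<close>, yet whenever the slave component
  determines the spectral gap, every link added against the cutset has positive sensitivity.
\<close>

definition sufficiently_small_ev :: "real mat \<Rightarrow> real \<Rightarrow> bool" where
  "sufficiently_small_ev A \<mu> \<longleftrightarrow>
     (\<forall>\<nu>. ev A \<nu> \<and> \<nu> \<noteq> 0 \<and> \<nu> \<noteq> complex_of_real \<mu> \<longrightarrow> \<mu> < Re \<nu>)"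

text \<open>
  The relation \<open>sensitivity L Lp s\<close> says that the number \<open>s(\<Delta>)\<close> is defined and equal to \<open>s\<close>, where
  \<open>L\<close> is the unperturbed Laplacian and \<open>Lp \<epsilon>\<close> the Laplacian perturbed by \<open>\<epsilon> \<Delta>\<close>.
\<close>

definition sensitivity :: "real mat \<Rightarrow> (real \<Rightarrow> real mat) \<Rightarrow> real \<Rightarrow> bool" where
  "sensitivity L Lp s \<longleftrightarrow> simple_ev L (spectral_gap L) \<and>
     ((\<lambda>\<epsilon>. (spectral_gap (Lp \<epsilon>) - spectral_gap L) / complex_of_real \<epsilon>)
        \<longlongrightarrow> complex_of_real s) (at 0)"

abbreviation sens_against ::
    "real mat \<Rightarrow> real mat \<Rightarrow> real mat \<Rightarrow> real mat \<Rightarrow> real \<Rightarrow> bool" where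
  "sens_against L1 L2 C \<Delta> s \<equiv>
     sensitivity (master_slave_laplacian L1 L2 C) (\<lambda>\<epsilon>. perturbed_against L1 L2 C (\<epsilon> \<cdot>\<^sub>m \<Delta>)) s"

subsection \<open>Synchronizability\<close>

text \<open>
  For fixed \<open>f\<close> and \<open>H\<close>, synchronizability depends on these functions only through the number \<open>\<rho>\<close>
  and the eigenvalues of the matrix \<open>B = dH(0)\<close>.
\<close>

definition coupling_data :: "real \<Rightarrow> real mat \<Rightarrow> bool" where
  "coupling_data \<rho> B \<longleftrightarrow> 0 < \<rho> \<and> (\<exists>d>0. B \<in> carrier_mat d d) \<and>
     (\<forall>\<beta>. ev B \<beta> \<longrightarrow> \<beta> \<in> \<real> \<and> 0 < Re \<beta>)"

definition coupling_gamma :: "real mat \<Rightarrow> real mat \<Rightarrow> real" where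
  "coupling_gamma B L = Re (spectral_gap L) * Min (Re ` {\<beta>. ev B \<beta>})"

definition critical_coupling :: "real \<Rightarrow> real mat \<Rightarrow> real mat \<Rightarrow> real" where
  "critical_coupling \<rho> B L = \<rho> / coupling_gamma B L"

definition same_synchronizability :: "real \<Rightarrow> real mat \<Rightarrow> real mat \<Rightarrow> real mat \<Rightarrow> bool" where
  "same_synchronizability \<rho> B L' L \<longleftrightarrow> 0 < coupling_gamma B L \<and> 0 < coupling_gamma B L' \<and>
     critical_coupling \<rho> B L' = critical_coupling \<rho> B L"

definition more_synchronizable :: "real \<Rightarrow> real mat \<Rightarrow> real mat \<Rightarrow> real mat \<Rightarrow> bool" where
  "more_synchronizable \<rho> B L' L \<longleftrightarrow> 0 < coupling_gamma B L \<and> 0 < coupling_gamma B L' \<and>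
     critical_coupling \<rho> B L' < critical_coupling \<rho> B L"

subsection \<open>Genericity\<close>

definition laplacians_on :: "nat \<Rightarrow> nat rel \<Rightarrow> real mat set" where
  "laplacians_on N E = laplacian ` {W. adjacency_on N E W}"

definition weight_mat :: "nat \<Rightarrow> nat rel \<Rightarrow> (nat \<times> nat \<Rightarrow> real) \<Rightarrow> real mat" where
  "weight_mat N E w = mat N N (\<lambda>(i, j). if (j, i) \<in> E then w (j, i) else 0)"

text \<open>
  Lebesgue measure on the Laplacians with a given set of links is Lebesgue measure in the weights of
  these links. The weight of a loop cancels in the Laplacian, so it is a redundant coordinate that
  does not change which sets of Laplacians have measure zero.
\<close>

definition generic_laplacian :: "nat \<Rightarrow> nat rel \<Rightarrow> (real mat \<Rightarrow> bool) \<Rightarrow> bool" where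
  "generic_laplacian N E P \<longleftrightarrow>
     (\<forall>L\<in>laplacians_on N E. \<forall>\<epsilon>>0. \<exists>L'\<in>laplacians_on N E. P L' \<and>
        (\<forall>i<N. \<forall>j<N. \<bar>L' $$ (i, j) - L $$ (i, j)\<bar> < \<epsilon>)) \<and>
     (AE w in Pi\<^sub>M E (\<lambda>_. lborel). (\<forall>e\<in>E. 0 < w e) \<longrightarrow> P (laplacian (weight_mat N E w)))"

end

theory Submission
  imports
    Defs
    "Jordan_Normal_Form.Schur_Decomposition"
begin

text \<open>
  By Perron theory the slave block \<open>M = L2 + D\<^sub>C\<close> has a real simple eigenvalue \<open>t > 0\<close> with positive
  left and right eigenvectors \<open>x\<close> and \<open>y\<close>, all other eigenvalues of \<open>M\<close> have larger real part, and
  \<open>t\<close> increases strictly with each entry of \<open>C\<close>. This gives (i) and (ii), provided that \<open>t\<close> is not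
  the real part of an eigenvalue of \<open>L1\<close>. That is the only genericity needed: by strict
  monotonicity, only finitely many values of one cutset weight violate it when the others are fixed.

  If \<open>\<lambda>\<^sub>2 = t\<close>, the right eigenvector is \<open>(0, y)\<close> and the left one is \<open>(w, x)\<close> with
  \<open>w (L1 - t) = x C\<close>, so that \<open>s(\<Delta>) = - w \<Delta> y / (x \<bullet> y)\<close>. The entries of \<open>w\<close> have a negative sum
  because \<open>L1\<close> annihilates the all-one vector, and for small \<open>t\<close> they are all negative because
  \<open>(L1 - t)\<inverse>\<close> behaves like \<open>-1/t\<close> times the projection onto the null space. For (iv), rank-one
  cutsets give arbitrary \<open>t\<close> and \<open>x C\<close>; close below a positive eigenvalue of \<open>L1\<close> the matrix
  \<open>(L1 - t)\<inverse>\<close> must have a nonnegative entry.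
\<close>

text \<open>The demand for a null set shapes the second half. Finitely many ties on each line
  parallel to one coordinate axis give density at once, but measure zero only through Fubini's
  theorem, which needs a measurable set of ties, whereas ties are defined through eigenvalues. So
  the Perron value is described by countably many rational test vectors, as in the Collatz-Wielandt
  formula, and a shared real part by small values of the characteristic polynomial of
  \<open>L1\<close> at rational heights on a vertical line. The ordering behind
  \<open>spectral_gap\<close> leaves the choice open among equal real parts. Strict separation in
  real part is therefore the form in which the spectral lemmas are stated: it makes the second entry
  of every sorted list the same, for \<open>L\<close> and for limits of lists of perturbed matrices.
  In (iii) a threshold may depend on \<open>L1\<close> but not on the cutset, so the sign of
  \<open>w\<close> has to be controlled uniformly over all nonnegative nonzero right-hand sides
  \<open>x C\<close>.\<close>

lemma finite_convergent_subseq: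
  fixes f :: "nat \<Rightarrow> 'i \<Rightarrow> 'a::heine_borel"
  assumes "finite I" and "\<And>i. i \<in> I \<Longrightarrow> bounded (range (\<lambda>k. f k i))"
  shows "\<exists>r l. strict_mono (r :: nat \<Rightarrow> nat) \<and> (\<forall>i\<in>I. (\<lambda>k. f (r k) i) \<longlonglongrightarrow> l i)"
  using assms
proof (induction I rule: finite_induct)
  case empty
  show ?case using strict_mono_id by blast
next
  case (insert x I)
  then obtain r l where r: "strict_mono r" "\<And>i. i \<in> I \<Longrightarrow> (\<lambda>k. f (r k) i) \<longlonglongrightarrow> l i"
    by auto
  have "bounded (range (\<lambda>k. f (r k) x))"
    using insert.prems[of x] by (rule bounded_subset) auto
  from bounded_imp_convergent_subsequence[OF this]
  obtain b q where q: "strict_mono q" "(\<lambda>k. f (r (q k)) x) \<longlonglongrightarrow> b"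
    by (auto simp: o_def)
  have "(\<lambda>k. f (r (q k)) i) \<longlonglongrightarrow> l i" if "i \<in> I" for i
    using LIMSEQ_subseq_LIMSEQ[OF r(2)[OF that] q(1)] by (simp add: o_def)
  then have "\<forall>i\<in>insert x I. (\<lambda>k. f ((r \<circ> q) k) i) \<longlonglongrightarrow> (l(x := b)) i"
    using insert.hyps q(2) by auto
  then show ?case using strict_mono_o[OF r(1) q(1)] by blast
qed

subsection \<open>Perron theory of irreducible Z-matrices\<close>

text \<open>Irreducibility in terms of cuts: with a link from \<open>j\<close> to \<open>i\<close>
  wherever \<open>a i j < 0\<close>, every nonempty proper set of indices has a link leaving it. The
  proofs apply this to sets of coordinates singled out by a vector, such as its support, so cuts fit
  better than paths.\<close>

definition irreducible_Z :: "nat \<Rightarrow> (nat \<Rightarrow> nat \<Rightarrow> real) \<Rightarrow> bool" where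
  "irreducible_Z n a \<longleftrightarrow> 0 < n \<and> (\<forall>i<n. \<forall>j<n. i \<noteq> j \<longrightarrow> a i j \<le> 0) \<and>
     (\<forall>S. S \<noteq> {} \<and> S \<subset> {..<n} \<longrightarrow> (\<exists>i\<in>{..<n} - S. \<exists>j\<in>S. a i j < 0))"

lemma irreducible_ZD:
  assumes "irreducible_Z n a"
  shows irreducible_Z_dim: "0 < n"
    and irreducible_Z_nonpos: "i < n \<Longrightarrow> j < n \<Longrightarrow> i \<noteq> j \<Longrightarrow> a i j \<le> 0"
    and irreducible_Z_edge: "S \<noteq> {} \<and> S \<subset> {..<n} \<Longrightarrow> \<exists>i\<in>{..<n} - S. \<exists>j\<in>S. a i j < 0"
  using assms by (simp_all add: irreducible_Z_def)

text \<open>The cut condition of the transpose at \<open>S\<close> is the original one at the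
  complement of \<open>S\<close>.\<close>

lemma irreducible_Z_transpose:
  assumes "irreducible_Z n a"
  shows "irreducible_Z n (\<lambda>i j. a j i)"
  unfolding irreducible_Z_def
proof (intro conjI allI impI)
  fix S :: "nat set"
  assume S: "S \<noteq> {} \<and> S \<subset> {..<n}"
  then have "{..<n} - S \<noteq> {} \<and> {..<n} - S \<subset> {..<n}" "{..<n} - ({..<n} - S) = S" by auto
  then show "\<exists>i\<in>{..<n} - S. \<exists>j\<in>S. a j i < 0"
    using irreducible_Z_edge[OF assms, of "{..<n} - S"] by auto
qed (use assms in \<open>auto simp: irreducible_Z_def\<close>)

text \<open>A strong maximum principle. In a row where \<open>v\<close> vanishes the diagonal term
  drops out and all other terms are nonpositive; if that row has a negative entry over the support
  of \<open>v\<close>, the sum is negative, against the assumed lower bound 0.\<close>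

lemma irreducible_Z_positive:
  assumes a: "irreducible_Z n a" and v: "\<And>i. i < n \<Longrightarrow> 0 \<le> v i" "k < n" "v k \<noteq> 0"
    and ge: "\<And>i. i < n \<Longrightarrow> t * v i \<le> (\<Sum>j<n. a i j * v j)" and "i < n"
  shows "0 < v i"
proof (rule ccontr)
  assume "\<not> 0 < v i"
  define S where "S = {j. j < n \<and> 0 < v j}"
  have "k \<in> S" using v(1)[of k] v(2,3) by (auto simp: S_def)
  moreover have "i \<notin> S" using \<open>\<not> 0 < v i\<close> by (auto simp: S_def)
  ultimately have "S \<noteq> {} \<and> S \<subset> {..<n}" using \<open>i < n\<close> by (auto simp: S_def)
  then obtain p j where pj: "p \<in> {..<n} - S" "j \<in> S" "a p j < 0"
    using irreducible_Z_edge[OF a, of S] by blast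
  then have p0: "v p = 0" using v(1)[of p] by (auto simp: S_def)
  have "(\<Sum>j<n. a p j * v j) < (\<Sum>j<n. 0)"
  proof (rule sum_strict_mono_ex1)
    show "\<forall>x\<in>{..<n}. a p x * v x \<le> 0"
    proof
      fix x assume "x \<in> {..<n}"
      then show "a p x * v x \<le> 0"
        using irreducible_Z_nonpos[OF a, of p x] v(1)[of x] p0 pj(1)
          by (cases "x = p") (auto simp: mult_nonpos_nonneg)
    qed
    show "\<exists>x\<in>{..<n}. a p x * v x < 0"
      using pj by (intro bexI[of _ j]) (auto simp: S_def mult_neg_pos)
  qed simp
  then show False using ge[of p] pj p0 by simp
qed

text \<open>Subtract from \<open>r\<close> the largest multiple of \<open>v\<close> that leaves a
  nonnegative vector. The difference has a zero coordinate and lies in the same eigenspace, so by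
  the maximum principle it vanishes.\<close>

lemma irreducible_Z_kernel:
  fixes r v :: "nat \<Rightarrow> real"
  assumes a: "irreducible_Z n a" and v: "\<And>i. i < n \<Longrightarrow> 0 < v i"
    and av: "\<And>i. i < n \<Longrightarrow> (\<Sum>j<n. a i j * v j) = t * v i"
    and ar: "\<And>i. i < n \<Longrightarrow> (\<Sum>j<n. a i j * r j) = t * r i"
  shows "\<exists>c. \<forall>i<n. r i = c * v i"
proof -
  have ne: "{..<n} \<noteq> {}" using a by (auto simp: irreducible_Z_def lessThan_empty_iff)
  define c where "c = Min ((\<lambda>i. r i / v i) ` {..<n})"
  have "c \<in> (\<lambda>i. r i / v i) ` {..<n}" unfolding c_def using ne by (intro Min_in) auto
  then obtain k where k: "k < n" "c = r k / v k" by auto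
  have ge: "c \<le> r i / v i" if "i < n" for i unfolding c_def using that by (intro Min_le) auto
  define w where "w i = r i - c * v i" for i
  have w0: "0 \<le> w i" if "i < n" for i
    using ge[OF that] v[OF that] by (simp add: w_def field_simps)
  have aw: "(\<Sum>j<n. a i j * w j) = t * w i" if "i < n" for i
    using av[OF that] ar[OF that]
    by (simp add: w_def algebra_simps sum_subtractf flip: sum_distrib_left)
  have wk: "w k = 0" using k v[OF k(1)] by (simp add: w_def)
  have "w i = 0" if "i < n" for i
  proof (rule ccontr)
    assume "w i \<noteq> 0"
    then have "0 < w k"
      using aw k(1) by (intro irreducible_Z_positive[OF a w0 that, where t = t]) auto
    then show False using wk by simp
  qed
  then show ?thesis by (intro exI[of _ c]) (auto simp: w_def)
qed

lemma irreducible_Z_complex_kernel: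
  fixes y :: "nat \<Rightarrow> complex"
  assumes a: "irreducible_Z n a" and v: "\<And>i. i < n \<Longrightarrow> 0 < v i"
    and av: "\<And>i. i < n \<Longrightarrow> (\<Sum>j<n. a i j * v j) = t * v i"
    and ay: "\<And>i. i < n \<Longrightarrow> (\<Sum>j<n. of_real (a i j) * y j) = of_real t * y i"
  shows "\<exists>c. \<forall>i<n. y i = c * of_real (v i)"
proof -
  have "(\<Sum>j<n. a i j * Re (y j)) = t * Re (y i)" "(\<Sum>j<n. a i j * Im (y j)) = t * Im (y i)"
    if "i < n" for i
    using arg_cong[OF ay[OF that], of Re] arg_cong[OF ay[OF that], of Im] by simp_all
  then obtain c d where "\<forall>i<n. Re (y i) = c * v i" "\<forall>i<n. Im (y i) = d * v i"
    using irreducible_Z_kernel[OF a v av, where r = "\<lambda>i. Re (y i)"]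
      irreducible_Z_kernel[OF a v av, where r = "\<lambda>i. Im (y i)"] by blast
  then show ?thesis by (intro exI[of _ "Complex c d"]) (simp add: complex_eq_iff)
qed

text \<open>Gershgorin's disc after scaling coordinates by \<open>v\<close>, in a row that maximizes
  \<open>cmod (y i) / v i\<close>: its centre is \<open>a i i\<close> and its radius
  \<open>a i i - t\<close>, so \<open>t\<close> is its leftmost point and the only one with real
  part at most \<open>t\<close>.\<close>

lemma irreducible_Z_eigenvalue:
  fixes y :: "nat \<Rightarrow> complex"
  assumes a: "irreducible_Z n a" and v: "\<And>i. i < n \<Longrightarrow> 0 < v i"
    and av: "\<And>i. i < n \<Longrightarrow> (\<Sum>j<n. a i j * v j) = t * v i"
    and ay: "\<And>i. i < n \<Longrightarrow> (\<Sum>j<n. of_real (a i j) * y j) = z * y i"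
    and y: "k < n" "y k \<noteq> 0"
  shows "z = of_real t \<or> t < Re z"
proof -
  define M where "M = Max ((\<lambda>i. cmod (y i) / v i) ` {..<n})"
  have "M \<in> (\<lambda>i. cmod (y i) / v i) ` {..<n}" unfolding M_def using y(1) by (intro Max_in) auto
  then obtain i where i: "i < n" "M = cmod (y i) / v i" by auto
  have le: "cmod (y j) \<le> M * v j" if "j < n" for j
  proof -
    have "cmod (y j) / v j \<le> M" unfolding M_def using that by (intro Max_ge) auto
    then show ?thesis using v[OF that] by (simp add: field_simps)
  qed
  have "0 < cmod (y k) / v k" using y v by simp
  moreover have "cmod (y k) / v k \<le> M" using le[OF y(1)] v[OF y(1)] by (simp add: field_simps)
  ultimately have M: "0 < M" by linarith
  have yi: "cmod (y i) = M * v i" using i v[OF i(1)] by simp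
  have s1: "(\<Sum>j<n. of_real (a i j) * y j) = of_real (a i i) * y i + (\<Sum>j\<in>{..<n}-{i}. of_real (a i j) * y j)"
    using i(1) by (subst sum.remove[of _ i]) auto
  have s2: "(\<Sum>j<n. a i j * v j) = a i i * v i + (\<Sum>j\<in>{..<n}-{i}. a i j * v j)"
    using i(1) by (subst sum.remove[of _ i]) auto
  have "(z - of_real (a i i)) * y i = (\<Sum>j\<in>{..<n}-{i}. of_real (a i j) * y j)"
    using ay[OF i(1)] s1 by (simp add: algebra_simps)
  then have "cmod (z - of_real (a i i)) * cmod (y i) \<le> (\<Sum>j\<in>{..<n}-{i}. cmod (of_real (a i j) * y j))"
    by (metis norm_mult norm_sum)
  also have "\<dots> \<le> (\<Sum>j\<in>{..<n}-{i}. - a i j * (M * v j))"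
  proof (rule sum_mono)
    fix j assume j: "j \<in> {..<n} - {i}"
    then have "a i j \<le> 0" using a i(1) by (auto simp: irreducible_Z_def)
    then show "cmod (of_real (a i j) * y j) \<le> - a i j * (M * v j)"
      using mult_left_mono[OF le[of j], of "- a i j"] j by (simp add: norm_mult)
  qed
  also have "\<dots> = - M * (\<Sum>j\<in>{..<n}-{i}. a i j * v j)"
    by (simp add: sum_distrib_left sum_negf algebra_simps)
  also have "\<dots> = (a i i - t) * (M * v i)"
    using av[OF i(1)] s2 by (simp add: algebra_simps)
  finally have "cmod (z - of_real (a i i)) * (M * v i) \<le> (a i i - t) * (M * v i)"
    by (simp only: yi)
  then have disc: "cmod (z - of_real (a i i)) \<le> a i i - t"
    using M v[OF i(1)] by (simp add: mult_le_cancel_right)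
  show ?thesis
  proof (rule disjCI)
    assume "\<not> t < Re z"
    then have "a i i - t \<le> a i i - Re z" by simp
    have "0 \<le> a i i - t" using disc norm_ge_zero by (rule order_trans[rotated])
    have "(cmod (z - of_real (a i i)))\<^sup>2 = (a i i - Re z)\<^sup>2 + (Im z)\<^sup>2"
      by (simp add: cmod_power2 power2_commute)
    moreover have "(cmod (z - of_real (a i i)))\<^sup>2 \<le> (a i i - t)\<^sup>2"
      using disc by (intro power_mono) auto
    moreover have "(a i i - t)\<^sup>2 \<le> (a i i - Re z)\<^sup>2"
      using \<open>0 \<le> a i i - t\<close> \<open>a i i - t \<le> a i i - Re z\<close> by (intro power_mono) auto
    ultimately have "(Im z)\<^sup>2 \<le> 0" "(a i i - Re z)\<^sup>2 \<le> (a i i - t)\<^sup>2"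
      using zero_le_power2[of "Im z"] by linarith+
    moreover from this(2) have "a i i - Re z \<le> a i i - t"
      using \<open>0 \<le> a i i - t\<close> by (rule power2_le_imp_le)
    ultimately have "Im z = 0" "a i i - Re z \<le> a i i - t" by simp_all
    then show "z = of_real t"
      using \<open>a i i - t \<le> a i i - Re z\<close> by (simp add: complex_eq_iff)
  qed
qed

text \<open>
  The Perron value is the least \<open>t\<close> that admits a nonnegative \<open>v \<noteq> 0\<close> with \<open>A v \<le> t v\<close>. At the
  minimum, raising \<open>v\<close> in a coordinate where the inequality is strict makes it strict at the
  out-neighbours of that coordinate as well, so a strict coordinate would spread to all.
\<close>

lemma irreducible_Z_perron:
  assumes a: "irreducible_Z n a"
  shows "\<exists>t v. (\<forall>i<n. 0 < v i) \<and> (\<forall>i<n. (\<Sum>j<n. a i j * v j) = t * v i)"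
proof -
  have n: "0 < n" using a by (simp add: irreducible_Z_def)
  define adm where "adm t v \<longleftrightarrow> (\<forall>i<n. 0 \<le> v i) \<and> (\<exists>i<n. v i \<noteq> 0) \<and>
    (\<forall>i<n. (\<Sum>j<n. a i j * v j) \<le> t * v i)" for t :: real and v :: "nat \<Rightarrow> real"
  \<comment> \<open>Admissibility is homogeneous in the vector, so it may be normalized; this keeps
    a minimizing sequence in a compact simplex.\<close>
  define T where "T = {t. \<exists>v. adm t v \<and> sum v {..<n} = 1}"
  have T_I: "t \<in> T" if adm: "adm t v" for t v
  proof -
    obtain k where k: "k < n" "v k \<noteq> 0" and nn: "\<forall>i<n. 0 \<le> v i" using adm unfolding adm_def by blast
    have "0 < sum v {..<n}"
      using k nn by (intro sum_pos2[of _ k]) (auto simp: less_le)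
    then have "adm t (\<lambda>i. v i / sum v {..<n})" "(\<Sum>i<n. v i / sum v {..<n}) = 1"
      using that by (auto simp: adm_def simp flip: sum_divide_distrib intro!: divide_right_mono)
    then show ?thesis unfolding T_def by blast
  qed
  have unit: "0 \<le> v i" "v i \<le> 1" if "adm t v" "sum v {..<n} = 1" "i < n" for t v i
    using that member_le_sum[of i "{..<n}" v] by (auto simp: adm_def)
  \<comment> \<open>The off-diagonal entries of column 0 are nonpositive, so the first unit vector
    is admissible for \<open>a 0 0\<close> and the infimum is over a nonempty set.\<close>
  have "adm (a 0 0) (\<lambda>i. if i = 0 then 1 else 0)"
    using n a by (auto simp: adm_def irreducible_Z_def if_distrib cong: if_cong)
  then have "T \<noteq> {}" using T_I by blast
  have lower: "- (\<Sum>i<n. \<Sum>j<n. \<bar>a i j\<bar>) \<le> t" if "t \<in> T" for t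
  proof -
    obtain v where v: "adm t v" "sum v {..<n} = 1" using \<open>t \<in> T\<close> by (auto simp: T_def)
    have "- (\<Sum>i<n. \<Sum>j<n. \<bar>a i j\<bar>) = (\<Sum>i<n. \<Sum>j<n. - \<bar>a i j\<bar>)"
      by (simp add: sum_negf)
    also have "\<dots> \<le> (\<Sum>i<n. \<Sum>j<n. a i j * v j)"
    proof (intro sum_mono)
      fix i j assume "j \<in> {..<n}"
      then have "\<bar>a i j * v j\<bar> \<le> \<bar>a i j\<bar>"
        using unit[OF v, of j] by (auto simp: abs_mult intro: mult_left_le)
      then show "- \<bar>a i j\<bar> \<le> a i j * v j" by linarith
    qed
    also have "\<dots> \<le> (\<Sum>i<n. t * v i)" using v by (intro sum_mono) (auto simp: adm_def)
    also have "\<dots> = t" using v by (simp flip: sum_distrib_left)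
    finally show ?thesis .
  qed
  then have bdd: "bdd_below T" by (auto simp: bdd_below_def)
  define t where "t = Inf T"
  have t_le: "t \<le> s" if "adm s v" for s v
    unfolding t_def using T_I[OF that] bdd by (rule cInf_lower)
  have "t \<in> closure T" unfolding t_def using \<open>T \<noteq> {}\<close> bdd by (rule closure_contains_Inf)
  then obtain s where s: "\<And>k. s k \<in> T" "s \<longlonglongrightarrow> t" by (auto simp: closure_sequential)
  then obtain v where v: "\<And>k. adm (s k) (v k)" "\<And>k. sum (v k) {..<n} = 1"
    unfolding T_def by simp metis
  have "\<exists>r l. strict_mono (r :: nat \<Rightarrow> nat) \<and> (\<forall>i\<in>{..<n}. (\<lambda>k. v (r k) i) \<longlonglongrightarrow> l i)"
  proof (rule finite_convergent_subseq)
    fix i assume "i \<in> {..<n}"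
    then show "bounded (range (\<lambda>k. v k i))"
      using unit[OF v] by (intro boundedI[of _ 1]) auto
  qed simp
  then obtain r w where r: "strict_mono (r :: nat \<Rightarrow> nat)"
    and w: "\<And>i. i < n \<Longrightarrow> (\<lambda>k. v (r k) i) \<longlonglongrightarrow> w i" by auto
  have "adm t w"
    unfolding adm_def
  proof (intro conjI allI impI)
    fix i assume i: "i < n"
    show "0 \<le> w i" using w[OF i] unit[OF v i] by (auto intro: LIMSEQ_le_const)
    have "(\<lambda>k. s (r k)) \<longlonglongrightarrow> t" using LIMSEQ_subseq_LIMSEQ[OF s(2) r] by (simp add: o_def)
    then show "(\<Sum>j<n. a i j * w j) \<le> t * w i"
      using v(1) i by (intro LIMSEQ_le[of "\<lambda>k. \<Sum>j<n. a i j * v (r k) j" _ "\<lambda>k. s (r k) * v (r k) i"])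
        (auto intro!: tendsto_intros w simp: adm_def)
  next
    have "(\<lambda>k. sum (v (r k)) {..<n}) \<longlonglongrightarrow> sum w {..<n}" by (auto intro!: tendsto_intros w)
    then have "sum w {..<n} = 1" by (simp add: v(2) LIMSEQ_const_iff)
    then show "\<exists>i<n. w i \<noteq> 0" by (metis lessThan_iff sum.neutral zero_neq_one)
  qed
  \<comment> \<open>Among the admissible vectors for the least \<open>t\<close>, one with the most
    strict coordinates is taken; a vector with more of them is then a contradiction.\<close>
  define S where "S v = {i. i < n \<and> (\<Sum>j<n. a i j * v j) < t * v i}" for v
  have fS: "finite (S v)" "S v \<subseteq> {..<n}" for v by (auto simp: S_def)
  have "\<forall>v. adm t v \<longrightarrow> card (S v) < Suc n"
    using card_mono[OF finite_lessThan fS(2)] by (simp add: less_Suc_eq_le)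
  from ex_has_greatest_nat[of "adm t", OF \<open>adm t w\<close> this]
  obtain x where x: "adm t x" and max: "\<And>y. adm t y \<Longrightarrow> card (S y) \<le> card (S x)" by auto
  have "S x \<noteq> {..<n}"
  proof
    assume all: "S x = {..<n}"
    define d where "d = Min ((\<lambda>i. t * x i - (\<Sum>j<n. a i j * x j)) ` {..<n})"
    have "d \<in> (\<lambda>i. t * x i - (\<Sum>j<n. a i j * x j)) ` {..<n}"
      unfolding d_def using n by (intro Min_in) auto
    then obtain p where p: "p \<in> S x" "d = t * x p - (\<Sum>j<n. a p j * x j)" using all by auto
    then have d: "0 < d" by (simp add: S_def)
    have d_le: "d \<le> t * x i - (\<Sum>j<n. a i j * x j)" if "i < n" for i
      unfolding d_def using that by (intro Min_le) auto
    have x0: "\<forall>i<n. 0 \<le> x i" using x by (auto simp: adm_def)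
    then have sx: "0 < 1 + sum x {..<n}" by (intro add_pos_nonneg sum_nonneg) auto
    \<comment> \<open>Lowering \<open>t\<close> costs row \<open>i\<close> a multiple of
      \<open>x i\<close>. The divisor \<open>1 + sum x {..<n}\<close> dominates every
      \<open>x i\<close>, so a single decrement fits within the slack \<open>d\<close> of all
      rows.\<close>
    have "adm (t - d / (1 + sum x {..<n})) x"
      unfolding adm_def
    proof (intro conjI allI impI)
      fix i assume i: "i < n"
      have "x i \<le> 1 + sum x {..<n}" using member_le_sum[of i "{..<n}" x] x0 i by auto
      then have "d * x i \<le> d * (1 + sum x {..<n})" using d by (intro mult_left_mono) auto
      then have "d / (1 + sum x {..<n}) * x i \<le> d" using sx by (simp add: field_simps)
      then show "(\<Sum>j<n. a i j * x j) \<le> (t - d / (1 + sum x {..<n})) * x i"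
        using d_le[OF i] by (simp add: algebra_simps)
    qed (use x in \<open>auto simp: adm_def\<close>)
    then have "t \<le> t - d / (1 + sum x {..<n})" by (rule t_le)
    then show False using d sx by (simp add: field_simps)
  qed
  have "S x = {}"
  proof (rule ccontr)
    assume "S x \<noteq> {}"
    then have "S x \<noteq> {} \<and> S x \<subset> {..<n}" using fS(2) \<open>S x \<noteq> {..<n}\<close> by blast
    then obtain i j where ij: "i < n" "i \<notin> S x" "j \<in> S x" "a i j < 0"
      using irreducible_Z_edge[OF a, of "S x"] by blast
    define d where "d = t * x j - (\<Sum>k<n. a j k * x k)"
    have j: "j < n" and d: "0 < d" using ij(3) by (auto simp: S_def d_def)
    \<comment> \<open>\<open>K\<close> is a positive bound for \<open>a j j - t\<close> whatever its
      sign, so raising coordinate \<open>j\<close> by \<open>d / (2 * K)\<close> uses up at most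
      half of its slack.\<close>
    define K where "K = \<bar>a j j - t\<bar> + 1"
    have K: "0 < K" "a j j - t \<le> K" unfolding K_def by (auto intro: add_nonneg_pos)
    define e where "e = d / (2 * K)"
    have e: "0 < e" using d K unfolding e_def by (intro divide_pos_pos) auto
    have "e * (a j j - t) \<le> e * K" using e K by (intro mult_left_mono) auto
    also have "\<dots> = d / 2" using K by (simp add: e_def field_simps)
    finally have ej: "e * (a j j - t) < d" using d by linarith
    define y where "y k = x k + (if k = j then e else 0)" for k
    have ay: "(\<Sum>k<n. a p k * y k) = (\<Sum>k<n. a p k * x k) + a p j * e" for p
    proof -
      have "a p k * y k = a p k * x k + (if k = j then a p j * e else 0)" for k
        by (simp add: y_def algebra_simps)
      then show ?thesis using j by (simp add: sum.distrib)
    qed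
    have le: "(\<Sum>k<n. a p k * y k) \<le> t * y p" "p \<in> S x \<or> p = i \<Longrightarrow> (\<Sum>k<n. a p k * y k) < t * y p"
      if "p < n" for p
    proof -
      have apx: "(\<Sum>k<n. a p k * x k) \<le> t * x p" using x that by (auto simp: adm_def)
      have pS: "p \<in> S x \<Longrightarrow> (\<Sum>k<n. a p k * x k) < t * x p" by (auto simp: S_def)
      consider "p = j" | "p \<noteq> j" by blast
      then have "(\<Sum>k<n. a p k * y k) \<le> t * y p \<and>
        (p \<in> S x \<or> p = i \<longrightarrow> (\<Sum>k<n. a p k * y k) < t * y p)"
      proof cases
        case 1
        then show ?thesis using ej ay[of j] by (simp add: y_def d_def algebra_simps)
      next
        case 2
        then have "a p j * e \<le> 0" "p = i \<Longrightarrow> a p j * e < 0"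
          using a that j e ij(4) by (auto simp: irreducible_Z_def mult_nonpos_nonneg mult_neg_pos)
        then show ?thesis using 2 ay[of p] apx pS by (auto simp: y_def)
      qed
      then show "(\<Sum>k<n. a p k * y k) \<le> t * y p"
        "p \<in> S x \<or> p = i \<Longrightarrow> (\<Sum>k<n. a p k * y k) < t * y p" by auto
    qed
    have "adm t y"
      unfolding adm_def
    proof (intro conjI allI impI)
      show "\<exists>k<n. y k \<noteq> 0" using j e x by (intro exI[of _ j]) (auto simp: y_def adm_def add_nonneg_eq_0_iff)
    qed (use x e le in \<open>auto simp: y_def adm_def\<close>)
    moreover have "insert i (S x) \<subseteq> S y" using le ij(1) fS(2) by (auto simp: S_def)
    then have "card (insert i (S x)) \<le> card (S y)" by (rule card_mono[OF fS(1)])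
    ultimately show False using max[of y] ij(2) fS(1) by simp
  qed
  then have eq: "\<forall>i<n. (\<Sum>j<n. a i j * x j) = t * x i"
    using x by (auto simp: S_def adm_def order_less_le)
  moreover have "0 < x i" if "i < n" for i
  proof -
    obtain k where "k < n" "x k \<noteq> 0" using x unfolding adm_def by blast
    with eq x that show ?thesis
      by (intro irreducible_Z_positive[OF a, of x k t]) (auto simp: adm_def)
  qed
  ultimately show ?thesis by blast
qed

text \<open>Stated over a commutative ring because it is applied both to real Perron vectors and to
  complex eigenvectors.\<close>

lemma left_right_pairing:
  fixes a :: "nat \<Rightarrow> nat \<Rightarrow> 'a::comm_ring_1"
  assumes "\<And>j. j < n \<Longrightarrow> (\<Sum>i<n. x i * a i j) = t * x j"
  shows "(\<Sum>i<n. x i * (\<Sum>j<n. a i j * y j)) = t * (\<Sum>i<n. x i * y i)"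
proof -
  have "(\<Sum>i<n. x i * (\<Sum>j<n. a i j * y j)) = (\<Sum>j<n. (\<Sum>i<n. x i * a i j) * y j)"
    unfolding sum_distrib_left sum_distrib_right by (subst sum.swap) (simp add: algebra_simps)
  also have "\<dots> = (\<Sum>j<n. t * x j * y j)" using assms by simp
  finally show ?thesis by (simp add: sum_distrib_left algebra_simps)
qed

text \<open>The transpose has a positive eigenvector for some value \<open>s\<close>. Its pairing
  with \<open>v\<close> is positive, and evaluating the bilinear form from both sides gives
  \<open>s = t\<close>.\<close>

lemma irreducible_Z_left_perron:
  assumes a: "irreducible_Z n a" and v: "\<And>i. i < n \<Longrightarrow> 0 < v i"
    and av: "\<And>i. i < n \<Longrightarrow> (\<Sum>j<n. a i j * v j) = t * v i"
  shows "\<exists>u. (\<forall>i<n. 0 < u i) \<and> (\<forall>j<n. (\<Sum>i<n. u i * a i j) = t * u j)"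
proof -
  obtain s u where u: "\<forall>i<n. 0 < u i" "\<forall>j<n. (\<Sum>i<n. u i * a i j) = s * u j"
    using irreducible_Z_perron[OF irreducible_Z_transpose[OF a]] by (auto simp: mult.commute)
  have "s * (\<Sum>i<n. u i * v i) = (\<Sum>i<n. u i * (\<Sum>j<n. a i j * v j))"
    using u(2) by (intro left_right_pairing[symmetric]) auto
  also have "\<dots> = t * (\<Sum>i<n. u i * v i)"
    using av by (simp add: sum_distrib_left algebra_simps)
  finally have "s * (\<Sum>i<n. u i * v i) = t * (\<Sum>i<n. u i * v i)" .
  moreover have "0 < (\<Sum>i<n. u i * v i)"
    using a u(1) v by (intro sum_pos) (auto simp: irreducible_Z_def)
  ultimately have "s = t" by simp
  then show ?thesis using u by blast
qed

subsection \<open>Eigenvalues and characteristic polynomials\<close>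

lemma poly_linear_factors_eq_0_iff:
  fixes z :: "'a::idom"
  shows "poly (\<Prod>e\<leftarrow>es. [:- e, 1:]) z = 0 \<longleftrightarrow> z \<in> set es"
  by (induction es) auto

abbreviation cpoly :: "real mat \<Rightarrow> complex poly" where
  "cpoly A \<equiv> char_poly (map_mat complex_of_real A)"

lemma ev_iff_cpoly_root:
  assumes "A \<in> carrier_mat n n"
  shows "ev A z \<longleftrightarrow> poly (cpoly A) z = 0"
  using assms by (intro eigenvalue_root_char_poly) auto

lemma ev_iff:
  assumes A: "A \<in> carrier_mat n n"
  shows "ev A z \<longleftrightarrow> (\<exists>y. (\<exists>i<n. y i \<noteq> 0) \<and> (\<forall>i<n. (\<Sum>j<n. of_real (A $$ (i, j)) * y j) = z * y i))"
proof
  assume "ev A z"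
  then obtain v where v: "v \<in> carrier_vec n" "v \<noteq> 0\<^sub>v n" "map_mat complex_of_real A *\<^sub>v v = z \<cdot>\<^sub>v v"
    using A by (auto simp: eigenvalue_def eigenvector_def)
  have "(\<Sum>j<n. of_real (A $$ (i, j)) * v $ j) = z * v $ i" if "i < n" for i
    using arg_cong[OF v(3), of "\<lambda>w. w $ i"] A v(1) that
    by (simp add: scalar_prod_def atLeast0LessThan)
  moreover have "\<exists>i<n. v $ i \<noteq> 0" using v(1,2) by (metis eq_vecI carrier_vecD index_zero_vec)
  ultimately show "\<exists>y. (\<exists>i<n. y i \<noteq> 0) \<and> (\<forall>i<n. (\<Sum>j<n. of_real (A $$ (i, j)) * y j) = z * y i)"
    by blast
next
  assume "\<exists>y. (\<exists>i<n. y i \<noteq> 0) \<and> (\<forall>i<n. (\<Sum>j<n. of_real (A $$ (i, j)) * y j) = z * y i)"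
  then obtain y k where y: "k < n" "y k \<noteq> 0"
    "\<And>i. i < n \<Longrightarrow> (\<Sum>j<n. of_real (A $$ (i, j)) * y j) = z * y i" by blast
  have "map_mat complex_of_real A *\<^sub>v vec n y = z \<cdot>\<^sub>v vec n y"
    using A y(3) by (intro eq_vecI) (auto simp: scalar_prod_def atLeast0LessThan)
  moreover have "vec n y \<noteq> 0\<^sub>v n"
    using y(1,2) by (metis index_vec index_zero_vec(1))
  ultimately show "ev A z" using A by (auto simp: eigenvalue_def eigenvector_def intro!: exI[of _ "vec n y"])
qed

lemma finite_ev: "A \<in> carrier_mat n n \<Longrightarrow> finite {z. ev A z}"
  by (subst ev_iff_cpoly_root[of A n]) (auto intro!: poly_roots_finite dest!: degree_monic_char_poly[of "map_mat complex_of_real A" n, OF map_carrier_mat[THEN iffD2]])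

lemma ev_exists:
  assumes "A \<in> carrier_mat n n" "0 < n"
  shows "\<exists>z. ev A z"
proof -
  have "degree (cpoly A) = n" using assms(1) by (simp add: degree_monic_char_poly)
  then have "\<not> constant (poly (cpoly A))" using assms(2) by (simp add: constant_degree)
  then show ?thesis using ev_iff_cpoly_root[OF assms(1)] fundamental_theorem_of_algebra by blast
qed

text \<open>Crude, but bounded along a convergent sequence of matrices, which is what compactness of
  the lists of eigenvalues asks for.\<close>

lemma norm_ev_le:
  assumes A: "A \<in> carrier_mat n n" and "ev A z"
  shows "cmod z \<le> (\<Sum>i<n. \<Sum>j<n. \<bar>A $$ (i, j)\<bar>)"
proof -
  obtain y k where y: "k < n" "y k \<noteq> 0"
    "\<And>i. i < n \<Longrightarrow> (\<Sum>j<n. of_real (A $$ (i, j)) * y j) = z * y i"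
    using \<open>ev A z\<close> ev_iff[OF A] by blast
  define s where "s = (\<Sum>i<n. cmod (y i))"
  have s: "0 < s" using y(1,2) unfolding s_def by (intro sum_pos2[of _ k]) auto
  have "cmod z * s = (\<Sum>i<n. cmod (\<Sum>j<n. of_real (A $$ (i, j)) * y j))"
    using y(3) by (simp add: s_def sum_distrib_left norm_mult)
  also have "\<dots> \<le> (\<Sum>i<n. \<Sum>j<n. \<bar>A $$ (i, j)\<bar> * s)"
  proof (intro sum_mono order_trans[OF norm_sum])
    fix i j assume "j \<in> {..<n}"
    then have "cmod (y j) \<le> s" unfolding s_def by (intro member_le_sum) auto
    then show "cmod (of_real (A $$ (i, j)) * y j) \<le> \<bar>A $$ (i, j)\<bar> * s"
      by (simp add: norm_mult mult_left_mono)
  qed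
  finally show ?thesis using s by (simp flip: sum_distrib_right)
qed

text \<open>The Leibniz expansion shows the value as a polynomial in the entries; continuity and,
  later, measurability in the entries are read off from it.\<close>

lemma poly_char_poly:
  fixes A :: "'a::field mat"
  assumes A: "A \<in> carrier_mat n n"
  shows "poly (char_poly A) x = (\<Sum>p | p permutes {0..<n}. signof p *
     (\<Prod>i = 0..<n. (if i = p i then x else 0) - A $$ (i, p i)))"
proof -
  have "- char_matrix A x \<in> carrier_mat n n" using A by (auto simp: char_matrix_def)
  moreover have "(- char_matrix A x) $$ (i, p i) = (if i = p i then x else 0) - A $$ (i, p i)"
    if "p permutes {0..<n}" "i \<in> {0..<n}" for p i
    using A permutes_in_image[OF that(1), of i] that(2) by (auto simp: char_matrix_def)
  ultimately show ?thesis
    unfolding char_poly_matrix[OF A]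
    by (subst det_def'[of _ n]) (auto intro!: sum.cong prod.cong arg_cong2[of _ _ _ _ "(*)"])
qed

lemma tendsto_poly_cpoly:
  assumes "\<And>k. A k \<in> carrier_mat n n" "B \<in> carrier_mat n n"
    and "\<And>i j. i < n \<Longrightarrow> j < n \<Longrightarrow> (\<lambda>k. A k $$ (i, j)) \<longlonglongrightarrow> B $$ (i, j)"
  shows "(\<lambda>k. poly (cpoly (A k)) x) \<longlonglongrightarrow> poly (cpoly B) x"
proof -
  have "(\<lambda>k. map_mat complex_of_real (A k) $$ (i, p i)) \<longlonglongrightarrow> map_mat complex_of_real B $$ (i, p i)"
    if "p permutes {0..<n}" "i \<in> {0..<n}" for p i
  proof -
    have "i < n" "p i < n" using permutes_in_image[OF that(1), of i] that(2) by auto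
    moreover from this have "map_mat complex_of_real (A k) $$ (i, p i) = of_real (A k $$ (i, p i))" for k
      using assms(1)[of k] by auto
    ultimately show ?thesis using assms by (auto intro!: tendsto_of_real)
  qed
  then show ?thesis
    using assms(1,2) by (subst (1 2) poly_char_poly[of _ n]) (auto intro!: tendsto_intros)
qed

lemma cpoly_block_lower_triangular:
  assumes "A \<in> carrier_mat n n" "D \<in> carrier_mat m m" "B \<in> carrier_mat m n"
  shows "cpoly (four_block_mat A (0\<^sub>m n m) B D) = cpoly A * cpoly D"
proof -
  let ?cm = "\<lambda>A. [:0, 1:] \<cdot>\<^sub>m 1\<^sub>m (dim_row A) + map_mat (\<lambda>a. [:- of_real a:]) A :: complex poly mat"
  have cm: "cpoly A = Determinant.det (?cm A)" for A
    unfolding char_poly_defs by (intro arg_cong[of _ _ Determinant.det] eq_matI) auto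
  have "?cm (four_block_mat A (0\<^sub>m n m) B D)
    = four_block_mat (?cm A) (0\<^sub>m n m) (map_mat (\<lambda>a. [:- of_real a:]) B) (?cm D)"
    using assms by (intro eq_matI) (auto simp: one_poly_def)
  then show ?thesis
    unfolding cm using assms by (simp add: det_four_block_mat_upper_right_zero[of _ n _ m])
qed

text \<open>
  A double root would give, after a Schur decomposition, a vector \<open>w\<close> with \<open>A w = t w + c v\<close>.
  Pairing with the left Perron vector forces \<open>c = 0\<close>, but the kernel is one-dimensional.
\<close>

lemma irreducible_Z_cpoly:
  assumes A: "A \<in> carrier_mat n n" and a: "irreducible_Z n (\<lambda>i j. A $$ (i, j))"
    and v: "\<And>i. i < n \<Longrightarrow> 0 < v i"
    and av: "\<And>i. i < n \<Longrightarrow> (\<Sum>j<n. A $$ (i, j) * v j) = t * v i"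
  shows "\<exists>q. cpoly A = [:- of_real t, 1:] * q \<and> (\<forall>z. poly q z = 0 \<longrightarrow> t < Re z)"
proof -
  let ?A = "map_mat complex_of_real A"
  have cA: "?A \<in> carrier_mat n n" using A by auto
  obtain as where as: "cpoly A = (\<Prod>e\<leftarrow>as. [:- e, 1:])" "length as = n"
    using char_poly_factorized[OF cA] by blast
  note root = poly_linear_factors_eq_0_iff[where 'a = complex]
  have "ev A (of_real t)"
    unfolding ev_iff[OF A]
  proof (intro exI[of _ "\<lambda>i. complex_of_real (v i)"] conjI allI impI)
    show "\<exists>i<n. complex_of_real (v i) \<noteq> 0" using v irreducible_Z_dim[OF a] by fastforce
    fix i assume "i < n"
    show "(\<Sum>j<n. complex_of_real (A $$ (i, j)) * of_real (v j)) = of_real t * of_real (v i)"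
      unfolding of_real_mult[symmetric] of_real_sum[symmetric] av[OF \<open>i < n\<close>] ..
  qed
  then have t: "of_real t \<in> set as" using ev_iff_cpoly_root[OF A] as(1) root by simp
  define bs where "bs = remove1 (of_real t) as"
  have perm: "mset as = mset (of_real t # bs)" using t by (simp add: bs_def)
  have prod_cong: "(\<Prod>e\<leftarrow>es. [:- e, 1:]) = (\<Prod>e\<leftarrow>fs. [:- e, 1:])"
    if "mset es = mset fs" for es fs :: "complex list"
    using that by (metis mset_map prod_mset_prod_list)
  have "t < Re z" if z: "z \<in> set bs" for z
  proof -
    have "z \<in> set as" using z set_remove1_subset[of "of_real t" as] unfolding bs_def by blast
    then have "ev A z" using ev_iff_cpoly_root[OF A] as(1) root by simp
    then obtain y k where "k < n" "y k \<noteq> 0"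
      "\<And>i. i < n \<Longrightarrow> (\<Sum>j<n. of_real (A $$ (i, j)) * y j) = z * y i"
      unfolding ev_iff[OF A] by blast
    then have "z = of_real t \<or> t < Re z"
      using irreducible_Z_eigenvalue[OF a v av] by blast
    moreover have "z \<noteq> of_real t"
    proof
      assume "z = of_real t"
      \<comment> \<open>The diagonal of a Schur form follows the order of the list, so the supposed
        double root is moved to the two leading places.\<close>
      define cs where "cs = of_real t # of_real t # remove1 (of_real t) bs"
      have "mset as = mset cs" using perm z \<open>z = of_real t\<close> by (simp add: cs_def)
      then have cs: "cpoly A = (\<Prod>e\<leftarrow>cs. [:- e, 1:])" and "length cs = n"
        using prod_cong as by (metis, metis mset_eq_length)
      then have n: "0 < n" "1 < n" by (auto simp: cs_def)
      obtain B P Q where "schur_decomposition ?A cs = (B, P, Q)" by (cases "schur_decomposition ?A cs")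
      from schur_decomposition[OF cA cs this]
      have sim: "similar_mat_wit ?A B P Q" and B: "upper_triangular B" "diag_mat B = cs" by auto
      note S = similar_mat_witD2[OF cA sim]
      have B00: "B $$ (0, 0) = of_real t" and B11: "B $$ (1, 1) = of_real t"
        using arg_cong[OF B(2), of "\<lambda>l. l ! 0"] arg_cong[OF B(2), of "\<lambda>l. l ! 1"] n S(5)
        by (auto simp: diag_mat_def cs_def)
      have B0: "B $$ (k, l) = 0" if "k < n" "l < k" for k l
        using B(1) S(5) that by (auto simp: upper_triangular_def)
      have AP: "?A * P = P * B"
      proof -
        have "?A * P = P * B * (Q * P)" unfolding S(3)
          using S(5-7) by (simp add: assoc_mult_mat[of _ n n _ n _ n])
        then show ?thesis using S by simp
      qed
      have AP_entry: "(\<Sum>j<n. of_real (A $$ (i, j)) * P $$ (j, l)) = (\<Sum>k<n. P $$ (i, k) * B $$ (k, l))"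
        if "i < n" "l < n" for i l
        using arg_cong[OF AP, of "\<lambda>M. M $$ (i, l)"] that A S(5-7)
        by (simp add: scalar_prod_def atLeast0LessThan)
      \<comment> \<open>By triangularity column 0 of \<open>P\<close> is an eigenvector, and
        \<open>A\<close> sends column 1 to \<open>t\<close> times itself plus
        \<open>B $$ (0, 1)\<close> times column 0.\<close>
      have P0: "(\<Sum>j<n. of_real (A $$ (i, j)) * P $$ (j, 0)) = of_real t * P $$ (i, 0)" if "i < n" for i
      proof -
        have "(\<Sum>k<n. P $$ (i, k) * B $$ (k, 0)) = (\<Sum>k\<in>{0}. P $$ (i, k) * B $$ (k, 0))"
          using n B0 by (intro sum.mono_neutral_right) auto
        then show ?thesis using AP_entry[OF that n(1)] B00 by simp
      qed
      have P1: "(\<Sum>j<n. of_real (A $$ (i, j)) * P $$ (j, 1))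
          = of_real t * P $$ (i, 1) + P $$ (i, 0) * B $$ (0, 1)" if "i < n" for i
      proof -
        have "(\<Sum>k<n. P $$ (i, k) * B $$ (k, 1)) = (\<Sum>k\<in>{0, 1}. P $$ (i, k) * B $$ (k, 1))"
          using n B0 by (intro sum.mono_neutral_right) auto
        then show ?thesis using AP_entry[OF that n(2)] B11 by simp
      qed
      obtain c where c: "\<And>i. i < n \<Longrightarrow> P $$ (i, 0) = c * of_real (v i)"
        using irreducible_Z_complex_kernel[OF a v av P0] by blast
      obtain u where u: "\<And>i. i < n \<Longrightarrow> 0 < u i"
        "\<And>j. j < n \<Longrightarrow> (\<Sum>i<n. u i * A $$ (i, j)) = t * u j"
        using irreducible_Z_left_perron[OF a v av] by blast
      have cu: "(\<Sum>i<n. complex_of_real (u i) * of_real (A $$ (i, j))) = of_real t * of_real (u j)"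
        if "j < n" for j
        unfolding of_real_mult[symmetric] of_real_sum[symmetric] u(2)[OF that] ..
      have QP: "(\<Sum>k<n. Q $$ (i, k) * P $$ (k, j)) = (if i = j then 1 else 0)" if "i < n" "j < n" for i j
        using arg_cong[OF S(2), of "\<lambda>M. M $$ (i, j)"] that S(6,7)
        by (simp add: scalar_prod_def atLeast0LessThan)
      have "c \<noteq> 0" using QP[OF n(1) n(1)] c by auto
      have "(\<Sum>i<n. complex_of_real (u i) * (\<Sum>j<n. of_real (A $$ (i, j)) * P $$ (j, 1)))
          = of_real t * (\<Sum>i<n. of_real (u i) * P $$ (i, 1))"
        using cu by (rule left_right_pairing)
      moreover have "(\<Sum>i<n. complex_of_real (u i) * (\<Sum>j<n. of_real (A $$ (i, j)) * P $$ (j, 1)))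
          = of_real t * (\<Sum>i<n. of_real (u i) * P $$ (i, 1)) + (\<Sum>i<n. of_real (u i) * P $$ (i, 0)) * B $$ (0, 1)"
      proof -
        have "(\<Sum>i<n. complex_of_real (u i) * (\<Sum>j<n. of_real (A $$ (i, j)) * P $$ (j, 1)))
          = (\<Sum>i<n. of_real (u i) * (of_real t * P $$ (i, 1) + P $$ (i, 0) * B $$ (0, 1)))"
          using P1 by (intro sum.cong refl arg_cong2[of _ _ _ _ "(*)"]) auto
        then show ?thesis by (simp add: sum_distrib_left sum_distrib_right sum.distrib algebra_simps)
      qed
      moreover have "(\<Sum>i<n. of_real (u i) * P $$ (i, 0)) = c * of_real (\<Sum>i<n. u i * v i)"
        by (simp add: c sum_distrib_left algebra_simps)
      moreover have "0 < (\<Sum>i<n. u i * v i)" using n u v by (intro sum_pos) auto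
      ultimately have "B $$ (0, 1) = 0" using \<open>c \<noteq> 0\<close> by (simp del: of_real_sum)
      then have "(\<Sum>j<n. of_real (A $$ (i, j)) * P $$ (j, 1)) = of_real t * P $$ (i, 1)" if "i < n" for i
        using P1[OF that] by simp
      then obtain d where d: "\<And>i. i < n \<Longrightarrow> P $$ (i, 1) = d * of_real (v i)"
        using irreducible_Z_complex_kernel[OF a v av, of "\<lambda>j. P $$ (j, 1)"] by blast
      \<comment> \<open>Both leading columns of \<open>P\<close> are multiples of \<open>v\<close>,
        the first with factor \<open>c \<noteq> 0\<close>. Row 1 of \<open>Q\<close> would have to
        pair to 1 with one and to 0 with the other.\<close>
      have "d * (\<Sum>k<n. Q $$ (1, k) * of_real (v k)) = 1" "c * (\<Sum>k<n. Q $$ (1, k) * of_real (v k)) = 0"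
        using QP[OF n(2) n(2)] QP[OF n(2) n(1)] by (simp_all add: c d[simplified] sum_distrib_left algebra_simps)
      then show False using \<open>c \<noteq> 0\<close> by auto
    qed
    ultimately show ?thesis by blast
  qed
  moreover have "cpoly A = [:- of_real t, 1:] * (\<Prod>e\<leftarrow>bs. [:- e, 1:])"
    using prod_cong[OF perm] as(1) by simp
  ultimately show ?thesis using root by blast
qed

text \<open>Sorting any factorization into linear factors shows that the choice in
  \<open>spectral_gap\<close> has a candidate. The length makes index 1 meaningful once
  \<open>2 \<le> N\<close>.\<close>

lemma spectral_gap_listed:
  assumes A: "A \<in> carrier_mat N N"
  shows "\<exists>es. cpoly A = (\<Prod>e\<leftarrow>es. [:- e, 1:]) \<and> sorted (map Re es) \<and> length es = N \<and>
    spectral_gap A = es ! 1"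
proof -
  obtain as where as: "cpoly A = (\<Prod>e\<leftarrow>as. [:- e, 1:])"
    using char_poly_factorized[of "map_mat complex_of_real A" N] A by auto
  have "mset (map (\<lambda>e. [:- e, 1:]) (sort_key Re as)) = mset (map (\<lambda>e. [:- e, 1:]) as)" by simp
  then have "(\<Prod>e\<leftarrow>sort_key Re as. [:- e, 1:]) = (\<Prod>e\<leftarrow>as. [:- e, 1:])"
    by (metis prod_mset_prod_list)
  then have "\<exists>z es. cpoly A = (\<Prod>e\<leftarrow>es. [:- e, 1:]) \<and> sorted (map Re es) \<and> z = es ! 1"
    using as by (intro exI[of _ "sort_key Re as ! 1"] exI[of _ "sort_key Re as"]) simp
  from someI_ex[OF this] obtain es where es: "cpoly A = (\<Prod>e\<leftarrow>es. [:- e, 1:])"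
    "sorted (map Re es)" "spectral_gap A = es ! 1"
    unfolding spectral_gap_def by blast
  have "length es = degree (cpoly A)" unfolding es(1) by (rule degree_linear_factors[symmetric])
  also have "\<dots> = N" using A by (simp add: degree_monic_char_poly)
  finally show ?thesis using es by blast
qed

text \<open>All roots of \<open>q\<close> lie in the open right half-plane, so the factor
  \<open>[:0, 1:]\<close> accounts for the head of the list; the tail lists the roots of
  \<open>q\<close>, least real part first.\<close>

lemma second_listed_root:
  fixes es :: "complex list"
  assumes es: "(\<Prod>e\<leftarrow>es. [:- e, 1:]) = [:0, 1:] * q" "sorted (map Re es)" "2 \<le> length es"
    and q: "\<And>z. poly q z = 0 \<Longrightarrow> 0 < Re z"
  shows "poly q (es ! 1) = 0 \<and> (\<forall>z. poly q z = 0 \<longrightarrow> Re (es ! 1) \<le> Re z)"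
proof -
  note root = poly_linear_factors_eq_0_iff[where 'a = complex]
  obtain x y fs where x: "es = x # y # fs"
    using es(3) by (cases es; cases "tl es") auto
  have "0 \<in> set es" using root[of es 0] es(1) by simp
  then have "Re x \<le> 0" using es(2) x by auto
  moreover have "poly ([:0, 1:] * q) x = 0" unfolding es(1)[symmetric] root using x by simp
  ultimately have "x = 0" using q[of x] by auto
  then have yfs: "(\<Prod>e\<leftarrow>y # fs. [:- e, 1:]) = q" using es(1) x by simp
  then have "poly q z = 0 \<longleftrightarrow> z \<in> set (y # fs)" for z using root[of "y # fs" z] by simp
  then show ?thesis using es(2) x by auto
qed

lemma spectral_gap_least:
  assumes A: "A \<in> carrier_mat N N" "2 \<le> N" and c: "cpoly A = [:0, 1:] * q"
    and q: "\<And>z. poly q z = 0 \<Longrightarrow> 0 < Re z"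
  shows "poly q (spectral_gap A) = 0" and "poly q z = 0 \<Longrightarrow> Re (spectral_gap A) \<le> Re z"
  using spectral_gap_listed[OF A(1)] second_listed_root[of _ q] A(2) c q by metis+

subsection \<open>Sensitivity of the spectral gap\<close>

text \<open>
  Sorted lists of eigenvalues and unit eigenvectors of the perturbed matrices live in a compact set.
  Any limit point of the lists is a sorted list of the eigenvalues of \<open>L\<close>, so the gap is
  continuous, and any limit point of the eigenvectors is a multiple of \<open>v\<close>. With the left
  eigenvector \<open>u\<close> one has \<open>(\<lambda>\<^sub>2(\<epsilon>) - t) (u \<bullet> y) = \<epsilon> (u \<bullet> P y)\<close> for each eigenvector \<open>y\<close>.
\<close>

lemma sensitivity_simple_gap:
  fixes L :: "real mat" and P :: "nat \<Rightarrow> nat \<Rightarrow> real"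
  assumes L: "L \<in> carrier_mat N N" "2 \<le> N"
    and c: "cpoly L = [:0, 1:] * ([:- of_real t, 1:] * q)" and "0 < t"
    and q: "\<And>z. poly q z = 0 \<Longrightarrow> t < Re z"
    and A: "\<And>e. A e \<in> carrier_mat N N"
      "\<And>e i j. i < N \<Longrightarrow> j < N \<Longrightarrow> A e $$ (i, j) = L $$ (i, j) + e * P i j"
    and u: "\<And>j. j < N \<Longrightarrow> (\<Sum>i<N. u i * L $$ (i, j)) = t * u j"
    and v: "\<And>y. (\<And>i. i < N \<Longrightarrow> (\<Sum>j<N. complex_of_real (L $$ (i, j)) * y j) = of_real t * y i) \<Longrightarrow>
      \<exists>c. \<forall>i<N. y i = c * of_real (v i)"
    and uv: "(\<Sum>i<N. u i * v i) \<noteq> 0"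
  shows "spectral_gap L = of_real t"
    and "sensitivity L A ((\<Sum>i<N. u i * (\<Sum>j<N. P i j * v j)) / (\<Sum>i<N. u i * v i))"
proof -
  let ?q = "[:- of_real t, 1:] * q" and ?g = "\<lambda>e. spectral_gap (A e)"
  have q_root: "z = of_real t \<or> t < Re z" if "poly ?q z = 0" for z using that q by auto
  then have q_pos: "0 < Re z" if "poly ?q z = 0" for z using that \<open>0 < t\<close> by fastforce
  have second: "es ! 1 = of_real t"
    if "(\<Prod>e\<leftarrow>es. [:- e, 1:]) = [:0, 1:] * ?q" "sorted (map Re es)" "2 \<le> length es" for es
  proof -
    have "poly ?q (of_real t) = 0" by simp
    then have "Re (es ! 1) \<le> t" "poly ?q (es ! 1) = 0"
      using second_listed_root[OF that q_pos] by force+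
    then show ?thesis using q_root by force
  qed
  show gap: "spectral_gap L = of_real t"
    using spectral_gap_listed[OF L(1)] second c L(2) by metis
  have "q \<noteq> 0" using q[of 0] \<open>0 < t\<close> by auto
  then have "Polynomial.order (of_real t) (cpoly L) = 1"
  proof -
    have "Polynomial.order (of_real t) [:0, 1:] = (0::nat)" using \<open>0 < t\<close> by (intro order_0I) simp
    moreover have "Polynomial.order (of_real t) [:- complex_of_real t, 1:] = 1"
      using order_power_n_n[of "complex_of_real t" 1] by simp
    moreover have "Polynomial.order (of_real t) q = 0" using q[of "of_real t"] by (intro order_0I) auto
    ultimately show ?thesis unfolding c using \<open>q \<noteq> 0\<close> by (simp add: order_mult del: mult_pCons_left)
  qed
  then have simple: "simple_ev L (spectral_gap L)" by (simp add: simple_ev_def gap)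
  define s where "s = (\<Sum>i<N. u i * (\<Sum>j<N. P i j * v j)) / (\<Sum>i<N. u i * v i)"
  \<comment> \<open>The list has to be one whose entry 1 is the chosen gap, since equal real parts
    leave several orders. Fixing the norm of \<open>y\<close> keeps limits of eigenvectors
    nonzero.\<close>
  define R where "R e es y \<longleftrightarrow> cpoly (A e) = (\<Prod>x\<leftarrow>es. [:- x, 1:]) \<and> sorted (map Re es) \<and>
     length es = N \<and> ?g e = es ! 1 \<and> (\<Sum>i<N. cmod (y i)) = 1 \<and>
     (\<forall>i<N. (\<Sum>j<N. of_real (A e $$ (i, j)) * y j) = ?g e * y i)" for e es y
  have "\<exists>p. R e (fst p) (snd p)" for e
  proof -
    obtain es where es: "cpoly (A e) = (\<Prod>x\<leftarrow>es. [:- x, 1:])" "sorted (map Re es)" "length es = N"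
      "?g e = es ! 1"
      using spectral_gap_listed[OF A(1)] by blast
    have "?g e \<in> set es" using es(3,4) L(2) by simp
    then have "poly (cpoly (A e)) (?g e) = 0" unfolding es(1) poly_linear_factors_eq_0_iff .
    then have "ev (A e) (?g e)" using ev_iff_cpoly_root[OF A(1)] by simp
    then obtain y k where y: "k < N" "y k \<noteq> 0"
      "\<And>i. i < N \<Longrightarrow> (\<Sum>j<N. of_real (A e $$ (i, j)) * y j) = ?g e * y i"
      using ev_iff[OF A(1)] by blast
    have pos: "0 < (\<Sum>i<N. cmod (y i))" using y(1,2) by (intro sum_pos2[of _ k]) auto
    define r where "r = (\<Sum>i<N. cmod (y i))"
    have "(\<Sum>i<N. cmod (y i / of_real r)) = 1"
      using pos by (simp add: r_def[symmetric] norm_divide sum_divide_distrib[symmetric] del: of_real_sum)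
    moreover have "(\<Sum>j<N. of_real (A e $$ (i, j)) * (y j / of_real r)) = ?g e * (y i / of_real r)" if "i < N" for i
      using y(3)[OF that] by (simp add: sum_divide_distrib[symmetric])
    ultimately show ?thesis
      using es unfolding R_def by (intro exI[of _ "(es, \<lambda>i. y i / of_real r)"]) simp
  qed
  then obtain p where p: "\<And>e. R e (fst (p e)) (snd (p e))" by metis
  define es y where "es e = fst (p e)" and "y e = snd (p e)" for e
  have es: "\<And>e. cpoly (A e) = (\<Prod>x\<leftarrow>es e. [:- x, 1:])" "\<And>e. sorted (map Re (es e))"
      "\<And>e. length (es e) = N" "\<And>e. ?g e = es e ! 1"
    and y: "\<And>e. (\<Sum>i<N. cmod (y e i)) = 1"
      "\<And>e i. i < N \<Longrightarrow> (\<Sum>j<N. of_real (A e $$ (i, j)) * y e j) = ?g e * y e i"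
    using p by (simp_all add: R_def es_def y_def)
  have "((\<lambda>e. (?g e - spectral_gap L) / of_real e) \<longlongrightarrow> of_real s) (at 0)"
    unfolding LIM_def
  proof (rule ccontr)
    let ?f = "\<lambda>e. (?g e - spectral_gap L) / of_real e"
    assume "\<not> (\<forall>r>0. \<exists>d>0. \<forall>x. x \<noteq> 0 \<and> dist x 0 < d \<longrightarrow> dist (?f x) (of_real s) < r)"
    then obtain r where r: "0 < r"
      "\<And>d. 0 < d \<Longrightarrow> \<exists>x. x \<noteq> 0 \<and> dist x 0 < d \<and> \<not> dist (?f x) (of_real s) < r" by blast
    have "\<exists>x. x \<noteq> 0 \<and> dist x 0 < inverse (real (Suc k)) \<and> \<not> dist (?f x) (of_real s) < r" for k
      by (intro r(2)) simp
    then obtain S where S: "\<And>k. S k \<noteq> 0" "\<And>k. \<bar>S k\<bar> < inverse (real (Suc k))"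
      "\<And>k. \<not> dist (?f (S k)) (of_real s) < r"
      by (simp add: dist_real_def) metis
    have S0: "S \<longlonglongrightarrow> 0"
      by (rule Lim_null_comparison[OF _ LIMSEQ_inverse_real_of_nat])
        (use S(2) in \<open>auto intro!: always_eventually simp: less_imp_le\<close>)
    \<comment> \<open>The \<open>N\<close> eigenvalues and the \<open>N\<close> coordinates of the
      eigenvector are packed into one vector of length \<open>2 * N\<close>, so that a single
      subsequence serves both.\<close>
    define f where "f k i = (if i < N then es (S k) ! i else y (S k) (i - N))" for k i
    have A_lim: "(\<lambda>k. A (S k) $$ (i, j)) \<longlonglongrightarrow> L $$ (i, j)" if "i < N" "j < N" for i j
      unfolding A(2)[OF that] using tendsto_add[OF tendsto_const tendsto_mult_left_zero[OF S0]] by force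
    have "convergent (\<lambda>k. \<Sum>i<N. \<Sum>j<N. \<bar>A (S k) $$ (i, j)\<bar>)"
      unfolding convergent_def
      by (intro exI[of _ "\<Sum>i<N. \<Sum>j<N. \<bar>L $$ (i, j)\<bar>"]) (auto intro!: tendsto_intros A_lim)
    from convergent_imp_Bseq[OF this]
    obtain K where K: "\<And>k. norm (\<Sum>i<N. \<Sum>j<N. \<bar>A (S k) $$ (i, j)\<bar>) \<le> K"
      unfolding Bseq_def by blast
    have "\<exists>\<rho> l. strict_mono (\<rho> :: nat \<Rightarrow> nat) \<and> (\<forall>i\<in>{..<2 * N}. (\<lambda>k. f (\<rho> k) i) \<longlonglongrightarrow> l i)"
    proof (rule finite_convergent_subseq)
      fix i assume i: "i \<in> {..<2 * N}"
      have "cmod (f k i) \<le> max K 1" for k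
      proof (cases "i < N")
        case True
        then have "es (S k) ! i \<in> set (es (S k))" using es(3) by simp
        then have "poly (cpoly (A (S k))) (es (S k) ! i) = 0"
          unfolding es(1) poly_linear_factors_eq_0_iff .
        then have "ev (A (S k)) (f k i)" using ev_iff_cpoly_root[OF A(1)] True by (simp add: f_def)
        from norm_ev_le[OF A(1) this] K[of k] show ?thesis by simp
      next
        case False
        then have "cmod (y (S k) (i - N)) \<le> (\<Sum>i<N. cmod (y (S k) i))"
          using i by (intro member_le_sum) auto
        then show ?thesis using y(1) False by (simp add: f_def)
      qed
      then show "bounded (range (\<lambda>k. f k i))" by (intro boundedI[of _ "max K 1"]) auto
    qed simp
    then obtain \<rho> l where \<rho>: "strict_mono (\<rho> :: nat \<Rightarrow> nat)"
      and l: "\<And>i. i < 2 * N \<Longrightarrow> (\<lambda>k. f (\<rho> k) i) \<longlonglongrightarrow> l i" by auto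
    define T where "T k = S (\<rho> k)" for k
    have T0: "T \<longlonglongrightarrow> 0" using LIMSEQ_subseq_LIMSEQ[OF S0 \<rho>] by (simp add: o_def T_def[abs_def])
    have AT: "(\<lambda>k. A (T k) $$ (i, j)) \<longlonglongrightarrow> L $$ (i, j)" if "i < N" "j < N" for i j
      using LIMSEQ_subseq_LIMSEQ[OF A_lim[OF that] \<rho>] by (simp add: o_def T_def)
    have es_lim: "(\<lambda>k. es (T k) ! i) \<longlonglongrightarrow> l i" if "i < N" for i
      using l[of i] that by (simp add: f_def T_def)
    define w where "w i = l (i + N)" for i
    have y_lim: "(\<lambda>k. y (T k) i) \<longlonglongrightarrow> w i" if "i < N" for i
      using l[of "i + N"] that by (simp add: f_def T_def w_def)
    have prod_nth: "poly (\<Prod>x\<leftarrow>xs. [:- x, 1:]) z = (\<Prod>i<length xs. z - xs ! i)" for xs and z :: complex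
      by (induction xs) (auto simp: prod.lessThan_Suc_shift algebra_simps simp del: prod.lessThan_Suc)
    define es0 where "es0 = map l [0..<N]"
    have "poly (cpoly L) z = poly (\<Prod>x\<leftarrow>es0. [:- x, 1:]) z" for z
    proof (rule LIMSEQ_unique)
      show "(\<lambda>k. poly (cpoly (A (T k))) z) \<longlonglongrightarrow> poly (cpoly L) z"
        by (rule tendsto_poly_cpoly[OF A(1) L(1) AT])
      show "(\<lambda>k. poly (cpoly (A (T k))) z) \<longlonglongrightarrow> poly (\<Prod>x\<leftarrow>es0. [:- x, 1:]) z"
        unfolding es(1) prod_nth es(3) by (auto intro!: tendsto_intros es_lim simp: es0_def)
    qed
    then have "(\<Prod>x\<leftarrow>es0. [:- x, 1:]) = [:0, 1:] * ?q" unfolding c[symmetric] by (simp add: poly_eq_poly_eq_iff[symmetric] fun_eq_iff)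
    moreover have "sorted (map Re es0)"
      unfolding sorted_iff_nth_mono
    proof (intro allI impI)
      fix i j assume ij: "i \<le> j" "j < length (map Re es0)"
      then have "Re (es (T k) ! i) \<le> Re (es (T k) ! j)" for k
        using es(2)[of "T k"] es(3)[of "T k"] sorted_nth_mono[of "map Re (es (T k))" i j] by (simp add: es0_def)
      moreover have "(\<lambda>k. Re (es (T k) ! i)) \<longlonglongrightarrow> Re (l i)" "(\<lambda>k. Re (es (T k) ! j)) \<longlonglongrightarrow> Re (l j)"
        using ij by (auto intro!: tendsto_Re es_lim simp: es0_def)
      ultimately show "map Re es0 ! i \<le> map Re es0 ! j"
        using ij by (auto simp: es0_def intro: LIMSEQ_le)
    qed
    ultimately have "es0 ! 1 = of_real t" using L(2) by (intro second) (auto simp: es0_def)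
    then have g_lim: "(\<lambda>k. ?g (T k)) \<longlonglongrightarrow> of_real t"
      using es_lim[of 1] L(2) by (simp add: es(4) es0_def)
    have "(\<Sum>j<N. of_real (L $$ (i, j)) * w j) = of_real t * w i" if i: "i < N" for i
    proof (rule LIMSEQ_unique)
      show "(\<lambda>k. \<Sum>j<N. of_real (A (T k) $$ (i, j)) * y (T k) j) \<longlonglongrightarrow> (\<Sum>j<N. of_real (L $$ (i, j)) * w j)"
        using i by (auto intro!: tendsto_intros AT y_lim)
      show "(\<lambda>k. \<Sum>j<N. of_real (A (T k) $$ (i, j)) * y (T k) j) \<longlonglongrightarrow> of_real t * w i"
        unfolding y(2)[OF i] by (intro tendsto_intros g_lim y_lim i)
    qed
    then obtain d where d: "\<And>i. i < N \<Longrightarrow> w i = d * of_real (v i)" using v by blast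
    have "(\<lambda>k. \<Sum>i<N. cmod (y (T k) i)) \<longlonglongrightarrow> (\<Sum>i<N. cmod (w i))"
      by (auto intro!: tendsto_intros y_lim)
    then have "(\<Sum>i<N. cmod (w i)) = 1" by (simp add: y(1) LIMSEQ_const_iff)
    then have "d \<noteq> 0" using d by (auto simp: sum.neutral)
    define num where "num k = (\<Sum>i<N. of_real (u i) * (\<Sum>j<N. of_real (P i j) * y (T k) j))" for k
    define den where "den k = (\<Sum>i<N. of_real (u i) * y (T k) i)" for k
    have "num \<longlonglongrightarrow> (\<Sum>i<N. of_real (u i) * (\<Sum>j<N. of_real (P i j) * w j))"
      unfolding num_def by (auto intro!: tendsto_intros y_lim)
    also have "(\<Sum>i<N. of_real (u i) * (\<Sum>j<N. of_real (P i j) * w j))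
        = d * of_real (\<Sum>i<N. u i * (\<Sum>j<N. P i j * v j))"
      by (simp add: d sum_distrib_left algebra_simps)
    finally have num: "num \<longlonglongrightarrow> d * of_real (\<Sum>i<N. u i * (\<Sum>j<N. P i j * v j))" .
    have "den \<longlonglongrightarrow> (\<Sum>i<N. of_real (u i) * w i)"
      unfolding den_def by (auto intro!: tendsto_intros y_lim)
    also have "(\<Sum>i<N. of_real (u i) * w i) = d * of_real (\<Sum>i<N. u i * v i)"
      by (simp add: d sum_distrib_left algebra_simps)
    finally have den: "den \<longlonglongrightarrow> d * of_real (\<Sum>i<N. u i * v i)" .
    have den0: "d * of_real (\<Sum>i<N. u i * v i) \<noteq> (0::complex)"
      using \<open>d \<noteq> 0\<close> uv by (simp del: of_real_sum of_real_mult)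
    have "(\<lambda>k. num k / den k) \<longlonglongrightarrow> of_real s"
      using tendsto_divide[OF num den den0] \<open>d \<noteq> 0\<close> by (simp add: s_def del: of_real_sum of_real_mult)
    \<comment> \<open>The eigenvectors are not normalized against \<open>u\<close>, but their
      pairing with it tends to a nonzero number, so it may be divided by from some index on.\<close>
    moreover have "eventually (\<lambda>k. den k \<noteq> 0) sequentially"
      using den den0 by (rule tendsto_imp_eventually_ne)
    then have "eventually (\<lambda>k. ?f (T k) = num k / den k) sequentially"
    proof eventually_elim
      case (elim k)
      have uL: "(\<Sum>i<N. complex_of_real (u i) * of_real (L $$ (i, j))) = of_real t * of_real (u j)" if "j < N" for j
        unfolding of_real_mult[symmetric] of_real_sum[symmetric] u[OF that] ..
      have "?g (T k) * den k = (\<Sum>i<N. of_real (u i) * (\<Sum>j<N. of_real (A (T k) $$ (i, j)) * y (T k) j))"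
        by (simp add: y(2)) (simp add: den_def sum_distrib_left algebra_simps)
      also have "\<dots> = (\<Sum>i<N. of_real (u i) * ((\<Sum>j<N. of_real (L $$ (i, j)) * y (T k) j)
          + of_real (T k) * (\<Sum>j<N. of_real (P i j) * y (T k) j)))"
      proof (intro sum.cong refl arg_cong2[of _ _ _ _ "(*)"])
        fix i assume "i \<in> {..<N}"
        then show "(\<Sum>j<N. of_real (A (T k) $$ (i, j)) * y (T k) j) = (\<Sum>j<N. of_real (L $$ (i, j)) * y (T k) j)
          + of_real (T k) * (\<Sum>j<N. of_real (P i j) * y (T k) j)"
          by (simp add: A(2) distrib_right sum.distrib sum_distrib_left mult.assoc)
      qed
      also have "\<dots> = (\<Sum>i<N. of_real (u i) * (\<Sum>j<N. of_real (L $$ (i, j)) * y (T k) j)) + of_real (T k) * num k"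
        unfolding num_def distrib_left sum.distrib by (simp add: sum_distrib_left algebra_simps)
      also have "\<dots> = of_real t * den k + of_real (T k) * num k"
        using left_right_pairing[of N "\<lambda>i. of_real (u i)" "\<lambda>i j. of_real (L $$ (i, j))" "of_real t" "y (T k)", OF uL]
        by (simp add: den_def)
      finally have "(?g (T k) - of_real t) * den k = of_real (T k) * num k" by (simp add: algebra_simps)
      then show ?case using elim S(1) by (simp add: gap T_def frac_eq_eq mult.commute)
    qed
    ultimately have "(\<lambda>k. ?f (T k)) \<longlonglongrightarrow> of_real s" by (simp cong: tendsto_cong)
    then have "eventually (\<lambda>k. dist (?f (T k)) (of_real s) < r) sequentially"
      using r(1) by (rule tendstoD)
    then show False using S(3) by (auto simp: T_def eventually_sequentially)
  qed
  then show "sensitivity L A ((\<Sum>i<N. u i * (\<Sum>j<N. P i j * v j)) / (\<Sum>i<N. u i * v i))"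
    using simple by (simp add: sensitivity_def s_def)
qed

subsection \<open>Master-slave Laplacians\<close>

text \<open>These are the Laplacians of strongly connected weighted graphs, described without
  weights: the all-one vector is the Perron vector for the value 0. Being a property of the matrix
  alone, it lets thresholds be attached to \<open>L1\<close>.\<close>

definition strong_laplacian :: "nat \<Rightarrow> real mat \<Rightarrow> bool" where
  "strong_laplacian n L \<longleftrightarrow> L \<in> carrier_mat n n \<and> irreducible_Z n (\<lambda>i j. L $$ (i, j)) \<and>
     (\<forall>i<n. (\<Sum>j<n. L $$ (i, j)) = 0)"

lemma strong_laplacianD:
  assumes "strong_laplacian n L"
  shows "L \<in> carrier_mat n n" "irreducible_Z n (\<lambda>i j. L $$ (i, j))" "0 < n"
    "i < n \<Longrightarrow> (\<Sum>j<n. L $$ (i, j)) = 0"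
  using assms by (auto simp: strong_laplacian_def irreducible_Z_dim)

lemma strong_laplacian_cpoly:
  assumes "strong_laplacian n L"
  shows "\<exists>q. cpoly L = [:0, 1:] * q \<and> (\<forall>z. poly q z = 0 \<longrightarrow> 0 < Re z)"
  using irreducible_Z_cpoly[OF strong_laplacianD(1,2)[OF assms], of "\<lambda>_. 1" 0] strong_laplacianD(4)[OF assms]
  by simp

lemma strong_laplacian_left_null:
  assumes "strong_laplacian n L"
  shows "\<exists>p. (\<forall>i<n. 0 < p i) \<and> (\<forall>j<n. (\<Sum>i<n. p i * L $$ (i, j)) = 0)"
  using irreducible_Z_left_perron[OF strong_laplacianD(2)[OF assms], of "\<lambda>_. 1" 0] strong_laplacianD(4)[OF assms]
  by simp

lemma sum_lessThan_add:
  fixes f :: "nat \<Rightarrow> 'a::comm_monoid_add"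
  shows "(\<Sum>j<n + m. f j) = (\<Sum>j<n. f j) + (\<Sum>j<m. f (n + j))"
  by (induction m) (simp_all add: add.assoc)

lemma row_sum_mat_simps:
  assumes "C \<in> carrier_mat m n"
  shows "row_sum_mat C \<in> carrier_mat m m"
    and "i < m \<Longrightarrow> j < m \<Longrightarrow> row_sum_mat C $$ (i, j) = (if i = j then \<Sum>k<n. C $$ (i, k) else 0)"
  using assms by (auto simp: row_sum_mat_def mat_diag_def)

text \<open>No set of links is fixed here: \<open>C\<close> has only to be nonnegative and nonzero,
  so the reinforced cutset \<open>C + D\<close> gives another instance even when \<open>D\<close>
  adds new links, and (i) and (ii) compare two instances.\<close>

locale master_slave =
  fixes n m :: nat and L1 L2 C :: "real mat"
  assumes L1: "strong_laplacian n L1" and L2: "strong_laplacian m L2"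
    and C: "C \<in> carrier_mat m n" "nonneg_mat C" "C \<noteq> 0\<^sub>m m n"
begin

abbreviation M :: "real mat" where "M \<equiv> L2 + row_sum_mat C"
abbreviation L :: "real mat" where "L \<equiv> master_slave_laplacian L1 L2 C"

lemma C_nonneg: "i < m \<Longrightarrow> j < n \<Longrightarrow> 0 \<le> C $$ (i, j)"
  using C by (auto simp: nonneg_mat_def)

lemma C_entry: "\<exists>i j. i < m \<and> j < n \<and> 0 < C $$ (i, j)"
proof (rule ccontr)
  assume "\<nexists>i j. i < m \<and> j < n \<and> 0 < C $$ (i, j)"
  then have "C $$ (i, j) = 0" if "i < m" "j < n" for i j using C_nonneg[OF that] that by force
  then have "C = 0\<^sub>m m n" using C(1) by (intro eq_matI) auto
  then show False using C(3) by simp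
qed

lemma M_carrier: "M \<in> carrier_mat m m"
  using strong_laplacianD(1)[OF L2] row_sum_mat_simps(1)[OF C(1)] by simp

lemma M_entry:
  "i < m \<Longrightarrow> j < m \<Longrightarrow> M $$ (i, j) = L2 $$ (i, j) + (if i = j then \<Sum>k<n. C $$ (i, k) else 0)"
  using strong_laplacianD(1)[OF L2] row_sum_mat_simps[OF C(1)] by auto

lemma M_row_sum: "i < m \<Longrightarrow> (\<Sum>j<m. M $$ (i, j)) = (\<Sum>k<n. C $$ (i, k))"
  using strong_laplacianD(4)[OF L2] by (simp add: M_entry sum.distrib)

lemma M_irreducible: "irreducible_Z m (\<lambda>i j. M $$ (i, j))"
proof -
  note Z = strong_laplacianD(2)[OF L2]
  show ?thesis
    unfolding irreducible_Z_def
  proof (intro conjI allI impI)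
    fix S :: "nat set"
    assume S: "S \<noteq> {} \<and> S \<subset> {..<m}"
    from irreducible_Z_edge[OF Z this]
    obtain i j where ij: "i \<in> {..<m} - S" "j \<in> S" "L2 $$ (i, j) < 0" by blast
    with S have "M $$ (i, j) < 0" by (subst M_entry) auto
    with ij show "\<exists>i\<in>{..<m} - S. \<exists>j\<in>S. M $$ (i, j) < 0" by blast
  next
    fix i j assume "i < m" "j < m" "i \<noteq> j"
    then show "M $$ (i, j) \<le> 0" using irreducible_Z_nonpos[OF Z, of i j] by (simp add: M_entry)
  qed (rule strong_laplacianD(3)[OF L2])
qed

definition perron :: "real \<Rightarrow> (nat \<Rightarrow> real) \<Rightarrow> bool" where
  "perron t y \<longleftrightarrow> (\<forall>i<m. 0 < y i) \<and> (\<forall>i<m. (\<Sum>j<m. M $$ (i, j) * y j) = t * y i)"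

definition left_perron :: "real \<Rightarrow> (nat \<Rightarrow> real) \<Rightarrow> bool" where
  "left_perron t x \<longleftrightarrow> (\<forall>i<m. 0 < x i) \<and> (\<forall>j<m. (\<Sum>i<m. x i * M $$ (i, j)) = t * x j)"

lemma perron_exists: "\<exists>t y. perron t y"
  using irreducible_Z_perron[OF M_irreducible] unfolding perron_def by blast

lemma left_perron_exists: "perron t y \<Longrightarrow> \<exists>x. left_perron t x"
  using irreducible_Z_left_perron[OF M_irreducible] unfolding perron_def left_perron_def by blast

text \<open>The row vector \<open>x C\<close> is the right-hand side of the equation for the master
  part of the left eigenvector. Its positive total yields both \<open>0 < t\<close> and the negative
  sum of that part.\<close>

lemma left_perron_cut_pos:
  assumes "left_perron t x"
  shows "0 < (\<Sum>j<n. \<Sum>i<m. x i * C $$ (i, j))"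
proof -
  obtain i j where ij: "i < m" "j < n" "0 < C $$ (i, j)" using C_entry by blast
  have x: "\<And>i. i < m \<Longrightarrow> 0 < x i" using assms by (auto simp: left_perron_def)
  have nn: "0 \<le> x i * C $$ (i, j)" if "i < m" "j < n" for i j
    using x[OF that(1)] C_nonneg[OF that] by simp
  have "0 < (\<Sum>i<m. x i * C $$ (i, j))"
    using ij x nn by (intro sum_pos2[of _ i]) auto
  then show ?thesis using ij nn
    by (intro sum_pos2[where i = j and I = "{..<n}" and f = "\<lambda>j. \<Sum>i<m. x i * C $$ (i, j)"])
      (auto intro!: sum_nonneg)
qed

text \<open>Pair \<open>x\<close> with the all-one vector: \<open>L2\<close> contributes nothing to
  the row sums of \<open>M\<close>, so \<open>t\<close> times the sum of \<open>x\<close> is the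
  total of \<open>x C\<close>.\<close>

lemma left_perron_pos:
  assumes x: "left_perron t x"
  shows "0 < t"
proof -
  have "(\<Sum>i<m. x i * (\<Sum>j<m. M $$ (i, j) * 1)) = t * (\<Sum>i<m. x i * 1)"
    using x by (intro left_right_pairing) (auto simp: left_perron_def)
  then have "(\<Sum>j<n. \<Sum>i<m. x i * C $$ (i, j)) = t * (\<Sum>i<m. x i)"
    by (simp add: M_row_sum sum_distrib_left) (subst sum.swap, simp)
  moreover have "0 < (\<Sum>i<m. x i)"
    using x strong_laplacianD(3)[OF L2] by (intro sum_pos) (auto simp: left_perron_def)
  ultimately show ?thesis using left_perron_cut_pos[OF x] by (simp add: zero_less_mult_iff)
qed

lemma L_carrier: "L \<in> carrier_mat (n + m) (n + m)" "2 \<le> n + m"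
  using strong_laplacianD(1,3)[OF L1] strong_laplacianD(3)[OF L2] M_carrier
  by (auto simp: master_slave_laplacian_def)

lemma L_entry:
  assumes "i < n + m" "j < n + m"
  shows "L $$ (i, j) = (if i < n then if j < n then L1 $$ (i, j) else 0
    else if j < n then - C $$ (i - n, j) else M $$ (i - n, j - n))"
  using assms strong_laplacianD(1)[OF L1] strong_laplacianD(1)[OF L2] row_sum_mat_simps(1)[OF C(1)] C(1)
  by (auto simp: master_slave_laplacian_def)

lemma L_cpoly: "cpoly L = cpoly L1 * cpoly M"
  using cpoly_block_lower_triangular[OF strong_laplacianD(1)[OF L1] M_carrier, of "- C"]
    strong_laplacianD(1)[OF L1] strong_laplacianD(1)[OF L2] C(1)
  by (simp add: master_slave_laplacian_def)

lemma perron_cpoly: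
  assumes "perron t y"
  shows "\<exists>q1 q2. cpoly L1 = [:0, 1:] * q1 \<and> cpoly M = [:- of_real t, 1:] * q2 \<and>
    cpoly L = [:0, 1:] * ([:- of_real t, 1:] * (q1 * q2)) \<and> 0 < t \<and>
    (\<forall>z. poly q1 z = 0 \<longrightarrow> 0 < Re z) \<and> (\<forall>z. poly q2 z = 0 \<longrightarrow> t < Re z)"
proof -
  obtain q1 where q1: "cpoly L1 = [:0, 1:] * q1" "\<forall>z. poly q1 z = 0 \<longrightarrow> 0 < Re z"
    using strong_laplacian_cpoly[OF L1] by blast
  obtain q2 where q2: "cpoly M = [:- of_real t, 1:] * q2" "\<forall>z. poly q2 z = 0 \<longrightarrow> t < Re z"
    using irreducible_Z_cpoly[OF M_carrier M_irreducible, of y t] assms by (auto simp: perron_def)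
  have "cpoly L = [:0, 1:] * ([:- of_real t, 1:] * (q1 * q2))"
    unfolding L_cpoly q1(1) q2(1) by (simp only: mult.assoc mult.left_commute)
  moreover have "0 < t" using left_perron_exists[OF assms] left_perron_pos by blast
  ultimately show ?thesis using q1 q2 by blast
qed

text \<open>Apart from one zero of \<open>cpoly L1\<close>, the spectrum of \<open>L\<close> is that
  of the two diagonal blocks and lies in the open right half-plane. The bounds on the gap concern
  its real part because the eigenvalue of least real part need not be unique.\<close>

lemma spectral_gap_facts:
  assumes "perron t y"
  shows "0 < Re (spectral_gap L)" "Re (spectral_gap L) \<le> t"
    and "ev L1 z \<Longrightarrow> z \<noteq> 0 \<Longrightarrow> Re (spectral_gap L) \<le> Re z"
    and "ev L1 (spectral_gap L) \<or> ev M (spectral_gap L)"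
    and "ev M z \<Longrightarrow> z = of_real t \<or> t < Re z"
    and "ev M (of_real t)"
proof -
  obtain q1 q2 where q: "cpoly L1 = [:0, 1:] * q1" "cpoly M = [:- of_real t, 1:] * q2"
    "cpoly L = [:0, 1:] * ([:- of_real t, 1:] * (q1 * q2))" "0 < t"
    "\<And>z. poly q1 z = 0 \<Longrightarrow> 0 < Re z" "\<And>z. poly q2 z = 0 \<Longrightarrow> t < Re z"
    using perron_cpoly[OF assms] by blast
  note root1 = ev_iff_cpoly_root[OF strong_laplacianD(1)[OF L1]]
  note root2 = ev_iff_cpoly_root[OF M_carrier]
  let ?q = "[:- complex_of_real t, 1:] * (q1 * q2)"
  have pos: "0 < Re z" if "poly ?q z = 0" for z
  proof -
    have "z = of_real t \<or> poly q1 z = 0 \<or> poly q2 z = 0" using that by auto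
    then show ?thesis using q(4) q(5,6)[of z] by auto
  qed
  note gap = spectral_gap_least[OF L_carrier q(3) pos]
  have gap2: "Re (spectral_gap L) \<le> Re z" if "poly ?q z = 0" for z
    using gap(2) that by blast
  show "0 < Re (spectral_gap L)" by (rule pos[OF gap(1)])
  show "Re (spectral_gap L) \<le> t" using gap(2)[of "of_real t"] by simp
  show "Re (spectral_gap L) \<le> Re z" if "ev L1 z" "z \<noteq> 0"
  proof -
    have "poly q1 z = 0" using that root1 q(1) by simp
    then have "poly ?q z = 0" unfolding Polynomial.poly_mult by simp
    then show ?thesis by (rule gap2)
  qed
  show "ev L1 (spectral_gap L) \<or> ev M (spectral_gap L)"
    using gap(1) unfolding root1 root2 q(1,2) by auto
  show "z = of_real t \<or> t < Re z" if "ev M z"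
    using that q(6)[of z] unfolding root2 q(2) by auto
  show "ev M (of_real t)" unfolding root2 q(2) by simp
qed

lemma spectral_gap_perron:
  assumes "perron t y" "ev M (spectral_gap L)"
  shows "spectral_gap L = of_real t"
  using spectral_gap_facts(2,5)[OF assms(1)] assms(2) by fastforce

text \<open>The two slave blocks differ by the diagonal matrix of the added row sums
  \<open>d\<close>. Pairing the left vector \<open>x\<close> of the old block with the right vector
  \<open>y'\<close> of the new one gives \<open>t' - t\<close> times their pairing as the sum of
  \<open>x i * d i * y' i\<close>. With \<open>C' = C\<close> allowed, this also yields uniqueness
  of the Perron value.\<close>

lemma perron_mono:
  assumes t: "perron t y" and C': "C' \<in> carrier_mat m n" "\<And>i j. i < m \<Longrightarrow> j < n \<Longrightarrow> C $$ (i, j) \<le> C' $$ (i, j)"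
    and t': "master_slave.perron m L2 C' t' y'" "master_slave n m L1 L2 C'"
  shows "t \<le> t'" and "C' \<noteq> C \<Longrightarrow> t < t'"
proof -
  interpret N: master_slave n m L1 L2 C' by fact
  obtain x where x: "left_perron t x" using left_perron_exists[OF t] by blast
  have xp: "\<And>i. i < m \<Longrightarrow> 0 < x i" and yp: "\<And>i. i < m \<Longrightarrow> 0 < y' i"
    using x t'(1) by (auto simp: left_perron_def N.perron_def)
  define d where "d i = (\<Sum>k<n. C' $$ (i, k) - C $$ (i, k))" for i
  have d0: "0 \<le> d i" if "i < m" for i
    unfolding d_def using C'(2) that by (intro sum_nonneg) simp
  have "t' * (\<Sum>i<m. x i * y' i) = (\<Sum>i<m. x i * (\<Sum>j<m. N.M $$ (i, j) * y' j))"
    using t'(1) by (simp add: N.perron_def sum_distrib_left algebra_simps)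
  also have "\<dots> = (\<Sum>i<m. x i * ((\<Sum>j<m. M $$ (i, j) * y' j) + d i * y' i))"
  proof (intro sum.cong refl arg_cong2[of _ _ _ _ "(*)"])
    fix i assume "i \<in> {..<m}"
    then have "N.M $$ (i, j) * y' j = M $$ (i, j) * y' j + (if i = j then d i * y' i else 0)" if "j < m" for j
      using that by (simp add: M_entry N.M_entry d_def sum_subtractf algebra_simps)
    then have "(\<Sum>j<m. N.M $$ (i, j) * y' j) = (\<Sum>j<m. M $$ (i, j) * y' j + (if i = j then d i * y' i else 0))"
      by (intro sum.cong) auto
    then show "(\<Sum>j<m. N.M $$ (i, j) * y' j) = (\<Sum>j<m. M $$ (i, j) * y' j) + d i * y' i"
      using \<open>i \<in> {..<m}\<close> by (simp add: sum.distrib)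
  qed
  also have "\<dots> = t * (\<Sum>i<m. x i * y' i) + (\<Sum>i<m. x i * d i * y' i)"
    using left_right_pairing[of m x "\<lambda>i j. M $$ (i, j)" t y'] x
    by (simp add: left_perron_def distrib_left sum.distrib algebra_simps)
  finally have eq: "(t' - t) * (\<Sum>i<m. x i * y' i) = (\<Sum>i<m. x i * d i * y' i)"
    by (simp add: algebra_simps)
  have xy: "0 < (\<Sum>i<m. x i * y' i)"
    using xp yp strong_laplacianD(3)[OF L2] by (intro sum_pos) auto
  have term0: "0 \<le> x i * d i * y' i" if "i < m" for i
    using xp[OF that] yp[OF that] d0[OF that] by simp
  then have "0 \<le> (\<Sum>i<m. x i * d i * y' i)" by (intro sum_nonneg) auto
  then show "t \<le> t'" using eq xy by (metis diff_ge_0_iff_ge mult_less_0_iff not_less)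
  assume "C' \<noteq> C"
  then obtain i k where ik: "i < m" "k < n" "C' $$ (i, k) \<noteq> C $$ (i, k)"
    using C(1) C'(1) by (metis carrier_matD eq_matI)
  then have "0 < d i"
    unfolding d_def using C'(2)[OF ik(1)] C'(2)[OF ik(1,2)] ik(2,3)
    by (intro sum_pos2[of _ k]) (auto simp: less_le)
  then have "0 < x i * d i * y' i" using xp[OF ik(1)] yp[OF ik(1)] by simp
  then have "0 < (\<Sum>i<m. x i * d i * y' i)" using ik(1) term0 by (intro sum_pos2[of _ i]) auto
  then show "t < t'" using eq xy by (metis diff_gt_0_iff_gt zero_less_mult_pos2)
qed

lemma perturbed_along_eq:
  assumes "D \<in> carrier_mat m n"
  shows "perturbed_along L1 L2 C D = master_slave_laplacian L1 L2 (C + D)"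
proof -
  have "- C - D = - (C + D)" using C(1) assms by (intro eq_matI) auto
  then show ?thesis by (simp add: perturbed_along_def master_slave_laplacian_def)
qed

lemma perturbed_cut:
  assumes "structural_perturbation m n D"
  shows "master_slave n m L1 L2 (C + D)" "C + D \<noteq> C" "C + D \<in> carrier_mat m n"
    "i < m \<Longrightarrow> j < n \<Longrightarrow> C $$ (i, j) \<le> (C + D) $$ (i, j)"
proof -
  have D: "D \<in> carrier_mat m n" "nonneg_mat D" "D \<noteq> 0\<^sub>m m n"
    using assms by (auto simp: structural_perturbation_def)
  show "C + D \<noteq> C"
  proof
    assume eq: "C + D = C"
    have "D $$ (i, j) = 0" if "i < m" "j < n" for i j
      using arg_cong[OF eq, of "\<lambda>X. X $$ (i, j)"] that C(1) D(1) by auto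
    then have "D = 0\<^sub>m m n" using D(1) by (intro eq_matI) auto
    then show False using D(3) by simp
  qed
  show *: "i < m \<Longrightarrow> j < n \<Longrightarrow> C $$ (i, j) \<le> (C + D) $$ (i, j)" for i j
    using C(1) D by (auto simp: nonneg_mat_def)
  show "C + D \<in> carrier_mat m n" using C(1) D(1) by auto
  moreover have "nonneg_mat (C + D)" using C D by (auto simp: nonneg_mat_def)
  moreover have "C + D \<noteq> 0\<^sub>m m n" using C_entry * by force
  ultimately show "master_slave n m L1 L2 (C + D)" using L1 L2 by unfold_locales
qed

text \<open>The old gap survives as an eigenvalue of the unchanged \<open>L1\<close> and bounds the
  new one from above. From below, the new gap belongs to \<open>L1\<close> or to a slave block whose
  Perron value \<open>t' \<ge> t\<close> already dominates the old gap.\<close>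

lemma spectral_gap_along_invariant:
  assumes D: "structural_perturbation m n D" and gap: "ev L1 (spectral_gap L)"
  shows "Re (spectral_gap (perturbed_along L1 L2 C D)) = Re (spectral_gap L)"
proof -
  interpret N: master_slave n m L1 L2 "C + D" by (rule perturbed_cut(1)[OF D])
  obtain t y where t: "perron t y" using perron_exists by blast
  obtain t' y' where t': "N.perron t' y'" using N.perron_exists by blast
  have "t \<le> t'" using perron_mono(1)[OF t perturbed_cut(3,4)[OF D] t'] N.master_slave_axioms by blast
  have "0 < Re (spectral_gap N.L)" "0 < Re (spectral_gap L)"
    using N.spectral_gap_facts(1)[OF t'] spectral_gap_facts(1)[OF t] by blast+
  then have nz: "spectral_gap L \<noteq> 0" "spectral_gap N.L \<noteq> 0" by auto
  have "Re (spectral_gap N.L) \<le> Re (spectral_gap L)"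
    using N.spectral_gap_facts(3)[OF t' gap nz(1)] .
  moreover have "Re (spectral_gap L) \<le> Re (spectral_gap N.L)"
    using N.spectral_gap_facts(4)[OF t']
  proof
    assume "ev L1 (spectral_gap N.L)"
    then show ?thesis using spectral_gap_facts(3)[OF t _ nz(2)] by blast
  next
    assume "ev N.M (spectral_gap N.L)"
    then have "t' \<le> Re (spectral_gap N.L)" using N.spectral_gap_facts(5)[OF t'] by fastforce
    then show ?thesis using \<open>t \<le> t'\<close> spectral_gap_facts(2)[OF t] by linarith
  qed
  ultimately show ?thesis
    using D by (simp add: perturbed_along_eq structural_perturbation_def)
qed

text \<open>The new gap is either a nonzero eigenvalue of \<open>L1\<close>, hence beyond
  \<open>t\<close> by separation, or has real part at least \<open>t' > t\<close>.\<close>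

lemma spectral_gap_along_increases:
  assumes D: "structural_perturbation m n D" and t: "perron t y"
    and sep: "\<And>z. ev L1 z \<Longrightarrow> z \<noteq> 0 \<Longrightarrow> t < Re z"
  shows "Re (spectral_gap L) < Re (spectral_gap (perturbed_along L1 L2 C D))"
proof -
  interpret N: master_slave n m L1 L2 "C + D" by (rule perturbed_cut(1)[OF D])
  obtain t' y' where t': "N.perron t' y'" using N.perron_exists by blast
  have "t < t'" using perron_mono(2)[OF t perturbed_cut(3,4)[OF D] t' N.master_slave_axioms perturbed_cut(2)[OF D]] .
  have "0 < Re (spectral_gap N.L)" using N.spectral_gap_facts(1)[OF t'] .
  then have nz: "spectral_gap N.L \<noteq> 0" by auto
  have "t < Re (spectral_gap N.L)"
    using N.spectral_gap_facts(4)[OF t']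
  proof
    assume "ev L1 (spectral_gap N.L)"
    then show ?thesis using sep nz by blast
  next
    assume "ev N.M (spectral_gap N.L)"
    then have "t' \<le> Re (spectral_gap N.L)" using N.spectral_gap_facts(5)[OF t'] by fastforce
    then show ?thesis using \<open>t < t'\<close> by linarith
  qed
  then show ?thesis
    using D spectral_gap_facts(2)[OF t] by (simp add: perturbed_along_eq structural_perturbation_def)
qed

text \<open>Since \<open>t\<close> is no eigenvalue of \<open>L1\<close>, the right eigenvector
  vanishes on the master component. The diagonal part \<open>row_sum_mat D\<close> of the
  perturbation meets these zeros only, so the first-order term comes from \<open>- D\<close> acting
  on \<open>y\<close>.\<close>

lemma sens_against_formula:
  assumes t: "perron t y" "left_perron t x"
    and sep: "\<And>z. ev L1 z \<Longrightarrow> z \<noteq> 0 \<Longrightarrow> t < Re z"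
    and w: "\<And>j. j < n \<Longrightarrow> (\<Sum>i<n. w i * L1 $$ (i, j)) - t * w j = (\<Sum>k<m. x k * C $$ (k, j))"
    and D: "D \<in> carrier_mat n m"
  shows "spectral_gap L = of_real t"
    and "sens_against L1 L2 C D (- (\<Sum>i<n. w i * (\<Sum>k<m. D $$ (i, k) * y k)) / (\<Sum>k<m. x k * y k))"
proof -
  obtain q1 q2 where q: "cpoly L1 = [:0, 1:] * q1" "cpoly M = [:- of_real t, 1:] * q2"
    "cpoly L = [:0, 1:] * ([:- of_real t, 1:] * (q1 * q2))" "0 < t"
    "\<And>z. poly q1 z = 0 \<Longrightarrow> 0 < Re z" "\<And>z. poly q2 z = 0 \<Longrightarrow> t < Re z"
    using perron_cpoly[OF t(1)] by blast
  note d1 = strong_laplacianD(1)[OF L1]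
  have q_root: "t < Re z" if "poly (q1 * q2) z = 0" for z
  proof (cases "poly q2 z = 0")
    case False
    then have "poly q1 z = 0" using that by simp
    then have "ev L1 z" "z \<noteq> 0" using q(1) q(5)[of z] ev_iff_cpoly_root[OF d1] by auto
    then show ?thesis by (rule sep)
  qed (rule q(6))
  define u where "u i = (if i < n then w i else x (i - n))" for i
  define v where "v i = (if i < n then 0 else y (i - n))" for i
  \<comment> \<open>The perturbation is linear in \<open>e\<close>: row sums scale with the matrix,
    so \<open>P\<close> is its exact coefficient, supported on the master rows.\<close>
  define P where "P i j = (if i < n then if j < n then if i = j then \<Sum>k<m. D $$ (i, k) else 0
    else - D $$ (i, j - n) else 0)" for i j
  define A where "A e = perturbed_against L1 L2 C (e \<cdot>\<^sub>m D)" for e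
  have eD: "e \<cdot>\<^sub>m D \<in> carrier_mat n m" for e using D by simp
  have A_carrier: "A e \<in> carrier_mat (n + m) (n + m)" for e
    using d1 M_carrier row_sum_mat_simps(1)[OF eD[of e]] by (auto simp: A_def perturbed_against_def)
  have A_entry: "A e $$ (i, j) = L $$ (i, j) + e * P i j" if "i < n + m" "j < n + m" for e i j
    using that d1 M_carrier D C(1) strong_laplacianD(1)[OF L2] row_sum_mat_simps[OF eD[of e]]
      row_sum_mat_simps(1)[OF C(1)]
    by (auto simp: A_def perturbed_against_def L_entry P_def sum_distrib_left)
  have uL: "(\<Sum>i<n + m. u i * L $$ (i, j)) = t * u j" if j: "j < n + m" for j
  proof (cases "j < n")
    case True
    then have "(\<Sum>i<n + m. u i * L $$ (i, j))
      = (\<Sum>i<n. w i * L1 $$ (i, j)) + (\<Sum>i<m. x i * - C $$ (i, j))"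
      by (simp add: sum_lessThan_add u_def L_entry)
    then show ?thesis using w[OF True] True by (simp add: u_def sum_negf)
  next
    case False
    then have "(\<Sum>i<n + m. u i * L $$ (i, j)) = (\<Sum>i<m. x i * M $$ (i, j - n))"
      using j by (simp add: sum_lessThan_add u_def L_entry)
    then show ?thesis using t(2) j False by (auto simp: u_def left_perron_def)
  qed
  have ker: "\<exists>c. \<forall>i<n + m. z i = c * of_real (v i)"
    if z: "\<And>i. i < n + m \<Longrightarrow> (\<Sum>j<n + m. complex_of_real (L $$ (i, j)) * z j) = of_real t * z i" for z
  proof -
    have z1: "(\<Sum>j<n. complex_of_real (L1 $$ (i, j)) * z j) = of_real t * z i" if "i < n" for i
      using z[of i] that by (simp add: sum_lessThan_add L_entry)
    have zero: "z i = 0" if "i < n" for i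
    proof (rule ccontr)
      assume "z i \<noteq> 0"
      with z1 that have "ev L1 (of_real t)" unfolding ev_iff[OF d1] by blast
      then show False using sep[of "of_real t"] q(4) by simp
    qed
    then have "(\<Sum>j<m. complex_of_real (M $$ (i, j)) * z (n + j)) = of_real t * z (n + i)" if "i < m" for i
      using z[of "n + i"] that by (simp add: sum_lessThan_add L_entry)
    then obtain c where "\<forall>i<m. z (n + i) = c * of_real (y i)"
      using irreducible_Z_complex_kernel[OF M_irreducible, of y t "\<lambda>j. z (n + j)"] t(1)
      by (auto simp: perron_def)
    moreover have "n + (i - n) = i" "i - n < m" if "n \<le> i" "i < n + m" for i
      using that by auto
    ultimately have "z i = c * of_real (y (i - n))" if "n \<le> i" "i < n + m" for i
      using that by metis
    then show ?thesis using zero by (intro exI[of _ c]) (auto simp: v_def)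
  qed
  have uv: "(\<Sum>i<n + m. u i * v i) = (\<Sum>k<m. x k * y k)"
    by (simp add: sum_lessThan_add u_def v_def)
  have uPv: "(\<Sum>i<n + m. u i * (\<Sum>j<n + m. P i j * v j)) = - (\<Sum>i<n. w i * (\<Sum>k<m. D $$ (i, k) * y k))"
    by (simp add: sum_lessThan_add u_def v_def P_def sum_negf)
  have "0 < (\<Sum>k<m. x k * y k)"
    using t strong_laplacianD(3)[OF L2] by (intro sum_pos) (auto simp: perron_def left_perron_def)
  then have uv0: "(\<Sum>i<n + m. u i * v i) \<noteq> 0" unfolding uv by simp
  note s = sensitivity_simple_gap[OF L_carrier q(3,4) q_root A_carrier A_entry uL ker uv0]
  show "spectral_gap L = of_real t" by (rule s(1))
  show "sens_against L1 L2 C D (- (\<Sum>i<n. w i * (\<Sum>k<m. D $$ (i, k) * y k)) / (\<Sum>k<m. x k * y k))"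
    using s(2) unfolding uv uPv A_def .
qed

end

section \<open>The resolvent of a strong Laplacian, acting on row vectors\<close>

lemma solve_left:
  assumes A: "A \<in> carrier_mat n n" and t: "\<not> ev A (of_real t)"
  shows "\<exists>w. \<forall>j<n. (\<Sum>i<n. w i * A $$ (i, j)) - t * w j = (b j :: real)"
proof -
  let ?B = "A - t \<cdot>\<^sub>m 1\<^sub>m n"
  have B: "?B \<in> carrier_mat n n" using A by auto
  have "Determinant.det ?B \<noteq> 0"
  proof
    assume "Determinant.det ?B = 0"
    then obtain v where v: "v \<in> carrier_vec n" "v \<noteq> 0\<^sub>v n" "?B *\<^sub>v v = 0\<^sub>v n"
      using det_0_iff_vec_prod_zero[OF B] by blast
    have "(\<Sum>j<n. A $$ (i, j) * v $ j) = t * v $ i" if i: "i < n" for i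
    proof -
      have "0 = (\<Sum>j<n. ?B $$ (i, j) * v $ j)"
        using arg_cong[OF v(3), of "\<lambda>x. x $ i"] i B v(1) by (simp add: scalar_prod_def atLeast0LessThan)
      also have "\<dots> = (\<Sum>j<n. A $$ (i, j) * v $ j - (if i = j then t * v $ i else 0))"
        using A i by (intro sum.cong) (auto simp: algebra_simps)
      finally show ?thesis using i by (simp add: sum_subtractf)
    qed
    then have "(\<Sum>j<n. complex_of_real (A $$ (i, j)) * of_real (v $ j)) = of_real t * of_real (v $ i)" if "i < n" for i
      unfolding of_real_mult[symmetric] of_real_sum[symmetric] using that by simp
    moreover have "\<exists>i<n. v $ i \<noteq> 0" using v(1,2) by (metis eq_vecI carrier_vecD index_zero_vec)
    then have "\<exists>i<n. complex_of_real (v $ i) \<noteq> 0" by simp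
    ultimately have "ev A (of_real t)"
      unfolding ev_iff[OF A] by (intro exI[of _ "\<lambda>i. complex_of_real (v $ i)"] conjI allI impI)
    then show False using t by simp
  qed
  from det_non_zero_imp_unit[OF B this, of "()"]
  obtain X where X: "X \<in> carrier_mat n n" "X * ?B = 1\<^sub>m n"
    unfolding Units_def ring_mat_def by auto
  define w where "w i = (\<Sum>k<n. b k * X $$ (k, i))" for i
  have "(\<Sum>i<n. w i * A $$ (i, j)) - t * w j = b j" if j: "j < n" for j
  proof -
    have "(\<Sum>i<n. w i * A $$ (i, j)) - t * w j = (\<Sum>i<n. w i * A $$ (i, j) - (if i = j then t * w j else 0))"
      using j by (simp add: sum_subtractf)
    also have "\<dots> = (\<Sum>i<n. w i * ?B $$ (i, j))"
      using A j by (intro sum.cong) (auto simp: algebra_simps)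
    also have "\<dots> = (\<Sum>k<n. b k * (\<Sum>i<n. X $$ (k, i) * ?B $$ (i, j)))"
      unfolding w_def sum_distrib_left sum_distrib_right by (subst sum.swap) (simp add: algebra_simps)
    also have "\<dots> = (\<Sum>k<n. b k * (1\<^sub>m n $$ (k, j)))"
    proof (intro sum.cong refl arg_cong2[of _ _ _ _ "(*)"])
      fix k assume "k \<in> {..<n}"
      then show "(\<Sum>i<n. X $$ (k, i) * ?B $$ (i, j)) = 1\<^sub>m n $$ (k, j)"
        using arg_cong[OF X(2), of "\<lambda>Y. Y $$ (k, j)"] j X(1) B
        by (simp add: scalar_prod_def atLeast0LessThan)
    qed
    also have "\<dots> = (\<Sum>k<n. if k = j then b j else 0)" using j by (intro sum.cong) auto
    finally show ?thesis using j by simp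
  qed
  then show ?thesis by blast
qed

text \<open>An anti-maximum principle: just above the principal eigenvalue 0 the resolvent reverses
  signs. It ranges over all nonnegative nonzero right-hand sides, so \<open>\<delta>\<close> cannot
  depend on a cutset.\<close>

definition anti_maximum :: "nat \<Rightarrow> real mat \<Rightarrow> real \<Rightarrow> bool" where
  "anti_maximum n L \<delta> \<longleftrightarrow> (\<forall>t w. 0 < t \<and> t < \<delta> \<and>
     (\<forall>j<n. 0 \<le> (\<Sum>i<n. w i * L $$ (i, j)) - t * w j) \<and>
     (\<exists>j<n. 0 < (\<Sum>i<n. w i * L $$ (i, j)) - t * w j) \<longrightarrow> (\<forall>i<n. w i < 0))"

lemma strong_laplacian_row_vector_sum:
  assumes "strong_laplacian n L"
  shows "(\<Sum>j<n. \<Sum>i<n. w i * L $$ (i, j)) = 0"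
  using strong_laplacianD(4)[OF assms] by (subst sum.swap) (simp flip: sum_distrib_left)

text \<open>
  If \<open>w (L - t) \<ge> 0\<close> is nonzero, then \<open>w\<close> has negative sum because \<open>L\<close> annihilates the all-one
  vector. As \<open>t \<rightarrow> 0\<close>, every limit of normalized such \<open>w\<close> is therefore a negative multiple of the
  positive left null vector of \<open>L\<close>.
\<close>

lemma strong_laplacian_anti_maximum:
  assumes L: "strong_laplacian n L"
  shows "\<exists>\<delta>>0. anti_maximum n L \<delta>"
proof (rule ccontr)
  define f where "f t w j = (\<Sum>i<n. w i * L $$ (i, j)) - t * w j" for t w j
  assume "\<not> (\<exists>\<delta>>0. anti_maximum n L \<delta>)"
  then have neg: "\<exists>t w. 0 < t \<and> t < \<delta> \<and> (\<forall>j<n. 0 \<le> f t w j) \<and> (\<exists>j<n. 0 < f t w j) \<and> (\<exists>i<n. 0 \<le> w i)"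
    if "0 < \<delta>" for \<delta>
  proof -
    have "\<not> anti_maximum n L \<delta>" using \<open>\<not> (\<exists>\<delta>>0. anti_maximum n L \<delta>)\<close> that by blast
    then show ?thesis
      unfolding anti_maximum_def f_def by (simp only: not_all not_imp not_less) blast
  qed
  define R where "R k t w \<longleftrightarrow> 0 < t \<and> t < inverse (real (Suc k)) \<and> (\<forall>j<n. 0 \<le> f t w j) \<and>
    (\<Sum>i<n. w i) \<le> 0 \<and> (\<Sum>i<n. \<bar>w i\<bar>) = 1 \<and> (\<exists>i<n. 0 \<le> w i)" for k t w
  have "\<exists>p. R k (fst p) (snd p)" for k
  proof -
    obtain t w where t: "0 < t" "t < inverse (real (Suc k))" and w: "\<forall>j<n. 0 \<le> f t w j"
      "\<exists>j<n. 0 < f t w j" "\<exists>i<n. 0 \<le> w i"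
      using neg[of "inverse (real (Suc k))"] by auto
    obtain j where "j < n" "0 < f t w j" using w(2) by blast
    then have "0 < (\<Sum>j<n. f t w j)" using w(1) by (intro sum_pos2[of _ j]) auto
    also have "(\<Sum>j<n. f t w j) = - t * (\<Sum>i<n. w i)"
      using strong_laplacian_row_vector_sum[OF L, of w]
      by (simp add: f_def sum_subtractf sum_distrib_left sum_negf)
    finally have neg_sum: "(\<Sum>i<n. w i) < 0" using t(1) by (simp add: zero_less_mult_iff mult_less_0_iff)
    define r where "r = (\<Sum>i<n. \<bar>w i\<bar>)"
    have "\<bar>\<Sum>i<n. w i\<bar> \<le> r" unfolding r_def by (rule sum_abs)
    then have r: "0 < r" using neg_sum by linarith
    have fr: "f t (\<lambda>i. w i / r) j = f t w j / r" for j
      by (simp add: f_def diff_divide_distrib sum_divide_distrib)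
    have "R k t (\<lambda>i. w i / r)"
      unfolding R_def fr using t w r neg_sum
      by (simp add: sum_divide_distrib[symmetric] r_def[symmetric] divide_le_0_iff zero_le_divide_iff)
    then show ?thesis by (intro exI[of _ "(t, \<lambda>i. w i / r)"]) simp
  qed
  then obtain p where p: "\<And>k. R k (fst (p k)) (snd (p k))" by metis
  define t w where "t k = fst (p k)" and "w k = snd (p k)" for k
  have R: "R k (t k) (w k)" for k using p by (simp add: t_def w_def)
  have t0: "t \<longlonglongrightarrow> 0"
    by (rule Lim_null_comparison[OF _ LIMSEQ_inverse_real_of_nat])
      (use R in \<open>auto intro!: always_eventually simp: R_def less_imp_le\<close>)
  have "\<exists>\<rho> l. strict_mono (\<rho> :: nat \<Rightarrow> nat) \<and> (\<forall>i\<in>{..<n}. (\<lambda>k. w (\<rho> k) i) \<longlonglongrightarrow> l i)"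
  proof (rule finite_convergent_subseq)
    fix i assume i: "i \<in> {..<n}"
    have "\<bar>w k i\<bar> \<le> 1" for k
      using member_le_sum[of i "{..<n}" "\<lambda>i. \<bar>w k i\<bar>"] R[of k] i by (simp add: R_def)
    then show "bounded (range (\<lambda>k. w k i))" by (intro boundedI[of _ 1]) auto
  qed simp
  then obtain \<rho> l where \<rho>: "strict_mono (\<rho> :: nat \<Rightarrow> nat)"
    and l: "\<And>i. i < n \<Longrightarrow> (\<lambda>k. w (\<rho> k) i) \<longlonglongrightarrow> l i" by auto
  have t0': "(\<lambda>k. t (\<rho> k)) \<longlonglongrightarrow> 0" using LIMSEQ_subseq_LIMSEQ[OF t0 \<rho>] by (simp add: o_def)
  have ge: "0 \<le> (\<Sum>i<n. l i * L $$ (i, j))" if j: "j < n" for j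
  proof (rule LIMSEQ_le_const)
    have "(\<lambda>k. f (t (\<rho> k)) (w (\<rho> k)) j) \<longlonglongrightarrow> (\<Sum>i<n. l i * L $$ (i, j)) - 0 * l j"
      unfolding f_def by (intro tendsto_intros l t0') (use j in auto)
    then show "(\<lambda>k. f (t (\<rho> k)) (w (\<rho> k)) j) \<longlonglongrightarrow> (\<Sum>i<n. l i * L $$ (i, j))" by simp
  qed (use R j in \<open>auto simp: R_def\<close>)
  \<comment> \<open>Nonnegative entries with total 0 vanish, so the limit is a left null
    vector.\<close>
  then have null: "(\<Sum>i<n. l i * L $$ (i, j)) = 0" if "j < n" for j
    using strong_laplacian_row_vector_sum[OF L, of l] that
      sum_nonneg_eq_0_iff[of "{..<n}" "\<lambda>j. \<Sum>i<n. l i * L $$ (i, j)"] by auto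
  obtain q where q: "\<And>i. i < n \<Longrightarrow> 0 < q i" "\<And>j. j < n \<Longrightarrow> (\<Sum>i<n. q i * L $$ (i, j)) = 0"
    using strong_laplacian_left_null[OF L] by blast
  have "\<exists>c. \<forall>i<n. l i = c * q i"
    using irreducible_Z_kernel[OF irreducible_Z_transpose[OF strong_laplacianD(2)[OF L]] q(1), where t = 0 and r = l] q(2) null
    by (simp add: mult.commute)
  then obtain c where c: "\<And>i. i < n \<Longrightarrow> l i = c * q i" by blast
  have "(\<lambda>k. \<Sum>i<n. w (\<rho> k) i) \<longlonglongrightarrow> (\<Sum>i<n. l i)" by (auto intro!: tendsto_intros l)
  then have "(\<Sum>i<n. l i) \<le> 0" by (rule LIMSEQ_le_const2) (use R in \<open>auto simp: R_def\<close>)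
  then have "c * (\<Sum>i<n. q i) \<le> 0" by (simp add: c sum_distrib_left)
  moreover have "0 < (\<Sum>i<n. q i)" using q(1) strong_laplacianD(3)[OF L] by (intro sum_pos) auto
  ultimately have "c \<le> 0" by (simp add: mult_le_0_iff)
  have "(\<lambda>k. \<Sum>i<n. \<bar>w (\<rho> k) i\<bar>) \<longlonglongrightarrow> (\<Sum>i<n. \<bar>l i\<bar>)" by (auto intro!: tendsto_intros l)
  moreover have "(\<Sum>i<n. \<bar>w (\<rho> k) i\<bar>) = 1" for k using R by (simp add: R_def)
  ultimately have "(\<Sum>i<n. \<bar>l i\<bar>) = 1" by (simp add: LIMSEQ_const_iff)
  then have "c \<noteq> 0" using c by (auto simp: sum.neutral)
  with \<open>c \<le> 0\<close> have "l i < 0" if "i < n" for i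
    using c[OF that] q(1)[OF that] by (simp add: mult_less_0_iff)
  \<comment> \<open>Strict negativity of the limit passes back to late members of the sequence, each
    of which was chosen with a nonnegative coordinate.\<close>
  then have "eventually (\<lambda>k. \<forall>i\<in>{..<n}. w (\<rho> k) i < 0) sequentially"
    using l by (intro eventually_ball_finite) (auto intro!: order_tendstoD(2))
  then obtain k where "\<forall>i\<in>{..<n}. w (\<rho> k) i < 0" by (auto simp: eventually_sequentially)
  moreover have "\<exists>i<n. 0 \<le> w (\<rho> k) i" using R by (simp add: R_def)
  ultimately show False by force
qed

section \<open>Links against the cutset and the sign of their sensitivity\<close>

definition link_mat :: "nat \<Rightarrow> nat \<Rightarrow> nat \<Rightarrow> nat \<Rightarrow> real mat" where
  "link_mat r c i k = mat r c (\<lambda>(a, b). if a = i \<and> b = k then 1 else 0)"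

lemma structural_perturbation_link_mat:
  assumes "i < r" "k < c"
  shows "structural_perturbation r c (link_mat r c i k)"
proof -
  have "link_mat r c i k $$ (i, k) = 1" using assms by (simp add: link_mat_def)
  then have "link_mat r c i k \<noteq> 0\<^sub>m r c" using assms by auto
  then show ?thesis by (auto simp: structural_perturbation_def nonneg_mat_def link_mat_def)
qed

text \<open>For a single link the sensitivity thus has the sign opposite to that of
  \<open>w i\<close>, where \<open>i\<close> is the node at which the link ends, because
  \<open>y\<close> is positive.\<close>

lemma link_mat_pairing:
  assumes "i < r" "k < c"
  shows "(\<Sum>a<r. w a * (\<Sum>b<c. link_mat r c i k $$ (a, b) * y b)) = w i * y k"
proof -
  have "(\<Sum>b<c. link_mat r c i k $$ (a, b) * y b) = (if a = i then y k else 0)" if "a < r" for a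
  proof -
    have "(\<Sum>b<c. link_mat r c i k $$ (a, b) * y b) = (\<Sum>b<c. if b = k then if a = i then y k else 0 else 0)"
      using that by (intro sum.cong) (auto simp: link_mat_def)
    then show ?thesis using assms(2) by simp
  qed
  then have "(\<Sum>a<r. w a * (\<Sum>b<c. link_mat r c i k $$ (a, b) * y b)) = (\<Sum>a<r. if a = i then w i * y k else 0)"
    by (intro sum.cong) auto
  then show ?thesis using assms(1) by simp
qed

context master_slave
begin

lemma left_eigenvector_exists:
  assumes "0 < t" and sep: "\<And>z. ev L1 z \<Longrightarrow> z \<noteq> 0 \<Longrightarrow> t < Re z"
  shows "\<exists>w. \<forall>j<n. (\<Sum>i<n. w i * L1 $$ (i, j)) - t * w j = (\<Sum>k<m. x k * C $$ (k, j))"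
proof -
  have "\<not> ev L1 (of_real t)" using sep[of "of_real t"] \<open>0 < t\<close> by auto
  then show ?thesis by (rule solve_left[OF strong_laplacianD(1)[OF L1]])
qed

lemma perron_pairing_pos:
  assumes "perron t y" "left_perron t x"
  shows "0 < (\<Sum>k<m. x k * y k)"
  using assms strong_laplacianD(3)[OF L2] by (intro sum_pos) (auto simp: perron_def left_perron_def)

lemma exists_improving_opposite_link:
  assumes t: "perron t y" and sep: "\<And>z. ev L1 z \<Longrightarrow> z \<noteq> 0 \<Longrightarrow> t < Re z"
  shows "\<exists>D s. structural_perturbation n m D \<and> sens_against L1 L2 C D s \<and> 0 < s"
proof -
  obtain x where x: "left_perron t x" using left_perron_exists[OF t] by blast
  have "0 < t" by (rule left_perron_pos[OF x])
  obtain w where w: "\<And>j. j < n \<Longrightarrow> (\<Sum>i<n. w i * L1 $$ (i, j)) - t * w j = (\<Sum>k<m. x k * C $$ (k, j))"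
    using left_eigenvector_exists[OF \<open>0 < t\<close> sep] by blast
  have "(\<Sum>j<n. (\<Sum>i<n. w i * L1 $$ (i, j)) - t * w j) = (\<Sum>j<n. \<Sum>k<m. x k * C $$ (k, j))"
    using w by simp
  then have "- t * (\<Sum>j<n. w j) = (\<Sum>j<n. \<Sum>k<m. x k * C $$ (k, j))"
    using strong_laplacian_row_vector_sum[OF L1, of w] by (simp add: sum_subtractf sum_distrib_left sum_negf)
  also have "0 < \<dots>" by (rule left_perron_cut_pos[OF x])
  finally have "(\<Sum>j<n. w j) < 0" using \<open>0 < t\<close> by (simp add: zero_less_mult_iff mult_less_0_iff)
  then obtain i where i: "i < n" "w i < 0" by (metis lessThan_iff not_less sum_nonneg)
  have m: "0 < m" by (rule strong_laplacianD(3)[OF L2])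
  \<comment> \<open>Only the head \<open>i\<close> of the link decides the sign; as \<open>y\<close>
    is positive, slave node 0 is as good a tail as any.\<close>
  note D = structural_perturbation_link_mat[OF i(1) m]
  have Dc: "link_mat n m i 0 \<in> carrier_mat n m" using D by (simp add: structural_perturbation_def)
  have "0 < - (w i * y 0) / (\<Sum>k<m. x k * y k)"
    using i m t perron_pairing_pos[OF t x] mult_neg_pos[of "w i" "y 0"]
    by (intro divide_pos_pos) (auto simp: perron_def)
  then show ?thesis
    using sens_against_formula(2)[OF t x sep w Dc] D unfolding link_mat_pairing[OF i(1) m] by blast
qed

text \<open>The vector \<open>x C\<close> is a right-hand side to which the anti-maximum principle
  applies. Once every \<open>w i\<close> is negative, each nonzero entry of \<open>D\<close>
  contributes a positive amount to the sensitivity and none a negative one.\<close>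

lemma opposite_perturbation_improves:
  assumes t: "perron t y" and sep: "\<And>z. ev L1 z \<Longrightarrow> z \<noteq> 0 \<Longrightarrow> t < Re z"
    and d: "anti_maximum n L1 d" "t < d" and D: "structural_perturbation n m D"
  shows "\<exists>s. sens_against L1 L2 C D s \<and> 0 < s"
proof -
  obtain x where x: "left_perron t x" using left_perron_exists[OF t] by blast
  have "0 < t" by (rule left_perron_pos[OF x])
  obtain w where w: "\<And>j. j < n \<Longrightarrow> (\<Sum>i<n. w i * L1 $$ (i, j)) - t * w j = (\<Sum>k<m. x k * C $$ (k, j))"
    using left_eigenvector_exists[OF \<open>0 < t\<close> sep] by blast
  have ge: "0 \<le> (\<Sum>k<m. x k * C $$ (k, j))" if "j < n" for j
    using x C_nonneg that by (intro sum_nonneg) (auto simp: left_perron_def less_imp_le)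
  have "\<exists>j<n. 0 < (\<Sum>k<m. x k * C $$ (k, j))"
  proof (rule ccontr)
    assume "\<not> ?thesis"
    then have "(\<Sum>k<m. x k * C $$ (k, j)) \<le> 0" if "j < n" for j using that not_less by blast
    then have "(\<Sum>j\<in>{..<n}. \<Sum>k<m. x k * C $$ (k, j)) \<le> 0" by - (rule sum_nonpos, simp)
    then show False using left_perron_cut_pos[OF x] by simp
  qed
  then obtain j where j: "j < n" "0 < (\<Sum>k<m. x k * C $$ (k, j))" by blast
  have "\<exists>j<n. 0 < (\<Sum>i<n. w i * L1 $$ (i, j)) - t * w j"
    using j unfolding w[OF j(1), symmetric] by blast
  moreover have "\<forall>j<n. 0 \<le> (\<Sum>i<n. w i * L1 $$ (i, j)) - t * w j"
    using ge w by metis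
  moreover have "0 < t \<and> t < d \<and> (\<forall>j<n. 0 \<le> (\<Sum>i<n. w i * L1 $$ (i, j)) - t * w j) \<and>
     (\<exists>j<n. 0 < (\<Sum>i<n. w i * L1 $$ (i, j)) - t * w j) \<longrightarrow> (\<forall>i<n. w i < 0)"
    using d(1) unfolding anti_maximum_def by blast
  ultimately have wneg: "w i < 0" if "i < n" for i
    using \<open>0 < t\<close> d(2) that by blast
  have Dc: "D \<in> carrier_mat n m" and Dn: "\<And>i k. i < n \<Longrightarrow> k < m \<Longrightarrow> 0 \<le> D $$ (i, k)" and D0: "D \<noteq> 0\<^sub>m n m"
    using D by (auto simp: structural_perturbation_def nonneg_mat_def)
  have yp: "\<And>k. k < m \<Longrightarrow> 0 < y k" using t by (simp add: perron_def)
  obtain i k where ik: "i < n" "k < m" "D $$ (i, k) \<noteq> 0"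
    using D0 Dc by (metis carrier_matD eq_matI index_zero_mat)
  have Dy: "0 \<le> (\<Sum>k<m. D $$ (i, k) * y k)" if "i < n" for i
    using Dn[OF that] yp by (intro sum_nonneg) (auto simp: less_imp_le)
  have "0 < (\<Sum>k<m. D $$ (i, k) * y k)"
    using ik Dn[OF ik(1)] yp by (intro sum_pos2[of _ k]) (auto simp: less_le)
  then have "w i * (\<Sum>k<m. D $$ (i, k) * y k) < 0" using wneg[OF ik(1)] by (simp add: mult_neg_pos)
  then have "(\<Sum>i<n. w i * (\<Sum>k<m. D $$ (i, k) * y k)) < (\<Sum>i<n. 0)"
    using ik(1) wneg Dy by (intro sum_strict_mono_ex1) (auto intro!: mult_nonpos_nonneg simp: less_imp_le)
  then have "0 < - (\<Sum>i<n. w i * (\<Sum>k<m. D $$ (i, k) * y k)) / (\<Sum>k<m. x k * y k)"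
    using perron_pairing_pos[OF t x] by (intro divide_pos_pos) auto
  then show ?thesis using sens_against_formula(2)[OF t x sep w Dc] by blast
qed

end

text \<open>
  If \<open>(L - t)\<inverse>\<close> were entrywise negative for \<open>t\<close> close below the eigenvalue \<open>\<mu>\<close>, its row sums
  \<open>-1/t\<close> would bound its norm by \<open>1/t\<close>, while \<open>1/(\<mu> - t)\<close> is one of its eigenvalues. The value
  \<open>t = 3\<mu>/4\<close> already gives a contradiction.
\<close>

lemma strong_laplacian_nonneg_resolvent_entry:
  assumes L: "strong_laplacian n L" and mu: "0 < \<mu>" "ev L (of_real \<mu>)"
    and sep: "\<And>z. ev L z \<Longrightarrow> z \<noteq> 0 \<Longrightarrow> 3 / 4 * \<mu> < Re z"
  shows "\<exists>i<n. \<exists>k<n. \<exists>w. 0 \<le> w k \<and>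
    (\<forall>j<n. (\<Sum>a<n. w a * L $$ (a, j)) - 3 / 4 * \<mu> * w j = (if j = i then 1 else 0))"
proof (rule ccontr)
  define t where "t = 3 / 4 * \<mu>"
  assume neg: "\<not> ?thesis"
  have "\<not> ev L (of_real t)" using sep[of "of_real t"] mu(1) by (auto simp: t_def)
  then have "\<exists>w. \<forall>j<n. (\<Sum>a<n. w a * L $$ (a, j)) - t * w j = (if j = i then 1 else 0)" for i
    by (rule solve_left[OF strong_laplacianD(1)[OF L]])
  \<comment> \<open>\<open>w i\<close> is row \<open>i\<close> of the inverse of
    \<open>L - t\<close>; the negated claim makes all its entries negative.\<close>
  then obtain w where w: "\<And>i j. j < n \<Longrightarrow> (\<Sum>a<n. w i a * L $$ (a, j)) - t * w i j = (if j = i then 1 else 0)"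
    by metis
  then have wneg: "w i k < 0" if "i < n" "k < n" for i k
    using neg that unfolding t_def by (meson not_less)
  have wsum: "(\<Sum>k<n. \<bar>w i k\<bar>) = 1 / t" if i: "i < n" for i
  proof -
    have "(\<Sum>j<n. (\<Sum>a<n. w i a * L $$ (a, j)) - t * w i j) = (\<Sum>j<n. if j = i then 1 else 0)"
      using w[of _ i] by (intro sum.cong) auto
    then have "- t * (\<Sum>k<n. w i k) = 1"
      using i strong_laplacian_row_vector_sum[OF L, of "w i"] by (simp add: sum_subtractf sum_distrib_left sum_negf)
    moreover have "(\<Sum>k<n. \<bar>w i k\<bar>) = - (\<Sum>k<n. w i k)"
      using wneg[OF i] unfolding sum_negf[symmetric] by (intro sum.cong) (auto simp: abs_of_neg)
    ultimately show ?thesis using mu(1) by (simp add: t_def field_simps)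
  qed
  obtain v k where v: "k < n" "v k \<noteq> 0"
    "\<And>i. i < n \<Longrightarrow> (\<Sum>j<n. complex_of_real (L $$ (i, j)) * v j) = of_real \<mu> * v i"
    using mu(2) ev_iff[OF strong_laplacianD(1)[OF L]] by blast
  define K where "K = Max ((\<lambda>i. cmod (v i)) ` {..<n})"
  have le: "cmod (v i) \<le> K" if "i < n" for i unfolding K_def using that by (intro Max_ge) auto
  have "K \<in> (\<lambda>i. cmod (v i)) ` {..<n}" unfolding K_def using v(1) by (intro Max_in) auto
  then obtain i where i: "i < n" "K = cmod (v i)" by auto
  have "0 < K" using le[OF v(1)] v(2) by (metis norm_le_zero_iff not_less order_trans)
  define S where "S = (\<Sum>a<n. of_real (w i a) * v a)"
  have "(\<Sum>j<n. of_real ((\<Sum>a<n. w i a * L $$ (a, j)) - t * w i j) * v j) = (\<Sum>j<n. if j = i then v i else 0)"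
    using w[of _ i] by (intro sum.cong) auto
  then have "v i = (\<Sum>j<n. of_real (\<Sum>a<n. w i a * L $$ (a, j)) * v j) - of_real t * S"
    using i(1) by (simp add: S_def left_diff_distrib sum_subtractf sum_distrib_left mult.assoc del: of_real_sum)
  also have "(\<Sum>j<n. of_real (\<Sum>a<n. w i a * L $$ (a, j)) * v j)
      = (\<Sum>a<n. of_real (w i a) * (\<Sum>j<n. of_real (L $$ (a, j)) * v j))"
    unfolding of_real_sum sum_distrib_left sum_distrib_right by (subst sum.swap) (simp add: mult.assoc)
  also have "\<dots> = of_real \<mu> * S"
    by (simp add: v(3)) (simp add: S_def sum_distrib_left algebra_simps)
  finally have "v i = of_real (\<mu> - t) * S" by (simp add: algebra_simps)
  then have "cmod (v i) = \<bar>\<mu> - t\<bar> * cmod S" by (simp only: norm_mult norm_of_real)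
  then have "K = (\<mu> - t) * cmod S" using i(2) mu(1) by (simp add: t_def)
  also have "cmod S \<le> (\<Sum>a<n. \<bar>w i a\<bar> * K)"
    unfolding S_def using le by (intro order_trans[OF norm_sum] sum_mono) (auto simp: norm_mult intro: mult_left_mono)
  also have "\<dots> = K / t" using wsum[OF i(1)] by (simp flip: sum_distrib_right)
  finally have "K \<le> (\<mu> - t) * (K / t)" using mu(1) by (simp add: t_def)
  \<comment> \<open>The factor \<open>(\<mu> - t) / t\<close> equals 1/3 here; it is below 1 as soon
    as \<open>t\<close> exceeds half of \<open>\<mu>\<close>.\<close>
  then show False using \<open>0 < K\<close> mu(1) by (simp add: t_def field_simps)
qed

text \<open>
  For the cutset \<open>C = 1 b\<^sup>T\<close> the slave block is a translate of \<open>L2\<close>, with Perron value the sum of \<open>b\<close>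
  and the all-one vector as Perron vector.
\<close>

lemma rank_one_cutset:
  assumes L1: "strong_laplacian n L1" and L2: "strong_laplacian m L2" and i: "i < n" and t: "0 < t"
  defines "C \<equiv> mat m n (\<lambda>(a, b). if b = i then t else 0)"
  shows "master_slave n m L1 L2 C" and "master_slave.perron m L2 C t (\<lambda>_. 1)"
proof -
  have m: "0 < m" by (rule strong_laplacianD(3)[OF L2])
  have "C $$ (0, i) = t" using i m by (simp add: C_def)
  then have "C \<noteq> 0\<^sub>m m n" using i m t by auto
  then show ms: "master_slave n m L1 L2 C"
    using L1 L2 t by unfold_locales (auto simp: C_def nonneg_mat_def)
  then interpret master_slave n m L1 L2 C .
  have "(\<Sum>k<n. C $$ (a, k)) = t" if "a < m" for a
    using i that by (simp add: C_def)
  then show "perron t (\<lambda>_. 1)" by (simp add: perron_def M_row_sum)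
qed

text \<open>With a cutset leaving only master node \<open>i\<close>, \<open>x C\<close> is a
  multiple of a unit vector, so \<open>w\<close> is a positive multiple of row \<open>i\<close> of
  the resolvent, and a link ending at \<open>k\<close> is harmful or neutral when entry
  \<open>(i, k)\<close> is nonnegative. When \<open>L1\<close> has no sufficiently small positive
  eigenvalue the sign is not at stake, but a cutset with gap in the slave block and a defined
  sensitivity must still be produced.\<close>

lemma exists_hindering_opposite_link:
  assumes L1: "strong_laplacian n L1" and L2: "strong_laplacian m L2"
  shows "\<exists>C D s. C \<in> carrier_mat m n \<and> nonneg_mat C \<and> C \<noteq> 0\<^sub>m m n \<and>
    ev (L2 + row_sum_mat C) (spectral_gap (master_slave_laplacian L1 L2 C)) \<and>
    structural_perturbation n m D \<and> sens_against L1 L2 C D s \<and>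
    ((\<exists>\<mu>::real. 0 < \<mu> \<and> ev L1 (complex_of_real \<mu>) \<and> sufficiently_small_ev L1 \<mu>) \<longrightarrow> s \<le> 0)"
proof -
  have m: "0 < m" by (rule strong_laplacianD(3)[OF L2])
  have n: "0 < n" by (rule strong_laplacianD(3)[OF L1])
  have main: "\<exists>C D s. C \<in> carrier_mat m n \<and> nonneg_mat C \<and> C \<noteq> 0\<^sub>m m n \<and>
    ev (L2 + row_sum_mat C) (spectral_gap (master_slave_laplacian L1 L2 C)) \<and>
    structural_perturbation n m D \<and> sens_against L1 L2 C D s \<and> (0 \<le> w k \<longrightarrow> s \<le> 0)"
    if t: "0 < t" and sep: "\<And>z. ev L1 z \<Longrightarrow> z \<noteq> 0 \<Longrightarrow> t < Re z" and ik: "i < n" "k < n"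
      and w: "\<And>j. j < n \<Longrightarrow> (\<Sum>a<n. w a * L1 $$ (a, j)) - t * w j = (if j = i then 1 else 0)" for t i k w
  proof -
    define C where "C = mat m n (\<lambda>(a, b). if b = i then t else 0)"
    interpret master_slave n m L1 L2 C unfolding C_def by (rule rank_one_cutset(1)[OF L1 L2 ik(1) t])
    have y: "perron t (\<lambda>_. 1)" unfolding C_def by (rule rank_one_cutset(2)[OF L1 L2 ik(1) t])
    obtain x where x: "left_perron t x" using left_perron_exists[OF y] by blast
    define r where "r = t * (\<Sum>k<m. x k)"
    have "0 < (\<Sum>k<m. x k)" using perron_pairing_pos[OF y x] by simp
    then have r: "0 < r" using t by (simp add: r_def)
    have rw: "(\<Sum>a<n. r * w a * L1 $$ (a, j)) - t * (r * w j) = (\<Sum>k<m. x k * C $$ (k, j))" if j: "j < n" for j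
    proof -
      have "(\<Sum>a<n. r * w a * L1 $$ (a, j)) - t * (r * w j) = r * ((\<Sum>a<n. w a * L1 $$ (a, j)) - t * w j)"
        by (simp add: sum_distrib_left algebra_simps)
      also have "\<dots> = (if j = i then r else 0)" using w[OF j] by simp
      also have "\<dots> = (\<Sum>k<m. x k * C $$ (k, j))"
        using j by (simp add: C_def r_def sum_distrib_left mult.commute)
      finally show ?thesis .
    qed
    note D = structural_perturbation_link_mat[OF ik(2) m]
    have Dc: "link_mat n m k 0 \<in> carrier_mat n m" using D by (simp add: structural_perturbation_def)
    note s = sens_against_formula[OF y x sep rw Dc]
    have "ev M (spectral_gap L)" using s(1) spectral_gap_facts(6)[OF y] by simp
    moreover have "0 \<le> w k \<longrightarrow> - (r * w k * 1) / (\<Sum>k<m. x k * 1) \<le> 0"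
      using r \<open>0 < (\<Sum>k<m. x k)\<close> by (simp add: divide_le_0_iff)
    ultimately show ?thesis
      using C(1-3) D s(2) unfolding link_mat_pairing[OF ik(2) m, of "\<lambda>i. r * w i" "\<lambda>_. 1"] by blast
  qed
  show ?thesis
  proof (cases "\<exists>\<mu>::real. 0 < \<mu> \<and> ev L1 (complex_of_real \<mu>) \<and> sufficiently_small_ev L1 \<mu>")
    case True
    then obtain \<mu> :: real where mu: "0 < \<mu>" "ev L1 (of_real \<mu>)" "sufficiently_small_ev L1 \<mu>" by blast
    have sep: "3 / 4 * \<mu> < Re z" if "ev L1 z" "z \<noteq> 0" for z
      using mu that by (cases "z = of_real \<mu>") (force simp: sufficiently_small_ev_def)+
    obtain i k w where "i < n" "k < n" "0 \<le> w k"
      "\<And>j. j < n \<Longrightarrow> (\<Sum>a<n. w a * L1 $$ (a, j)) - 3 / 4 * \<mu> * w j = (if j = i then 1 else 0)"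
      using strong_laplacian_nonneg_resolvent_entry[OF L1 mu(1,2) sep] by blast
    then show ?thesis using main[of "3 / 4 * \<mu>" i k w] mu(1) sep by (simp, blast)
  next
    case False
    obtain q where q: "cpoly L1 = [:0, 1:] * q" "\<And>z. poly q z = 0 \<Longrightarrow> 0 < Re z"
      using strong_laplacian_cpoly[OF L1] by blast
    \<comment> \<open>The element 1 keeps \<open>F\<close> nonempty when \<open>L1\<close> has no
      nonzero eigenvalue. Half the minimum is then a positive Perron value strictly left of all
      nonzero eigenvalues of \<open>L1\<close>.\<close>
    define F where "F = insert 1 (Re ` {z. ev L1 z \<and> z \<noteq> 0})"
    have fin: "finite F" using finite_ev[OF strong_laplacianD(1)[OF L1]] by (simp add: F_def)
    have "0 < r" if "r \<in> F" for r
      using that q(2) ev_iff_cpoly_root[OF strong_laplacianD(1)[OF L1]] q(1) by (auto simp: F_def)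
    moreover have "Min F \<in> F" using fin by (intro Min_in) (auto simp: F_def)
    ultimately have pos: "0 < Min F" by blast
    have sep: "Min F / 2 < Re z" if "ev L1 z" "z \<noteq> 0" for z
    proof -
      have "Min F \<le> Re z" using fin that by (intro Min_le) (auto simp: F_def)
      then show ?thesis using pos by linarith
    qed
    then have "\<not> ev L1 (of_real (Min F / 2))" using pos by fastforce
    then obtain w where "\<And>j. j < n \<Longrightarrow> (\<Sum>a<n. w a * L1 $$ (a, j)) - Min F / 2 * w j = (if j = 0 then 1 else 0)"
      using solve_left[OF strong_laplacianD(1)[OF L1], of "Min F / 2" "\<lambda>j. if j = 0 then 1 else 0"] by blast
    then show ?thesis using main[of "Min F / 2" 0 0 w] pos sep n False by (simp, blast)
  qed
qed

subsection \<open>Synchronizability\<close>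

lemma coupling_gamma_factor_pos:
  assumes "coupling_data \<rho> B"
  shows "0 < Min (Re ` {\<beta>. ev B \<beta>})"
proof -
  obtain d where d: "0 < d" "B \<in> carrier_mat d d" using assms by (auto simp: coupling_data_def)
  have "Min (Re ` {\<beta>. ev B \<beta>}) \<in> Re ` {\<beta>. ev B \<beta>}"
    using finite_ev[OF d(2)] ev_exists[OF d(2,1)] by (intro Min_in) auto
  then show ?thesis using assms by (auto simp: coupling_data_def)
qed

lemma same_synchronizabilityI:
  assumes "coupling_data \<rho> B" "0 < Re (spectral_gap L)" "Re (spectral_gap L') = Re (spectral_gap L)"
  shows "same_synchronizability \<rho> B L' L"
  using assms coupling_gamma_factor_pos[OF assms(1)]
  by (simp add: same_synchronizability_def critical_coupling_def coupling_gamma_def)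

lemma more_synchronizableI:
  assumes "coupling_data \<rho> B" "0 < Re (spectral_gap L)" "Re (spectral_gap L) < Re (spectral_gap L')"
  shows "more_synchronizable \<rho> B L' L"
  using assms coupling_gamma_factor_pos[OF assms(1)]
  by (simp add: more_synchronizable_def critical_coupling_def coupling_gamma_def
      coupling_data_def divide_strict_left_mono)

subsection \<open>Two-component graphs\<close>

text \<open>Translates reachability into the cut form of irreducibility: a set without outgoing
  links inside \<open>V\<close> contains everything reachable from it.\<close>

lemma strongly_connected_induced_edge:
  assumes sc: "strongly_connected (induce_subgraph (with_proj (link_graph N E)) V)"
    and S: "S \<noteq> {}" "S \<subset> V"
  shows "\<exists>i\<in>V - S. \<exists>j\<in>S. (j, i) \<in> E"
proof (rule ccontr)
  assume none: "\<not> ?thesis"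
  let ?H = "induce_subgraph (with_proj (link_graph N E)) V"
  obtain u v where u: "u \<in> S" "v \<in> V" "v \<notin> S" using S by blast
  then have "u \<rightarrow>\<^sup>*\<^bsub>?H\<^esub> v" using sc S by (auto simp: strongly_connected_def)
  then have "(u, v) \<in> (arcs_ends ?H)\<^sup>*" by (rule reachable_rtranclI)
  then have "v \<in> S"
  proof (induction rule: rtrancl_induct)
    case (step a b)
    then have "(a, b) \<in> E" "b \<in> V"
      by (auto simp: arcs_ends_conv induce_subgraph_def link_graph_def)
    then show ?case using none step.IH by blast
  qed (rule u(1))
  then show False using u(3) by simp
qed

lemma two_component_graph_edges:
  assumes "two_component_graph n m E"
  shows "0 < n" "0 < m" "E \<subseteq> {..<n + m} \<times> {..<n + m}" "finite E"
    and "S \<noteq> {} \<Longrightarrow> S \<subset> {..<n} \<Longrightarrow> \<exists>i\<in>{..<n} - S. \<exists>j\<in>S. (j, i) \<in> E"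
    and "T \<noteq> {} \<Longrightarrow> T \<subset> {n..<n + m} \<Longrightarrow> \<exists>i\<in>{n..<n + m} - T. \<exists>j\<in>T. (j, i) \<in> E"
    and "i < n \<Longrightarrow> n \<le> j \<Longrightarrow> (j, i) \<notin> E"
proof -
  let ?G = "with_proj (link_graph (n + m) E)"
  have E: "E \<subseteq> {..<n + m} \<times> {..<n + m}" "E \<inter> {n..<n + m} \<times> {..<n} = {}"
    and sccs: "pre_digraph.sccs ?G = {induce_subgraph ?G {..<n}, induce_subgraph ?G {n..<n + m}}"
    using assms by (auto simp: two_component_graph_def)
  have sc: "strongly_connected (induce_subgraph ?G {..<n})" "strongly_connected (induce_subgraph ?G {n..<n + m})"
    using sccs unfolding pre_digraph.sccs_def by blast+
  show "0 < n" "0 < m" using sc by (auto simp: strongly_connected_def)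
  show "E \<subseteq> {..<n + m} \<times> {..<n + m}" by (rule E(1))
  then show "finite E" by (rule finite_subset) simp
  show "S \<noteq> {} \<Longrightarrow> S \<subset> {..<n} \<Longrightarrow> \<exists>i\<in>{..<n} - S. \<exists>j\<in>S. (j, i) \<in> E"
    by (rule strongly_connected_induced_edge[OF sc(1)])
  show "T \<noteq> {} \<Longrightarrow> T \<subset> {n..<n + m} \<Longrightarrow> \<exists>i\<in>{n..<n + m} - T. \<exists>j\<in>T. (j, i) \<in> E"
    by (rule strongly_connected_induced_edge[OF sc(2)])
  show "(j, i) \<notin> E" if "i < n" "n \<le> j"
  proof
    assume "(j, i) \<in> E"
    then have "(j, i) \<in> E \<inter> {n..<n + m} \<times> {..<n}" using E(1) that by auto
    then show False using E(2) by blast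
  qed
qed

text \<open>A weakly connected spanning subgraph must cross between the two components. No link
  points back, so a crossing link belongs to the cutset; this makes \<open>C\<close>
  nonzero.\<close>

lemma two_component_graph_cut_edge:
  assumes E: "two_component_graph n m E"
    and T: "spanning_diverging_tree T (with_proj (link_graph (n + m) E))"
  shows "\<exists>i j. j < n \<and> i < m \<and> (j, n + i) \<in> E"
proof (rule ccontr)
  assume none: "\<not> ?thesis"
  note e = two_component_graph_edges[OF E]
  define V where "V = {..<n}"
  let ?G = "with_proj (link_graph (n + m) E)" and ?T = "with_proj (mk_symmetric T)"
  have T: "subgraph T ?G" "verts ?G = verts T" "strongly_connected ?T"
    using T unfolding spanning_diverging_tree_def spanning_def Digraph_Component.connected_def by blast+
  have arc: "(tail T a, head T a) \<in> E" if "a \<in> arcs T" for a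
  proof -
    have "compatible ?G T" "arcs T \<subseteq> arcs ?G" using T(1) by (simp_all add: subgraph_def)
    then have "tail T = fst" "head T = snd" "arcs T \<subseteq> E"
      by (simp_all add: compatible_def link_graph_def)
    then show ?thesis using that by auto
  qed
  have "verts ?T = {..<n + m}" using T(2) by (simp add: mk_symmetric_def link_graph_def)
  then have "0 \<in> verts ?T" "n \<in> verts ?T" using e(1,2) by simp_all
  then have "0 \<rightarrow>\<^sup>*\<^bsub>?T\<^esub> n" using T(3) unfolding strongly_connected_def by blast
  then have "(0, n) \<in> (arcs_ends ?T)\<^sup>*" by (rule reachable_rtranclI)
  then have "n \<in> V"
  proof (induction rule: rtrancl_induct)
    case (step a b)
    then have "(a, b) \<in> E \<or> (b, a) \<in> E"
      using arc by (auto simp: arcs_ends_conv mk_symmetric_def)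
    show ?case
    proof (rule ccontr)
      assume "b \<notin> V"
      then have "\<not> b < n" "a < n" using step.IH by (auto simp: V_def)
      then have "(a, b) \<in> E" using \<open>(a, b) \<in> E \<or> (b, a) \<in> E\<close> e(7)[of a b] by auto
      then have "b < n + m" using e(3) by auto
      then have "(a, n + (b - n)) \<in> E" "b - n < m" using \<open>(a, b) \<in> E\<close> \<open>\<not> b < n\<close> by simp_all
      then show False using none \<open>a < n\<close> by blast
    qed
  qed (use e(1) in \<open>simp add: V_def\<close>)
  then show False by (simp add: V_def)
qed

lemma laplacian_entry:
  assumes "W \<in> carrier_mat N N" "i < N" "j < N"
  shows "laplacian W $$ (i, j) = (if i = j then \<Sum>k<N. W $$ (i, k) else 0) - W $$ (i, j)"
  using assms row_sum_mat_simps[OF assms(1)] by (simp add: laplacian_def)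

lemma strong_laplacian_laplacian:
  assumes W: "W \<in> carrier_mat N N" "0 < N" "\<And>i j. i < N \<Longrightarrow> j < N \<Longrightarrow> 0 \<le> W $$ (i, j)"
    and edge: "\<And>S. S \<noteq> {} \<Longrightarrow> S \<subset> {..<N} \<Longrightarrow> \<exists>i\<in>{..<N} - S. \<exists>j\<in>S. 0 < W $$ (i, j)"
  shows "strong_laplacian N (laplacian W)"
proof -
  have "laplacian W \<in> carrier_mat N N"
    using W(1) by (simp add: laplacian_def minus_carrier_mat)
  moreover have "irreducible_Z N (\<lambda>i j. laplacian W $$ (i, j))"
    unfolding irreducible_Z_def
  proof (intro conjI allI impI)
    fix S :: "nat set"
    assume S: "S \<noteq> {} \<and> S \<subset> {..<N}"
    then obtain i j where ij: "i \<in> {..<N} - S" "j \<in> S" "0 < W $$ (i, j)" using edge by meson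
    then have "laplacian W $$ (i, j) < 0" using S by (subst laplacian_entry[OF W(1)]) auto
    with ij show "\<exists>i\<in>{..<N} - S. \<exists>j\<in>S. laplacian W $$ (i, j) < 0" by blast
  qed (use W in \<open>auto simp: laplacian_entry[OF W(1)]\<close>)
  moreover have "(\<Sum>j<N. laplacian W $$ (i, j)) = 0" if "i < N" for i
    using that by (simp add: laplacian_entry[OF W(1)] sum_subtractf)
  ultimately show ?thesis by (simp add: strong_laplacian_def)
qed

text \<open>The blocks in the theorem are given only through their product \<open>L\<close>; this
  identifies them with the blocks built from the weights. \<open>C\<close> has to be recovered
  before \<open>L2\<close>, which appears only together with the row sums of
  \<open>C\<close>.\<close>

lemma master_slave_laplacian_inject:
  assumes eq: "master_slave_laplacian L1 L2 C = master_slave_laplacian L1' L2' C'"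
    and "L1 \<in> carrier_mat n n" "L2 \<in> carrier_mat m m" "C \<in> carrier_mat m n"
    and "L1' \<in> carrier_mat n n" "L2' \<in> carrier_mat m m" "C' \<in> carrier_mat m n"
  shows "L1 = L1'" "L2 = L2'" "C = C'"
proof -
  have entries: "master_slave_laplacian A B D $$ (i, j) = (if i < n then if j < n then A $$ (i, j) else 0
    else if j < n then - D $$ (i - n, j) else (B + row_sum_mat D) $$ (i - n, j - n))"
    if "i < n + m" "j < n + m" "A \<in> carrier_mat n n" "B \<in> carrier_mat m m" "D \<in> carrier_mat m n" for A B D i j
    using that row_sum_mat_simps(1)[OF that(5)] by (auto simp: master_slave_laplacian_def)
  have E: "(if i < n then if j < n then L1 $$ (i, j) else 0
      else if j < n then - C $$ (i - n, j) else (L2 + row_sum_mat C) $$ (i - n, j - n))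
    = (if i < n then if j < n then L1' $$ (i, j) else 0
      else if j < n then - C' $$ (i - n, j) else (L2' + row_sum_mat C') $$ (i - n, j - n))"
    if "i < n + m" "j < n + m" for i j
    using entries[OF that assms(2-4)] entries[OF that assms(5-7)] unfolding eq by (rule trans[OF sym])
  show "L1 = L1'"
  proof (rule eq_matI)
    fix i j assume "i < dim_row L1'" "j < dim_col L1'"
    then show "L1 $$ (i, j) = L1' $$ (i, j)" using E[of i j] assms by auto
  qed (use assms in auto)
  show CC: "C = C'"
  proof (rule eq_matI)
    fix i j assume "i < dim_row C'" "j < dim_col C'"
    then show "C $$ (i, j) = C' $$ (i, j)" using E[of "n + i" j] assms by auto
  qed (use assms in auto)
  show "L2 = L2'"
  proof (rule eq_matI)
    fix i j assume "i < dim_row L2'" "j < dim_col L2'"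
    then show "L2 $$ (i, j) = L2' $$ (i, j)"
      using E[of "n + i" "n + j"] assms row_sum_mat_simps(1)[OF assms(4)] CC by auto
  qed (use assms in auto)
qed

subsection \<open>Weights without ties\<close>

text \<open>The distinguished cutset link from \<open>j0\<close> to \<open>n + i0\<close> is the one
  whose weight is varied to avoid ties.\<close>

locale weighted_two_component =
  fixes n m :: nat and E :: "nat rel" and j0 i0 :: nat
  assumes graph: "two_component_graph n m E"
    and cut: "j0 < n" "i0 < m" "(j0, n + i0) \<in> E"
begin

abbreviation N :: nat where "N \<equiv> n + m"

definition positive_weights :: "(nat \<times> nat \<Rightarrow> real) \<Rightarrow> bool" where
  "positive_weights w \<longleftrightarrow> (\<forall>e\<in>E. 0 < w e)"

definition link_weight :: "(nat \<times> nat \<Rightarrow> real) \<Rightarrow> nat \<Rightarrow> nat \<Rightarrow> real" where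
  "link_weight w i j = (if (j, i) \<in> E then w (j, i) else 0)"

definition master_weights :: "(nat \<times> nat \<Rightarrow> real) \<Rightarrow> real mat" where
  "master_weights w = mat n n (\<lambda>(i, j). link_weight w i j)"

definition slave_weights :: "(nat \<times> nat \<Rightarrow> real) \<Rightarrow> real mat" where
  "slave_weights w = mat m m (\<lambda>(i, j). link_weight w (n + i) (n + j))"

definition cut_weights :: "(nat \<times> nat \<Rightarrow> real) \<Rightarrow> real mat" where
  "cut_weights w = mat m n (\<lambda>(i, j). link_weight w (n + i) j)"

lemma carriers: "master_weights w \<in> carrier_mat n n" "slave_weights w \<in> carrier_mat m m" "cut_weights w \<in> carrier_mat m n"
  by (simp_all add: master_weights_def slave_weights_def cut_weights_def)

lemma weight_mat_blocks: "weight_mat N E w = four_block_mat (master_weights w) (0\<^sub>m n m) (cut_weights w) (slave_weights w)"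
proof (rule eq_matI)
  fix i j
  assume "i < dim_row (four_block_mat (master_weights w) (0\<^sub>m n m) (cut_weights w) (slave_weights w))"
    "j < dim_col (four_block_mat (master_weights w) (0\<^sub>m n m) (cut_weights w) (slave_weights w))"
  then have ij: "i < N" "j < N" using carriers[of w] by auto
  then show "weight_mat N E w $$ (i, j) = four_block_mat (master_weights w) (0\<^sub>m n m) (cut_weights w) (slave_weights w) $$ (i, j)"
    using two_component_graph_edges(7)[OF graph, of i j]
    by (auto simp: weight_mat_def master_weights_def slave_weights_def cut_weights_def link_weight_def)
qed (use carriers[of w] in \<open>auto simp: weight_mat_def\<close>)

lemma laplacian_weight_mat:
  "laplacian (weight_mat N E w) = master_slave_laplacian (laplacian (master_weights w)) (laplacian (slave_weights w)) (cut_weights w)"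
  unfolding weight_mat_blocks using carriers by (rule laplacian_master_slave)

lemma link_weight_nonneg: "positive_weights w \<Longrightarrow> 0 \<le> link_weight w i j"
  by (auto simp: link_weight_def positive_weights_def less_imp_le)

lemma link_weight_pos: "positive_weights w \<Longrightarrow> (j, i) \<in> E \<Longrightarrow> 0 < link_weight w i j"
  by (auto simp: link_weight_def positive_weights_def)

lemma master_slave_weights:
  assumes w: "positive_weights w"
  shows "master_slave n m (laplacian (master_weights w)) (laplacian (slave_weights w)) (cut_weights w)"
proof
  note e = two_component_graph_edges[OF graph]
  show "strong_laplacian n (laplacian (master_weights w))"
  proof (rule strong_laplacian_laplacian)
    fix S assume S: "S \<noteq> {}" "S \<subset> {..<n}"
    from e(5)[OF this] obtain i j where "i \<in> {..<n} - S" "j \<in> S" "(j, i) \<in> E" by blast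
    then show "\<exists>i\<in>{..<n} - S. \<exists>j\<in>S. 0 < master_weights w $$ (i, j)"
      using S link_weight_pos[OF w] by (intro bexI[of _ i] bexI[of _ j]) (auto simp: master_weights_def)
  qed (use e(1) carriers link_weight_nonneg[OF w] in \<open>auto simp: master_weights_def\<close>)
  show "strong_laplacian m (laplacian (slave_weights w))"
  proof (rule strong_laplacian_laplacian)
    fix S assume S: "S \<noteq> {}" "S \<subset> {..<m}"
    have "(+) n ` S \<noteq> {}" "(+) n ` S \<subset> {n..<n + m}"
    proof -
      obtain x where "x < m" "x \<notin> S" using S(2) by auto
      then have "n + x \<in> {n..<n + m}" "n + x \<notin> (+) n ` S" by auto
      moreover have "(+) n ` S \<subseteq> {n..<n + m}" using S(2) by auto
      ultimately show "(+) n ` S \<subset> {n..<n + m}" by (intro psubsetI) metis+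
    qed (use S in simp)
    from e(6)[OF this] obtain i j where ij: "i \<in> {n..<n + m} - (+) n ` S" "j \<in> S" "(n + j, i) \<in> E" by auto
    then have "i - n \<in> {..<m} - S" "n + (i - n) = i" by (auto simp: image_iff)
    with ij S show "\<exists>i\<in>{..<m} - S. \<exists>j\<in>S. 0 < slave_weights w $$ (i, j)"
      using link_weight_pos[OF w ij(3)] by (intro bexI[of _ "i - n"] bexI[of _ j]) (auto simp: slave_weights_def)
  qed (use e(2) carriers link_weight_nonneg[OF w] in \<open>auto simp: slave_weights_def\<close>)
  show "cut_weights w \<in> carrier_mat m n" by (rule carriers)
  show "nonneg_mat (cut_weights w)" using link_weight_nonneg[OF w] by (auto simp: nonneg_mat_def cut_weights_def)
  have "cut_weights w $$ (i0, j0) \<noteq> 0" using cut link_weight_pos[OF w cut(3)] by (simp add: cut_weights_def)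
  then show "cut_weights w \<noteq> 0\<^sub>m m n" using cut by auto
qed

abbreviation weighted_perron :: "(nat \<times> nat \<Rightarrow> real) \<Rightarrow> real \<Rightarrow> (nat \<Rightarrow> real) \<Rightarrow> bool" where
  "weighted_perron w \<equiv> master_slave.perron m (laplacian (slave_weights w)) (cut_weights w)"

text \<open>
  The only weights to be avoided: with a tie, the master component can keep the gap from growing when
  the cutset is reinforced, and \<open>\<lambda>\<^sub>2\<close> need not be simple.
\<close>

definition tied :: "(nat \<times> nat \<Rightarrow> real) \<Rightarrow> bool" where
  "tied w \<longleftrightarrow> (\<exists>z y. ev (laplacian (master_weights w)) z \<and> weighted_perron w (Re z) y)"

text \<open>The Perron value is strictly increasing in each weight of the cutset.\<close>

lemma finite_tied:
  assumes w: "positive_weights w"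
  shows "finite {s. 0 < s \<and> tied (w((j0, n + i0) := s))}"
proof -
  let ?v = "\<lambda>s. w((j0, n + i0) := s)"
  define B where "B = {s. 0 < s \<and> tied (?v s)}"
  have pos: "positive_weights (?v s)" if "0 < s" for s using w that by (auto simp: positive_weights_def)
  have master_weights: "master_weights (?v s) = master_weights w" for s
    by (rule eq_matI) (auto simp: master_weights_def link_weight_def)
  have slave_weights: "slave_weights (?v s) = slave_weights w" for s
    using cut by (intro eq_matI) (auto simp: slave_weights_def link_weight_def)
  have "\<exists>z y. ev (laplacian (master_weights w)) z \<and> weighted_perron (?v s) (Re z) y" if "s \<in> B" for s
    using that unfolding B_def tied_def master_weights by blast
  then obtain z where z: "\<And>s. s \<in> B \<Longrightarrow> ev (laplacian (master_weights w)) (z s)" "\<And>s. s \<in> B \<Longrightarrow> \<exists>y. weighted_perron (?v s) (Re (z s)) y"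
    by metis
  have mono: "Re (z s) < Re (z r)" if sr: "s \<in> B" "r \<in> B" "s < r" for s r
  proof -
    have s: "0 < s" "0 < r" using sr by (auto simp: B_def)
    obtain y y' where y: "weighted_perron (?v s) (Re (z s)) y" "weighted_perron (?v r) (Re (z r)) y'" using z(2) sr by metis
    interpret master_slave n m "laplacian (master_weights w)" "laplacian (slave_weights w)" "cut_weights (?v s)"
      using master_slave_weights[OF pos[OF s(1)]] unfolding master_weights slave_weights .
    have le: "cut_weights (?v s) $$ (i, j) \<le> cut_weights (?v r) $$ (i, j)" if "i < m" "j < n" for i j
      using that sr(3) by (simp add: cut_weights_def link_weight_def)
    have "cut_weights (?v s) $$ (i0, j0) = s" "cut_weights (?v r) $$ (i0, j0) = r"
      using cut by (simp_all add: cut_weights_def link_weight_def)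
    then have "cut_weights (?v r) \<noteq> cut_weights (?v s)" using sr(3) by auto
    with perron_mono(2)[OF _ carriers(3) le] y master_slave_weights[OF pos[OF s(2)]]
    show ?thesis unfolding master_weights slave_weights by blast
  qed
  \<comment> \<open>Different tied weights have different Perron values, all of them among the
    finitely many real parts of the spectrum of the master block, which does not see the varied
    weight.\<close>
  have "inj_on (\<lambda>s. Re (z s)) B"
    by (rule inj_onI) (metis less_irrefl linorder_neqE_linordered_idom mono)
  moreover have "finite ((\<lambda>s. Re (z s)) ` B)"
  proof (rule finite_subset)
    show "(\<lambda>s. Re (z s)) ` B \<subseteq> Re ` {z. ev (laplacian (master_weights w)) z}" using z(1) by blast
    have "laplacian (master_weights w) \<in> carrier_mat n n"
      using master_slave.L1[OF master_slave_weights[OF w]] by (rule strong_laplacianD)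
    then show "finite (Re ` {z. ev (laplacian (master_weights w)) z})" using finite_ev by blast
  qed
  ultimately show ?thesis using finite_imageD B_def by blast
qed

end

text \<open>The bound does not depend on the height \<open>y\<close>: a polynomial without roots on
  a vertical line is bounded away from 0 along the whole line.\<close>

lemma cmod_poly_linear_factors_ge:
  "(\<Prod>e\<leftarrow>es. \<bar>c - Re e\<bar>) \<le> cmod (poly (\<Prod>e\<leftarrow>es. [:- e, 1:]) (Complex c y))"
proof (induction es)
  case (Cons e es)
  have "\<bar>c - Re e\<bar> \<le> cmod (Complex c y - e)"
    using abs_Re_le_cmod[of "Complex c y - e"] by simp
  moreover have "0 \<le> (\<Prod>e\<leftarrow>es. \<bar>c - Re e\<bar>)" by (induction es) auto
  ultimately have "\<bar>c - Re e\<bar> * (\<Prod>e\<leftarrow>es. \<bar>c - Re e\<bar>)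
      \<le> cmod (Complex c y - e) * cmod (poly (\<Prod>e\<leftarrow>es. [:- e, 1:]) (Complex c y))"
    using Cons.IH by (intro mult_mono) auto
  moreover have "poly (\<Prod>e\<leftarrow>e # es. [:- e, 1:]) (Complex c y)
      = (Complex c y - e) * poly (\<Prod>e\<leftarrow>es. [:- e, 1:]) (Complex c y)"
    by (simp add: algebra_simps)
  ultimately show ?case by (simp only: norm_mult list.map prod_list.Cons)
qed simp

text \<open>Approximation from above keeps rational approximants of a positive vector
  positive.\<close>

lemma rational_vector_approx:
  fixes y :: "nat \<Rightarrow> real"
  shows "\<exists>v. (\<forall>k i. v k i \<in> \<rat> \<and> y i < v k i) \<and> (\<forall>i. (\<lambda>k. v k i) \<longlonglongrightarrow> y i)"
proof -
  have "\<exists>r\<in>\<rat>. y i < r \<and> r < y i + inverse (real (Suc k))" for k i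
    by (rule Rats_dense_in_real) simp
  then have "\<forall>p. \<exists>r. r \<in> \<rat> \<and> y (snd p) < r \<and> r < y (snd p) + inverse (real (Suc (fst p)))" by blast
  from choice[OF this] obtain f where
    f: "\<And>p. f p \<in> \<rat> \<and> y (snd p) < f p \<and> f p < y (snd p) + inverse (real (Suc (fst p)))" by blast
  define v where "v k i = f (k, i)" for k i
  have v: "v k i \<in> \<rat> \<and> y i < v k i \<and> v k i < y i + inverse (real (Suc k))" for k i
    using f[of "(k, i)"] by (simp add: v_def)
  have "(\<lambda>k. v k i) \<longlonglongrightarrow> y i" for i
  proof (rule tendsto_sandwich[where f = "\<lambda>_. y i" and h = "\<lambda>k. y i + inverse (real (Suc k))"])
    show "(\<lambda>k. y i + inverse (real (Suc k))) \<longlonglongrightarrow> y i"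
      using tendsto_add[OF tendsto_const LIMSEQ_inverse_real_of_nat] by simp
  qed (use v in \<open>auto intro!: always_eventually simp: less_imp_le simp del: of_nat_Suc\<close>)
  then show ?thesis using v by blast
qed

section \<open>Measurability, measure zero and density\<close>

context weighted_two_component
begin

abbreviation weight_measure :: "(nat \<times> nat \<Rightarrow> real) measure" where
  "weight_measure \<equiv> Pi\<^sub>M E (\<lambda>_. lborel)"

text \<open>The slave block in terms of single link weights, each a measurable coordinate. The
  diagonal sums over all tails because the cutset adds its row sums.\<close>

definition slave_block :: "(nat \<times> nat \<Rightarrow> real) \<Rightarrow> nat \<Rightarrow> nat \<Rightarrow> real" where
  "slave_block w i j = (if i = j then \<Sum>k<n + m. link_weight w (n + i) k else 0) - link_weight w (n + i) (n + j)"

lemma laplacian_master_weights_entry: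
  "i < n \<Longrightarrow> j < n \<Longrightarrow> laplacian (master_weights w) $$ (i, j) = (if i = j then \<Sum>k<n. link_weight w i k else 0) - link_weight w i j"
  unfolding laplacian_entry[OF carriers(1)] by (simp add: master_weights_def)

lemma laplacian_slave_weights_entry:
  "i < m \<Longrightarrow> j < m \<Longrightarrow> laplacian (slave_weights w) $$ (i, j)
    = (if i = j then \<Sum>k<m. link_weight w (n + i) (n + k) else 0) - link_weight w (n + i) (n + j)"
  unfolding laplacian_entry[OF carriers(2)] by (simp add: slave_weights_def)

lemma M_entry_slave_block:
  assumes "i < m" "j < m"
  shows "(laplacian (slave_weights w) + row_sum_mat (cut_weights w)) $$ (i, j) = slave_block w i j"
proof -
  have "row_sum_mat (cut_weights w) \<in> carrier_mat m m" by (rule row_sum_mat_simps(1)[OF carriers(3)])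
  moreover have "row_sum_mat (cut_weights w) $$ (i, j) = (if i = j then \<Sum>k<n. link_weight w (n + i) k else 0)"
    unfolding row_sum_mat_simps(2)[OF carriers(3) assms] using assms by (simp add: cut_weights_def)
  ultimately show ?thesis
    using assms by (simp add: laplacian_slave_weights_entry slave_block_def sum_lessThan_add)
qed

lemma weighted_perron_iff:
  assumes "positive_weights w"
  shows "weighted_perron w t y \<longleftrightarrow> (\<forall>i<m. 0 < y i) \<and> (\<forall>i<m. (\<Sum>j<m. slave_block w i j * y j) = t * y i)"
proof -
  interpret master_slave n m "laplacian (master_weights w)" "laplacian (slave_weights w)" "cut_weights w"
    by (rule master_slave_weights[OF assms])
  show ?thesis by (simp add: perron_def M_entry_slave_block)
qed

text \<open>The default 0 makes this a total function on the product space, whose points may have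
  nonpositive weights.\<close>

definition perron_value :: "(nat \<times> nat \<Rightarrow> real) \<Rightarrow> real" where
  "perron_value w = (if positive_weights w then SOME t. \<exists>y. weighted_perron w t y else 0)"

lemma weighted_perron_value:
  assumes w: "positive_weights w"
  shows "\<exists>y. weighted_perron w (perron_value w) y" and "weighted_perron w t y \<Longrightarrow> t = perron_value w"
proof -
  interpret master_slave n m "laplacian (master_weights w)" "laplacian (slave_weights w)" "cut_weights w"
    by (rule master_slave_weights[OF w])
  show *: "\<exists>y. weighted_perron w (perron_value w) y"
    using someI_ex[OF perron_exists] w by (simp add: perron_value_def)
  show "t = perron_value w" if t: "weighted_perron w t y"
  proof -
    obtain y' where y': "weighted_perron w (perron_value w) y'" using * by blast
    show ?thesis
      using perron_mono(1)[OF t C(1) order_refl y' master_slave_axioms]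
        perron_mono(1)[OF y' C(1) order_refl t master_slave_axioms] by simp
  qed
qed

text \<open>The Collatz-Wielandt formula: the Perron value is the maximum over positive
  \<open>v\<close> of the least quotient of \<open>M v\<close> by \<open>v\<close>. Pairing with the
  left Perron vector bounds the quotients. The strict inequality survives a small change of the
  Perron vector, so rational \<open>v\<close> suffice; taken extensional, they form a countable
  set.\<close>

lemma less_perron_value_iff:
  assumes w: "positive_weights w"
  shows "a < perron_value w \<longleftrightarrow> (\<exists>v \<in> {v \<in> {..<m} \<rightarrow>\<^sub>E \<rat>. \<forall>i<m. 0 < v i}. \<forall>i\<in>{..<m}. a * v i < (\<Sum>j<m. slave_block w i j * v j))"
    (is "_ \<longleftrightarrow> (\<exists>v\<in>?V. ?Q v)")
proof
  obtain y where y: "weighted_perron w (perron_value w) y" using weighted_perron_value(1)[OF w] by blast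
  interpret master_slave n m "laplacian (master_weights w)" "laplacian (slave_weights w)" "cut_weights w"
    by (rule master_slave_weights[OF w])
  have m: "{..<m} \<noteq> {}" using strong_laplacianD(3)[OF L2] by (auto simp: lessThan_empty_iff)
  {
    assume "\<exists>v\<in>?V. ?Q v"
    then obtain v where v: "\<And>i. i < m \<Longrightarrow> 0 < v i" "\<And>i. i < m \<Longrightarrow> a * v i < (\<Sum>j<m. slave_block w i j * v j)" by auto
    obtain x where x: "left_perron (perron_value w) x" using left_perron_exists[OF y] by blast
    then have xp: "\<And>i. i < m \<Longrightarrow> 0 < x i" by (simp add: left_perron_def)
    have "a * (\<Sum>i<m. x i * v i) = (\<Sum>i<m. x i * (a * v i))" by (simp add: sum_distrib_left algebra_simps)
    also have "\<dots> < (\<Sum>i<m. x i * (\<Sum>j<m. slave_block w i j * v j))"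
      using m xp v(2) by (intro sum_strict_mono) auto
    also have "\<dots> = perron_value w * (\<Sum>i<m. x i * v i)"
      using x by (intro left_right_pairing) (simp add: left_perron_def M_entry_slave_block)
    finally have "a * (\<Sum>i<m. x i * v i) < perron_value w * (\<Sum>i<m. x i * v i)" .
    moreover have "0 < (\<Sum>i<m. x i * v i)" using m xp v(1) by (intro sum_pos) auto
    ultimately show "a < perron_value w" by simp
  }
  {
    assume a: "a < perron_value w"
    have yp: "\<And>i. i < m \<Longrightarrow> 0 < y i" and My: "\<And>i. i < m \<Longrightarrow> (\<Sum>j<m. slave_block w i j * y j) = perron_value w * y i"
      using y unfolding weighted_perron_iff[OF w] by auto
    obtain v where v: "\<And>k i. v k i \<in> \<rat>" "\<And>k i. y i < v k i" "\<And>i. (\<lambda>k. v k i) \<longlonglongrightarrow> y i"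
      using rational_vector_approx[of y] by blast
    have "eventually (\<lambda>k. a * v k i < (\<Sum>j<m. slave_block w i j * v k j)) sequentially" if i: "i < m" for i
    proof -
      have "(\<lambda>k. (\<Sum>j<m. slave_block w i j * v k j) - a * v k i) \<longlonglongrightarrow> (\<Sum>j<m. slave_block w i j * y j) - a * y i"
        by (intro tendsto_intros v)
      moreover have "0 < (\<Sum>j<m. slave_block w i j * y j) - a * y i"
        unfolding My[OF i] using a yp[OF i] by simp
      ultimately have "eventually (\<lambda>k. 0 < (\<Sum>j<m. slave_block w i j * v k j) - a * v k i) sequentially"
        by (rule order_tendstoD(1))
      then show ?thesis by eventually_elim simp
    qed
    then have "eventually (\<lambda>k. \<forall>i\<in>{..<m}. a * v k i < (\<Sum>j<m. slave_block w i j * v k j)) sequentially"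
      by (intro eventually_ball_finite) auto
    then obtain k where k: "\<And>i. i < m \<Longrightarrow> a * v k i < (\<Sum>j<m. slave_block w i j * v k j)"
      by (auto simp: eventually_sequentially)
    have "0 < v k i" if "i < m" for i using yp[OF that] v(2)[of i k] by simp
    then show "\<exists>v\<in>?V. ?Q v"
      using v(1) k by (intro bexI[of _ "restrict (v k) {..<m}"]) auto
  }
qed

lemma component_measurable: "e \<in> E \<Longrightarrow> (\<lambda>w. w e) \<in> borel_measurable weight_measure"
  using measurable_component_singleton[of e E "\<lambda>_. lborel"] by simp

lemma link_weight_measurable[measurable]: "(\<lambda>w. link_weight w i j) \<in> borel_measurable weight_measure"
  unfolding link_weight_def by (cases "(j, i) \<in> E") (auto intro: component_measurable)

lemma slave_block_measurable[measurable]: "(\<lambda>w. slave_block w i j) \<in> borel_measurable weight_measure"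
  unfolding slave_block_def by measurable

lemma positive_weights_measurable[measurable]: "Measurable.pred weight_measure positive_weights"
proof -
  have "Measurable.pred weight_measure (\<lambda>w. 0 < w e)" if "e \<in> E" for e
    using component_measurable[OF that] by measurable
  then show ?thesis
    unfolding positive_weights_def using two_component_graph_edges(4)[OF graph] by (intro pred_intros_finite) auto
qed

lemma perron_value_measurable[measurable]: "perron_value \<in> borel_measurable weight_measure"
  unfolding borel_measurable_iff_greater
proof
  fix a
  let ?V = "{v \<in> {..<m} \<rightarrow>\<^sub>E \<rat>. \<forall>i<m. 0 < v i} :: (nat \<Rightarrow> real) set"
  let ?A = "\<lambda>v. {w \<in> space weight_measure. positive_weights w \<and> (\<forall>i\<in>{..<m}. a * v i < (\<Sum>j<m. slave_block w i j * v j))}"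
  have "countable ?V"
    by (rule countable_subset[OF _ countable_PiE[of "{..<m}" "\<lambda>_. \<rat>"]]) (auto simp: countable_rat)
  moreover have "?A v \<in> sets weight_measure" for v by measurable
  ultimately have "(\<Union>v\<in>?V. ?A v) \<in> sets weight_measure" by (intro sets.countable_UN'') auto
  moreover have "{w \<in> space weight_measure. \<not> positive_weights w \<and> a < 0} \<in> sets weight_measure" by measurable
  moreover have "{w \<in> space weight_measure. a < perron_value w} = (\<Union>v\<in>?V. ?A v) \<union> {w \<in> space weight_measure. \<not> positive_weights w \<and> a < 0}"
  proof (rule Set.set_eqI)
    fix w
    show "w \<in> {w \<in> space weight_measure. a < perron_value w} \<longleftrightarrow> w \<in> (\<Union>v\<in>?V. ?A v) \<union> {w \<in> space weight_measure. \<not> positive_weights w \<and> a < 0}"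
    proof (cases "positive_weights w")
      case True
      then show ?thesis using less_perron_value_iff[OF True, of a] by blast
    next
      case False
      then show ?thesis by (simp add: perron_value_def)
    qed
  qed
  ultimately show "{w \<in> space weight_measure. a < perron_value w} \<in> sets weight_measure" by simp
qed

text \<open>Along the vertical line through the Perron value, a zero in \<open>y\<close> is an
  eigenvalue of the master block that causes a tie.\<close>

definition norm_master_cpoly :: "(nat \<times> nat \<Rightarrow> real) \<Rightarrow> real \<Rightarrow> real" where
  "norm_master_cpoly w y = cmod (poly (cpoly (laplacian (master_weights w))) (Complex (perron_value w) y))"

lemma laplacian_master_weights_carrier: "laplacian (master_weights w) \<in> carrier_mat n n"
  by (simp add: laplacian_def minus_carrier_mat carriers)

lemma norm_master_cpoly_measurable[measurable]: "(\<lambda>w. norm_master_cpoly w y) \<in> borel_measurable weight_measure"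
proof -
  define l where "l w i j = (if i = j then \<Sum>k<n. link_weight w i k else 0) - link_weight w i j" for w i j
  have l[measurable]: "(\<lambda>w. l w i j) \<in> borel_measurable weight_measure" for i j
    unfolding l_def by measurable
  have entry: "map_mat complex_of_real (laplacian (master_weights w)) $$ (i, p i) = of_real (l w i (p i))"
    if "p permutes {0..<n}" "i \<in> {0..<n}" for w p i
  proof -
    have "i < n" "p i < n" using permutes_in_image[OF that(1), of i] that(2) by auto
    then show ?thesis
      using laplacian_master_weights_carrier[of w] by (simp add: laplacian_master_weights_entry l_def)
  qed
  have "norm_master_cpoly w y = cmod (\<Sum>p | p permutes {0..<n}. signof p *
      (\<Prod>i = 0..<n. (if i = p i then of_real (perron_value w) + \<i> * of_real y else 0) - of_real (l w i (p i))))" for w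
  proof -
    have "map_mat complex_of_real (laplacian (master_weights w)) \<in> carrier_mat n n" using laplacian_master_weights_carrier by simp
    then show ?thesis
      unfolding norm_master_cpoly_def Complex_eq
      by (subst poly_char_poly)
        (auto intro!: arg_cong[of _ _ cmod] sum.cong prod.cong arg_cong2[of _ _ _ _ "(*)"] simp: entry)
  qed
  then show ?thesis by simp
qed

text \<open>Replaces a quantifier over eigenvalues by countable ones. A root on the line gives small
  values at nearby rational heights by continuity; conversely, without a root the height-independent
  lower bound would be positive.\<close>

lemma tied_iff_norm_master_cpoly:
  assumes w: "positive_weights w"
  shows "tied w \<longleftrightarrow> (\<forall>k. \<exists>y::rat. norm_master_cpoly w (of_rat y) < inverse (real (Suc k)))"
proof
  note root = ev_iff_cpoly_root[OF laplacian_master_weights_carrier[of w]]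
  {
    assume "tied w"
    then obtain z where z: "ev (laplacian (master_weights w)) z" "Re z = perron_value w"
      unfolding tied_def using weighted_perron_value(2)[OF w] by blast
    then have "Complex (perron_value w) (Im z) = z" by (simp add: complex_eq_iff)
    then have zero: "norm_master_cpoly w (Im z) = 0" using z(1) root by (simp add: norm_master_cpoly_def)
    have "isCont (norm_master_cpoly w) (Im z)" unfolding norm_master_cpoly_def Complex_eq by (intro continuous_intros)
    show "\<forall>k. \<exists>y::rat. norm_master_cpoly w (of_rat y) < inverse (real (Suc k))"
    proof
      fix k
      have "eventually (\<lambda>y. norm_master_cpoly w y < inverse (real (Suc k))) (at (Im z))"
        using \<open>isCont (norm_master_cpoly w) (Im z)\<close> zero unfolding isCont_def
        by (intro order_tendstoD(2)) auto
      then obtain d where d: "0 < d" "\<And>y. y \<noteq> Im z \<Longrightarrow> dist y (Im z) < d \<Longrightarrow> norm_master_cpoly w y < inverse (real (Suc k))"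
        unfolding eventually_at by blast
      obtain y where "y \<in> \<rat>" "Im z < y" "y < Im z + d" using Rats_dense_in_real[of "Im z" "Im z + d"] d(1) by auto
      then have "norm_master_cpoly w y < inverse (real (Suc k))" using d(2)[of y] by (auto simp: dist_real_def)
      then show "\<exists>y::rat. norm_master_cpoly w (of_rat y) < inverse (real (Suc k))"
        using \<open>y \<in> \<rat>\<close> by (auto elim: Rats_cases)
    qed
  }
  {
    assume close: "\<forall>k. \<exists>y::rat. norm_master_cpoly w (of_rat y) < inverse (real (Suc k))"
    obtain es where es: "cpoly (laplacian (master_weights w)) = (\<Prod>e\<leftarrow>es. [:- e, 1:])"
      using char_poly_factorized[of "map_mat complex_of_real (laplacian (master_weights w))" n] laplacian_master_weights_carrier by auto
    define c where "c = (\<Prod>e\<leftarrow>es. \<bar>perron_value w - Re e\<bar>)"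
    have "c \<le> norm_master_cpoly w y" for y
      unfolding norm_master_cpoly_def es c_def by (rule cmod_poly_linear_factors_ge)
    then have "c < inverse (real (Suc k))" for k using close by (meson order.strict_trans1)
    then have "c \<le> 0" by (metis not_less order.asym reals_Archimedean)
    then have "\<exists>e\<in>set es. perron_value w = Re e"
    proof (rule contrapos_pp)
      assume "\<not> (\<exists>e\<in>set es. perron_value w = Re e)"
      then have "0 < c" unfolding c_def by (induction es) auto
      then show "\<not> c \<le> 0" by simp
    qed
    then obtain e where e: "e \<in> set es" "perron_value w = Re e" by blast
    then have "ev (laplacian (master_weights w)) e"
      unfolding root es poly_linear_factors_eq_0_iff by simp
    then show "tied w" unfolding tied_def using weighted_perron_value(1)[OF w] e(2) by auto
  }
qed

lemma tied_measurable: "{w \<in> space weight_measure. positive_weights w \<and> tied w} \<in> sets weight_measure"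
proof -
  have "{w \<in> space weight_measure. positive_weights w \<and> tied w}
    = {w \<in> space weight_measure. positive_weights w \<and> (\<forall>k. \<exists>y::rat. norm_master_cpoly w (of_rat y) < inverse (real (Suc k)))}"
    using tied_iff_norm_master_cpoly by blast
  also have "\<dots> \<in> sets weight_measure" by measurable
  finally show ?thesis .
qed

text \<open>Fubini, integrating first over the weight of the distinguished link: every section of
  the measurable set of positive tied weights is finite.\<close>

lemma AE_untied: "AE w in weight_measure. positive_weights w \<longrightarrow> \<not> tied w"
proof -
  define e0 where "e0 = (j0, n + i0)"
  define E' where "E' = E - {e0}"
  define B where "B = {w \<in> space weight_measure. positive_weights w \<and> tied w}"
  have E: "E = insert e0 E'" "e0 \<notin> E'" "finite E'"
    using cut(3) two_component_graph_edges(4)[OF graph] by (auto simp: E'_def e0_def)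
  interpret product_sigma_finite "\<lambda>_. lborel :: real measure" by unfold_locales
  have B: "B \<in> sets weight_measure" unfolding B_def by (rule tied_measurable)
  have "emeasure weight_measure B = (\<integral>\<^sup>+ w. indicator B w \<partial>weight_measure)" using B by simp
  also have "\<dots> = (\<integral>\<^sup>+ x. (\<integral>\<^sup>+ s. indicator B (x(e0 := s)) \<partial>lborel) \<partial>Pi\<^sub>M E' (\<lambda>_. lborel))"
    using B unfolding E(1) by (intro product_nn_integral_insert E) auto
  also have "\<dots> = (\<integral>\<^sup>+ x. 0 \<partial>Pi\<^sub>M E' (\<lambda>_. lborel :: real measure))"
  proof (rule nn_integral_cong)
    fix x :: "nat \<times> nat \<Rightarrow> real"
    have "finite {s. x(e0 := s) \<in> B}"
    \<comment> \<open>The outer point \<open>x\<close> need not have positive weights; a point of a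
      nonempty section supplies the positive weights from which finiteness is derived.\<close>
    proof (cases "\<exists>s. x(e0 := s) \<in> B")
      case True
      then obtain s where "positive_weights (x(e0 := s))" by (auto simp: B_def)
      from finite_tied[OF this]
      show ?thesis
        by (rule rev_finite_subset) (use cut(3) in \<open>auto simp: B_def positive_weights_def e0_def\<close>)
    qed auto
    then have "AE s in lborel. s \<notin> {s. x(e0 := s) \<in> B}"
      by (intro AE_not_in finite_imp_null_set_lborel)
    then have "(\<integral>\<^sup>+ s. indicator B (x(e0 := s)) \<partial>lborel) = (\<integral>\<^sup>+ (s::real). 0 \<partial>lborel)"
      by (intro nn_integral_cong_AE) (auto elim!: eventually_mono simp: indicator_def)
    then show "(\<integral>\<^sup>+ s. indicator B (x(e0 := s)) \<partial>lborel) = 0" by simp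
  qed
  finally have "B \<in> null_sets weight_measure" using B by (simp add: null_sets_def)
  then show ?thesis by (rule AE_I') (auto simp: B_def)
qed

lemma adjacency_weight_mat:
  "positive_weights w \<Longrightarrow> adjacency_on N E (weight_mat N E w)"
  by (auto simp: adjacency_on_def weight_mat_def positive_weights_def less_imp_le)

lemma adjacency_on_imp_weight_mat:
  assumes "adjacency_on N E W"
  shows "\<exists>w. positive_weights w \<and> W = weight_mat N E w"
proof (intro exI conjI)
  let ?w = "\<lambda>e. W $$ (snd e, fst e)"
  show "positive_weights ?w"
    using assms two_component_graph_edges(3)[OF graph] by (auto simp: positive_weights_def adjacency_on_def)
  show "W = weight_mat N E ?w"
    using assms by (intro eq_matI) (auto simp: adjacency_on_def weight_mat_def less_le)
qed

text \<open>Raising one cutset weight by less than \<open>\<epsilon>\<close> changes two Laplacian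
  entries, both in the same row, by that amount; only finitely many of these values are
  tied.\<close>

lemma untied_dense:
  assumes w: "positive_weights w" and "0 < \<epsilon>"
  shows "\<exists>w'. positive_weights w' \<and> \<not> tied w' \<and> (\<forall>i<N. \<forall>j<N.
    \<bar>laplacian (weight_mat N E w') $$ (i, j) - laplacian (weight_mat N E w) $$ (i, j)\<bar> < \<epsilon>)"
proof -
  define e0 where "e0 = (j0, n + i0)"
  have e0: "0 < w e0" using w cut(3) by (simp add: positive_weights_def e0_def)
  have "infinite {w e0<..<w e0 + \<epsilon>}" using \<open>0 < \<epsilon>\<close> by (simp add: infinite_Ioo)
  then have "infinite ({w e0<..<w e0 + \<epsilon>} - {s. 0 < s \<and> tied (w(e0 := s))})"
    using finite_tied[OF w] unfolding e0_def by (rule Diff_infinite_finite[rotated])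
  then obtain s where "s \<in> {w e0<..<w e0 + \<epsilon>} - {s. 0 < s \<and> tied (w(e0 := s))}"
    using infinite_imp_nonempty by blast
  then have s: "w e0 < s" "s < w e0 + \<epsilon>" "\<not> tied (w(e0 := s))" using e0 by auto
  let ?w = "w(e0 := s)" and ?d = "s - w e0"
  have carrier: "weight_mat N E w \<in> carrier_mat N N" for w by (simp add: weight_mat_def)
  have diff: "weight_mat N E ?w $$ (i, j) = weight_mat N E w $$ (i, j) + (if j = j0 then if i = n + i0 then ?d else 0 else 0)"
    if "i < N" "j < N" for i j
    using that cut(3) by (auto simp: weight_mat_def e0_def)
  have row: "(\<Sum>k<N. weight_mat N E ?w $$ (i, k)) = (\<Sum>k<N. weight_mat N E w $$ (i, k)) + (if i = n + i0 then ?d else 0)"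
    if "i < N" for i
  proof -
    have "(\<Sum>k<N. weight_mat N E ?w $$ (i, k))
        = (\<Sum>k<N. weight_mat N E w $$ (i, k) + (if k = j0 then if i = n + i0 then ?d else 0 else 0))"
      using diff that by (intro sum.cong) auto
    then show ?thesis using cut(1) by (simp add: sum.distrib)
  qed
  have "\<bar>laplacian (weight_mat N E ?w) $$ (i, j) - laplacian (weight_mat N E w) $$ (i, j)\<bar> < \<epsilon>"
    if "i < N" "j < N" for i j
  proof -
    have "laplacian (weight_mat N E ?w) $$ (i, j) - laplacian (weight_mat N E w) $$ (i, j)
      = (if i = j \<and> i = n + i0 then ?d else 0) - (if j = j0 \<and> i = n + i0 then ?d else 0)"
      unfolding laplacian_entry[OF carrier that] row[OF that(1)] diff[OF that] by auto
    then show ?thesis using s(1,2) cut(1) \<open>0 < \<epsilon>\<close> by auto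
  qed
  moreover have "positive_weights ?w" using w e0 s(1) by (simp add: positive_weights_def)
  ultimately show ?thesis using s(3) by blast
qed

lemma generic_laplacianI:
  assumes P: "\<And>w. positive_weights w \<Longrightarrow> \<not> tied w \<Longrightarrow> P (laplacian (weight_mat N E w))"
  shows "generic_laplacian N E P"
  unfolding generic_laplacian_def
proof (intro conjI ballI allI impI)
  fix L and \<epsilon> :: real
  assume "L \<in> laplacians_on N E" "0 < \<epsilon>"
  then obtain w where w: "positive_weights w" "L = laplacian (weight_mat N E w)"
    using adjacency_on_imp_weight_mat by (auto simp: laplacians_on_def)
  obtain w' where "positive_weights w'" "\<not> tied w'" "\<forall>i<N. \<forall>j<N. \<bar>laplacian (weight_mat N E w') $$ (i, j) - L $$ (i, j)\<bar> < \<epsilon>"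
    using untied_dense[OF w(1) \<open>0 < \<epsilon>\<close>] unfolding w(2) by blast
  moreover have "laplacian (weight_mat N E w') \<in> laplacians_on N E"
    using adjacency_weight_mat[OF \<open>positive_weights w'\<close>] by (auto simp: laplacians_on_def)
  ultimately show "\<exists>L'\<in>laplacians_on N E. P L' \<and> (\<forall>i<N. \<forall>j<N. \<bar>L' $$ (i, j) - L $$ (i, j)\<bar> < \<epsilon>)"
    using P by blast
next
  show "AE w in weight_measure. (\<forall>e\<in>E. 0 < w e) \<longrightarrow> P (laplacian (weight_mat N E w))"
    using AE_untied by eventually_elim (use P in \<open>auto simp: positive_weights_def\<close>)
qed

end

section \<open>The four assertions for weights without ties\<close>

context master_slave
begin

text \<open>When the slave block determines the gap, the gap equals \<open>t\<close>, so nonzero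
  eigenvalues of \<open>L1\<close> have real part at least \<open>t\<close>; absence of ties makes
  this strict.\<close>

lemma perron_separated:
  assumes t: "perron t y" and gap: "ev M (spectral_gap L)"
    and untied: "\<And>z t y. ev L1 z \<Longrightarrow> perron t y \<Longrightarrow> Re z \<noteq> t"
    and z: "ev L1 z" "z \<noteq> 0"
  shows "t < Re z"
  using spectral_gap_facts(3)[OF t z] spectral_gap_perron[OF t gap] untied[OF z(1) t] by simp

end

theorem theorem2:
  shows "\<exists>(\<delta>b :: real mat \<Rightarrow> real) (k0 :: real mat \<Rightarrow> nat) (\<delta>c :: real mat \<Rightarrow> real).
    (\<forall>L. 0 < \<delta>b L \<and> 0 < \<delta>c L) \<and>
    (\<forall>n m E. two_component_graph n m E \<and>
       (\<exists>T. spanning_diverging_tree T (with_proj (link_graph (n + m) E))) \<longrightarrow>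
       generic_laplacian (n + m) E (\<lambda>L.
         \<forall>L1\<in>carrier_mat n n. \<forall>L2\<in>carrier_mat m m. \<forall>C\<in>carrier_mat m n.
         L = master_slave_laplacian L1 L2 C \<longrightarrow>
           (ev L1 (spectral_gap L) \<longrightarrow>
              (\<forall>\<rho> B \<Delta>. coupling_data \<rho> B \<and> structural_perturbation m n \<Delta> \<longrightarrow>
                 same_synchronizability \<rho> B (perturbed_along L1 L2 C \<Delta>) L)) \<and>
           (ev (L2 + row_sum_mat C) (spectral_gap L) \<longrightarrow>
              (\<forall>\<rho> B \<Delta>. coupling_data \<rho> B \<and> structural_perturbation m n \<Delta> \<longrightarrow>
                 more_synchronizable \<rho> B (perturbed_along L1 L2 C \<Delta>) L)) \<and>
           (ev (L2 + row_sum_mat C) (spectral_gap L) \<longrightarrow>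
              (\<exists>\<Delta> s. structural_perturbation n m \<Delta> \<and> sens_against L1 L2 C \<Delta> s \<and> 0 < s) \<and>
              (k0 L1 < n \<and>
                (0 < Re (spectral_gap L) \<and> Re (spectral_gap L) < \<delta>b L1 \<longrightarrow>
                 (\<forall>\<Delta>. structural_perturbation n m \<Delta> \<and> single_link_to (k0 L1) \<Delta> \<longrightarrow>
                    (\<exists>s. sens_against L1 L2 C \<Delta> s \<and> 0 < s)))) \<and>
              (zero_column_sums L1 \<and>
                 0 < Re (spectral_gap L) \<and> Re (spectral_gap L) < \<delta>c L1 \<longrightarrow>
                 (\<forall>\<Delta>. structural_perturbation n m \<Delta> \<longrightarrow>
                    (\<exists>s. sens_against L1 L2 C \<Delta> s \<and> 0 < s)))) \<and>
           (\<exists>C' \<Delta> s. C' \<in> carrier_mat m n \<and> nonneg_mat C' \<and> C' \<noteq> 0\<^sub>m m n \<and>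
              ev (L2 + row_sum_mat C') (spectral_gap (master_slave_laplacian L1 L2 C')) \<and>
              structural_perturbation n m \<Delta> \<and> sens_against L1 L2 C' \<Delta> s \<and>
              ((\<exists>\<mu>::real. 0 < \<mu> \<and> ev L1 (complex_of_real \<mu>) \<and>
                  sufficiently_small_ev L1 \<mu>) \<longrightarrow> s \<le> 0))))"
proof -
  \<comment> \<open>Thresholds are functions of the matrix, so one is chosen per matrix before any
    graph is given. The number of rows recovers the dimension, and 1 is a dummy value at matrices
    that are not strong Laplacians.\<close>
  have "\<exists>d. 0 < d \<and> (\<forall>n. strong_laplacian n L \<longrightarrow> anti_maximum n L d)" for L
  proof (cases "strong_laplacian (dim_row L) L")
    case True
    then obtain d where "0 < d" "anti_maximum (dim_row L) L d"
      using strong_laplacian_anti_maximum by blast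
    moreover have "n = dim_row L" if "strong_laplacian n L" for n
      using strong_laplacianD(1)[OF that] by simp
    ultimately show ?thesis by blast
  next
    case False
    have "\<not> strong_laplacian n L" for n
      using False strong_laplacianD(1)[of n L] by auto
    then show ?thesis by (intro exI[of _ 1]) simp
  qed
  then obtain \<delta> where \<delta>: "\<And>L. 0 < \<delta> L" "\<And>n L. strong_laplacian n L \<Longrightarrow> anti_maximum n L (\<delta> L)"
    by metis
  show ?thesis
  \<comment> \<open>Node 0 can serve as \<open>k0\<close>: below the threshold every entry of
    \<open>w\<close> is negative, at whichever node of the driving component the link ends.\<close>
  proof (intro exI[of _ \<delta>] exI[of _ "\<lambda>_. 0"] conjI allI impI, goal_cases)
    case (3 n m E)
    then obtain j0 i0 where graph: "two_component_graph n m E"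
      and cut: "j0 < n" "i0 < m" "(j0, n + i0) \<in> E"
      using two_component_graph_cut_edge by blast
    interpret G: weighted_two_component n m E j0 i0 using graph cut by unfold_locales
    show ?case
    proof (rule G.generic_laplacianI, intro ballI impI, goal_cases)
      case (1 w L1 L2 C)
      note w = 1(1,2) and carr = 1(3-5) and eq = 1(6)
      note W = G.master_slave_weights[OF w(1)]
      note inj = master_slave_laplacian_inject[OF eq[unfolded G.laplacian_weight_mat]
        strong_laplacianD(1)[OF master_slave.L1[OF W]] strong_laplacianD(1)[OF master_slave.L2[OF W]]
        G.carriers(3) carr]
      interpret master_slave n m L1 L2 C using W unfolding inj .
      obtain t y where t: "perron t y" using perron_exists by blast
      have untied: "Re z \<noteq> t" if "ev L1 z" "perron t y" for z t y
        using w(2) that unfolding G.tied_def inj by blast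
      note gap_pos = spectral_gap_facts(1)[OF t]
      have sep: "t < Re z" if "ev M (spectral_gap L)" "ev L1 z" "z \<noteq> 0" for z
        using perron_separated[OF t that(1) untied that(2,3)] .
      have small: "\<exists>s. sens_against L1 L2 C D s \<and> 0 < s"
        if "ev M (spectral_gap L)" "Re (spectral_gap L) < \<delta> L1" "structural_perturbation n m D" for D
      proof (rule opposite_perturbation_improves[OF t sep[OF that(1)] \<delta>(2)[OF L1] _ that(3)])
        show "t < \<delta> L1" using that(2) spectral_gap_perron[OF t that(1)] by simp
      qed
      have i: "ev L1 (spectral_gap L) \<longrightarrow>
          (\<forall>\<rho> B \<Delta>. coupling_data \<rho> B \<and> structural_perturbation m n \<Delta> \<longrightarrow>
            same_synchronizability \<rho> B (perturbed_along L1 L2 C \<Delta>) L)"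
        using same_synchronizabilityI[OF _ gap_pos spectral_gap_along_invariant] by blast
      have ii: "ev M (spectral_gap L) \<longrightarrow>
          (\<forall>\<rho> B \<Delta>. coupling_data \<rho> B \<and> structural_perturbation m n \<Delta> \<longrightarrow>
            more_synchronizable \<rho> B (perturbed_along L1 L2 C \<Delta>) L)"
        using more_synchronizableI[OF _ gap_pos spectral_gap_along_increases[OF _ t sep]] by blast
      have iii: "(\<exists>\<Delta> s. structural_perturbation n m \<Delta> \<and> sens_against L1 L2 C \<Delta> s \<and> 0 < s) \<and>
          (0 < n \<and> (0 < Re (spectral_gap L) \<and> Re (spectral_gap L) < \<delta> L1 \<longrightarrow>
            (\<forall>\<Delta>. structural_perturbation n m \<Delta> \<and> single_link_to 0 \<Delta> \<longrightarrow>
              (\<exists>s. sens_against L1 L2 C \<Delta> s \<and> 0 < s)))) \<and>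
          (zero_column_sums L1 \<and> 0 < Re (spectral_gap L) \<and> Re (spectral_gap L) < \<delta> L1 \<longrightarrow>
            (\<forall>\<Delta>. structural_perturbation n m \<Delta> \<longrightarrow>
              (\<exists>s. sens_against L1 L2 C \<Delta> s \<and> 0 < s)))"
        if gap: "ev M (spectral_gap L)"
        using exists_improving_opposite_link[OF t sep[OF gap]] small[OF gap] strong_laplacianD(3)[OF L1]
        by (intro conjI impI allI) simp_all
      show ?case
        unfolding eq by (intro conjI i ii impI[OF iii] exists_hindering_opposite_link[OF L1 L2])
    qed
  qed (simp_all add: \<delta>(1))
qed

end
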